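(* Let $\mathbb{J}\subset\mathbb{R}$ be an open interval, $x_0\in\mathbb{J}$, and let $\mathcal{S}(\cdot):\mathbb{J}\to\mathrm{Sym}_n$ be an analytic map such that the number of distinct eigenvalues of $\mathcal{S}(x)$ is a constant $r$ on $\mathbb{J}$. For $x\in\mathbb{J}$ let $\mathcal{P}^{\mathcal S}(x)=(P_i^{\mathcal S}(x))_{1\le i\le r}$ be the flag of eigenspaces of $\mathcal{S}(x)$; its type $\mathrm I=(q_i)_{1\le i\le r}$ is constant on $\mathbb{J}$. Fix $Q_0\in O(n)$ a matrix of eigenvectors of $\mathcal{S}(x_0)$. Let $\mathbb{J}^0_{\mathcal H}$ be the connected component of $x_0$ in $\{x\in\mathbb{J}:P_i^{\mathcal S}(x)\notin\mathrm{Cut}(P_i^{\mathcal S}(x_0)),\ 1\le i\le r\}$, and for $x\in\mathbb{J}^0_{\mathcal H}$ let $\mathcal{Q}^{\mathcal S}_{\mathcal H}(x)\in O(n)$ be the orthogonal matrix with $q_i$-blocks $$\left(\mathcal{Q}^{\mathcal S}_{\mathcal H}(x)\right)^{(i)}=\mathcal{H}^{\pi^i}_{(P_i^{\mathcal S}(x_0),P_i^{\mathcal S}(x))}\left(Q_0^{(i)}\right),\qquad1\le i\le r.$$ Then $\mathcal{Q}^{\mathcal S}_{\mathcal H}(\cdot):\mathbb{J}^0_{\mathcal H}\to O(n)$ is smooth; for every $x\in\mathbb{J}^0_{\mathcal H}$, $\mathcal{Q}^{\mathcal S}_{\mathcal H}(x)$ is a matrix of eigenvectors of $\mathcal{S}(x)$;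 and for every $x\in\mathbb{J}^0_{\mathcal H}$ and $1\le i\le r$, among all $W\in\mathrm{St}_{q_i}$ with $WW^T=P_i^{\mathcal S}(x)$, the block $\left(\mathcal{Q}^{\mathcal S}_{\mathcal H}(x)\right)^{(i)}$ minimizes the geodesic distance in $(\mathrm{St}_{q_i},g^{\mathrm{St}})$ to $Q_0^{(i)}$.
   Context: $\mathrm{Sym}_n$: real symmetric $n\times n$ matrices. For $\mathcal S\in\mathrm{Sym}_n$ with distinct eigenvalues $\lambda_1>\dots>\lambda_r$, let $P_i(\mathcal S)$ be the orthogonal projector onto the eigenspace of $\lambda_i$ and $q_i$ its rank; $(P_i(\mathcal S))_{1\le i\le r}$ is the flag of eigenspaces of $\mathcal S$, of type $(q_i)_{1\le i\le r}$. A matrix $Q\in O(n)$ is partitioned into consecutive column blocks $Q=(Q^{(1)}\ \dots\ Q^{(r)})$, $Q^{(i)}\in\mathbb{R}^{n\times q_i}$; $Q$ is called a matrix of eigenvectors of $\mathcal S$ if for every $i$ the columns of $Q^{(i)}$ form an orthonormal basis of the eigenspace of $\lambda_i$. $G_q$ is the set of rank-$q$ orthogonal projectors of $\mathbb{R}^n$. $\mathrm{St}_q=\{U\in\mathbb{R}^{n\times q}:U^TU=I_q\}$ has the Euclidean metric $g^{\mathrm{St}}_U(D_1,D_2)=\mathrm{tr}(D_1^TD_2)$ (geodesic distance between distinct connected components is $+\infty$). $\pi^{SG}_q:\mathrm{St}_q\to G_q$, $U\mapsto UU^T$, is a Riemannian submersion, where $G_q$ has the metric $\frac12\mathrm{tr}(\Delta\Delta')$;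 $\pi^i=\pi^{SG}_{q_i}$; the horizontal lift at $U$ of $\Delta\in T_PG_q$ is $\Delta^\sharp_U=\Delta U$. For $P=UU^T$, $\mathrm{Cut}(P)=\{YY^T:Y\in\mathrm{St}_q,\ \mathrm{rank}(U^TY)<q\}$ is the cut locus of $P$ in $G_q$. For $R\in G_q\setminus\mathrm{Cut}(P)$ and $UU^T=P$, the holonomy map is $\mathcal{H}^{\pi^{SG}_q}_{(P,R)}(U)=\mathrm{Exp}^{\mathrm{St}_q}_U\left((\mathrm{Log}^{G_q}_P(R))^\sharp_U\right)$; explicitly, with $\Omega=\frac12\log_m((I_n-2R)(I_n-2P))$ (principal logarithm), $\Delta=\mathrm{Log}^{G_q}_P(R)=\Omega P-P\Omega$, $A=U^T\Delta U$, $C=U^T\Delta^2U$, it equals $(U\ \ \Delta U)\exp_m\begin{pmatrix}A&-C\\ I_q&A\end{pmatrix}\begin{pmatrix}I_q\\ 0_q\end{pmatrix}\exp_m(-A)$. *)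

theory Defs
  imports "HOL-Analysis.Analysis"
begin

text \<open>
  Conventions. An \<open>n \<times> q\<close> matrix is an element of \<open>real^'m^'n\<close> together with a set \<open>I\<close> of
  \<open>q\<close> column indices, all columns outside \<open>I\<close> being zero; for \<open>I = UNIV\<close> this is the plain
  \<open>n \<times> q\<close> matrix. This lets the \<open>q\<^sub>i\<close>-blocks of a matrix \<open>Q :: real^'n^'n\<close>, whose
  widths depend on \<open>i\<close>, live in one type. Products, transposes, ranks and Frobenius inner products
  are unaffected by the zero columns. The inner product of \<open>real^'m^'n\<close> is
  \<open>D\<^sub>1 \<bullet> D\<^sub>2 = tr (D\<^sub>1\<^sup>T D\<^sub>2)\<close>, so \<open>norm\<close> is the norm of the metric
  \<open>g\<^sup>S\<^sup>t\<close>. The indices \<open>i\<close> of eigenvalues, projectors and blocks start at 1.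
\<close>

section \<open>Eigenspaces and flags\<close>

definition eigenspace :: "'a::field^'n^'n \<Rightarrow> 'a \<Rightarrow> ('a^'n) set" where
  "eigenspace A l = {v. A *v v = l *s v}"

definition eigenvalues :: "'a::field^'n^'n \<Rightarrow> 'a set" where
  "eigenvalues A = {l. \<exists>v. v \<noteq> 0 \<and> v \<in> eigenspace A l}"

text \<open>\<open>eigval A 1 > eigval A 2 > \<dots>\<close> are the distinct eigenvalues.\<close>

definition eigval :: "real^'n^'n \<Rightarrow> nat \<Rightarrow> real" where
  "eigval A i = rev (sorted_list_of_set (eigenvalues A)) ! (i - 1)"

definition orthogonal_projector :: "(real^'n) set \<Rightarrow> real^'n^'n" where
  "orthogonal_projector V =
     (THE P. transpose P = P \<and> P ** P = P \<and> range ((*v) P) = V)"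

definition eigproj :: "real^'n^'n \<Rightarrow> nat \<Rightarrow> real^'n^'n" where
  "eigproj A i = orthogonal_projector (eigenspace A (eigval A i))"

definition flag_type :: "real^'n^'n \<Rightarrow> nat \<Rightarrow> nat" where
  "flag_type A i = rank (eigproj A i)"

section \<open>Column blocks\<close>

text \<open>The indices of the \<open>i\<close>-th of the consecutive column blocks of widths \<open>q 1, q 2, \<dots>\<close>;
  \<open>card {..<j}\<close> is the position of the column \<open>j\<close>, counted from 0.\<close>

definition block :: "(nat \<Rightarrow> nat) \<Rightarrow> nat \<Rightarrow> 'n::{finite,linorder} set" where
  "block q i = {j. (\<Sum>k\<in>{1..<i}. q k) \<le> card {..<j} \<and> card {..<j} < (\<Sum>k\<in>{1..i}. q k)}"

definition restrict_cols :: "'m set \<Rightarrow> real^'m^'n \<Rightarrow> real^'m^'n" where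
  "restrict_cols I Q = (\<chi> k j. if j \<in> I then Q $ k $ j else 0)"

definition id_on :: "'m set \<Rightarrow> real^'m^'m" where
  "id_on I = restrict_cols I (mat 1)"

definition orthonormal_basis :: "'m set \<Rightarrow> ('m \<Rightarrow> real^'n) \<Rightarrow> (real^'n) set \<Rightarrow> bool" where
  "orthonormal_basis I b V \<longleftrightarrow>
     (\<forall>j\<in>I. \<forall>k\<in>I. b j \<bullet> b k = (if j = k then 1 else 0)) \<and> span (b ` I) = V"

definition eigenvector_matrix :: "real^('n::{finite,linorder})^('n::{finite,linorder}) \<Rightarrow> real^('n::{finite,linorder})^('n::{finite,linorder}) \<Rightarrow> bool" where
  "eigenvector_matrix A Q \<longleftrightarrow> orthogonal_matrix Q \<and>
     (\<forall>i\<in>{1..card (eigenvalues A)}.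
        orthonormal_basis (block (flag_type A) i) (\<lambda>j. column j Q) (eigenspace A (eigval A i)))"

section \<open>Matrix exponential and principal logarithm\<close>

definition matpow :: "real^'n^'n \<Rightarrow> nat \<Rightarrow> real^'n^'n" where
  "matpow A k = (((**) A) ^^ k) (mat 1)"

definition exp_m :: "real^'n^'n \<Rightarrow> real^'n^'n" where
  "exp_m A = (\<Sum>k. matpow A k /\<^sub>R fact k)"

text \<open>The principal logarithm is the unique logarithm whose complex eigenvalues lie in the open strip
  \<open>\<bar>Im z\<bar> < pi\<close>; it exists and is real if the real matrix has no eigenvalue in \<open>{..0}\<close>.\<close>

definition log_m :: "real^'n^'n \<Rightarrow> real^'n^'n" where
  "log_m M = (THE X. exp_m X = M \<and>
     (\<forall>z\<in>eigenvalues (map_matrix complex_of_real X). \<bar>Im z\<bar> < pi))"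

section \<open>Stiefel manifolds, Grassmannians and the holonomy map\<close>

text \<open>\<open>stiefel I\<close> is \<open>St\<^sub>q\<close> with \<open>q = card I\<close>.\<close>

definition stiefel :: "'m set \<Rightarrow> (real^'m^'n) set" where
  "stiefel I = {U. restrict_cols I U = U \<and> transpose U ** U = id_on I}"

text \<open>The cut locus of the projector \<open>P\<close> of rank \<open>card I\<close>; the rank condition does not depend on
  the choice of \<open>U\<close> with \<open>U U\<^sup>T = P\<close>.\<close>

definition cut_locus :: "'m::finite set \<Rightarrow> real^'n^'n \<Rightarrow> (real^'n^'n) set" where
  "cut_locus I P = {Y ** transpose Y | Y U :: real^'m^'n.
     Y \<in> stiefel I \<and> U \<in> stiefel I \<and> U ** transpose U = P \<and> rank (transpose U ** Y) < card I}"

definition grassmann_log :: "real^'n^'n \<Rightarrow> real^'n^'n \<Rightarrow> real^'n^'n" where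
  "grassmann_log P R =
     (let \<Omega> = (1/2) *\<^sub>R log_m ((mat 1 - 2 *\<^sub>R R) ** (mat 1 - 2 *\<^sub>R P)) in \<Omega> ** P - P ** \<Omega>)"

definition horizontal_lift :: "real^'m^'n \<Rightarrow> real^'n^'n \<Rightarrow> real^'m^'n" where
  "horizontal_lift U \<Delta> = \<Delta> ** U"

definition hcat :: "real^'a^'n \<Rightarrow> real^'b^'n \<Rightarrow> real^('a + 'b)^'n" where
  "hcat X Y = (\<chi> k j. case j of Inl a \<Rightarrow> X $ k $ a | Inr b \<Rightarrow> Y $ k $ b)"

definition vcat :: "real^'m^'a \<Rightarrow> real^'m^'b \<Rightarrow> real^'m^('a + 'b)" where
  "vcat X Y = (\<chi> k. case k of Inl a \<Rightarrow> X $ a | Inr b \<Rightarrow> Y $ b)"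

text \<open>The Riemannian exponential of \<open>St\<^sub>q\<close> at \<open>U\<close> for the Euclidean metric, in closed form. For
  \<open>D = \<Delta> U\<close> with \<open>\<Delta>\<close> symmetric, \<open>A = U\<^sup>T \<Delta> U\<close> and \<open>C = U\<^sup>T \<Delta>\<^sup>2 U\<close>.\<close>

definition stiefel_exp :: "'m set \<Rightarrow> real^'m^'n \<Rightarrow> real^'m^'n \<Rightarrow> real^'m^'n" where
  "stiefel_exp I U D =
     (let A = transpose U ** D; C = transpose D ** D in
      hcat U D ** exp_m (vcat (hcat A (- C)) (hcat (id_on I) A)) ** vcat (id_on I) 0 ** exp_m (- A))"

definition holonomy :: "'m::finite set \<Rightarrow> real^'n^'n \<Rightarrow> real^'n^'n \<Rightarrow> real^'m^'n \<Rightarrow> real^'m^'n" where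
  "holonomy I P R U = stiefel_exp I U (horizontal_lift U (grassmann_log P R))"

section \<open>Geodesic distance\<close>

text \<open>Riemannian distance on a submanifold \<open>M\<close> of a Euclidean space with the induced metric, as the
  infimum of the lengths of the piecewise \<open>C\<^sup>1\<close> curves in \<open>M\<close>; it is \<open>\<infinity>\<close> between points of
  distinct components. Lengths are nonnegative Lebesgue integrals, because the derivative in
  \<open>piecewise_C1_differentiable_on\<close> may be unbounded near the exceptional points.\<close>

definition curve_length :: "(real \<Rightarrow> 'a::euclidean_space) \<Rightarrow> ennreal" where
  "curve_length \<gamma> = (\<integral>\<^sup>+t\<in>{0..1}. ennreal (norm (vector_derivative \<gamma> (at t))) \<partial>lborel)"

definition geodesic_dist :: "'a::euclidean_space set \<Rightarrow> 'a \<Rightarrow> 'a \<Rightarrow> ennreal" where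
  "geodesic_dist M p q =
     (INF \<gamma>\<in>{\<gamma>. \<gamma> piecewise_C1_differentiable_on {0..1} \<and> \<gamma> ` {0..1} \<subseteq> M \<and>
                 \<gamma> 0 = p \<and> \<gamma> 1 = q}. curve_length \<gamma>)"

section \<open>Analytic and smooth curves\<close>

definition real_analytic_curve_on :: "(real \<Rightarrow> 'a::real_normed_vector) \<Rightarrow> real set \<Rightarrow> bool" where
  "real_analytic_curve_on f J \<longleftrightarrow>
     (\<forall>x\<in>J. \<exists>a::nat \<Rightarrow> 'a. \<exists>e>0. \<forall>y\<in>J. \<bar>y - x\<bar> < e \<longrightarrow> (\<lambda>k. (y - x) ^ k *\<^sub>R a k) sums f y)"

definition smooth_curve_on :: "(real \<Rightarrow> 'a::real_normed_vector) \<Rightarrow> real set \<Rightarrow> bool" where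
  "smooth_curve_on f J \<longleftrightarrow>
     (\<exists>D::nat \<Rightarrow> real \<Rightarrow> 'a. (\<forall>x\<in>J. D 0 x = f x) \<and>
        (\<forall>k. \<forall>x\<in>J. (D k has_vector_derivative D (Suc k) x) (at x within J)))"

section \<open>The holonomy lift of the flag of eigenspaces\<close>

definition holonomy_domain ::
    "(real \<Rightarrow> real^('n::{finite,linorder})^('n::{finite,linorder})) \<Rightarrow> real set \<Rightarrow> real \<Rightarrow> real set" where
  "holonomy_domain S J x0 = connected_component_set
     {x\<in>J. \<forall>i\<in>{1..card (eigenvalues (S x0))}.
        eigproj (S x) i \<notin> cut_locus (block (flag_type (S x0)) i :: 'n set) (eigproj (S x0) i)} x0"

text \<open>The sum juxtaposes the blocks: the \<open>i\<close>-th summand is taken on the columns of the \<open>i\<close>-th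
  block.\<close>

definition holonomy_lift ::
    "(real \<Rightarrow> real^('n::{finite,linorder})^('n::{finite,linorder})) \<Rightarrow> real \<Rightarrow> real^('n::{finite,linorder})^('n::{finite,linorder}) \<Rightarrow>
     real \<Rightarrow> real^('n::{finite,linorder})^('n::{finite,linorder})" where
  "holonomy_lift S x0 Q0 x =
     (\<Sum>i\<in>{1..card (eigenvalues (S x0))}. let I = block (flag_type (S x0)) i in
        restrict_cols I (holonomy I (eigproj (S x0) i) (eigproj (S x) i) (restrict_cols I Q0)))"

end

theory Submission
  imports Defs "HOL-Computational_Algebra.Fundamental_Theorem_Algebra"
begin

text \<open>
  Let \<open>P\<close>, \<open>R\<close> be projectors of equal rank, \<open>R\<close> outside the cut locus of \<open>P\<close>, and \<open>E = (P - R)\<^sup>2\<close>. The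
  holonomy map is \<open>U \<mapsto> exp(\<Omega>) U\<close>, where \<open>exp(\<Omega>) = (I - E + R P - P R) (I - E)\<^bsup>-1/2\<^esup>\<close> is the direct rotation
  carrying \<open>P\<close> to \<open>R\<close>; on frames of \<open>P\<close> it equals \<open>R (I - E)\<^bsup>-1/2\<^esup> U\<close>. Smoothness follows by bootstrapping:
  the derivatives of the eigenvalues, of the eigenprojectors and of the square root of \<open>I - E\<close> solve
  linear equations whose coefficients are as regular as these objects themselves. For minimality,
  the curve \<open>exp(t\<Omega>) U\<close> has length \<open>(\<Sum> \<theta>\<^sup>2)\<^bsup>1/2\<^esup>\<close>, with \<open>\<theta>\<close> running over the principal angles, and each
  principal vector, transported along a competing curve, moves on the unit sphere from its initial
  position into the range of \<open>R\<close>, hence by an angle of at least \<open>\<theta>\<close>.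
\<close>

text \<open>The closed formula for the Riemannian exponential collapses because \<Omega> is
  off-diagonal with respect to \<open>P\<close>: hence A = 0, and the pair (U, \<Omega> U)
  intertwines the block matrix with \<Omega>. As \<open>log_m\<close> is a definite description over
  all real matrices, recognising 2 \<Omega> as the principal logarithm needs uniqueness among
  arbitrary, possibly nondiagonalisable matrices; this is why complex matrices enter. Smoothness is
  read off from R (I - E)^(-1/2) U and not from \<Omega>, whose coefficient involves arcsin and is
  awkward at angle 0; only a square root remains, governed by C^2 = I - E. The cut locus condition
  is traded for det (I - E) \<noteq> 0, which is visibly open, so that two-sided derivatives are
  available. In the lower bound for lengths, separate estimates of the principal vectors would not
  produce the root of a sum of squares. Their angles are therefore added with the weights \<theta>,
  and Cauchy-Schwarz bounds the derivative of this one function by the length of the vector of all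
  \<theta> times the speed of the curve.\<close>

declare transpose_matrix_vector [simp del]

section \<open>Matrix algebra and symmetric matrices\<close>

lemma bounded_bilinear_matrix_mult:
  "bounded_bilinear ((**) :: real^'n^'m \<Rightarrow> real^'p^'n \<Rightarrow> real^'p^'m)"
  unfolding bilinear_conv_bounded_bilinear[symmetric] bilinear_def
  by (auto intro!: linearI simp: vec_eq_iff matrix_matrix_mult_def sum.distrib algebra_simps sum_distrib_left)

interpretation matrix_mult: bounded_bilinear "(**) :: real^'n^'m \<Rightarrow> real^'p^'n \<Rightarrow> real^'p^'m"
  by (rule bounded_bilinear_matrix_mult)

lemma linear_transpose: "linear (transpose :: real^'n^'m \<Rightarrow> real^'m^'n)"
  by (auto intro!: linearI simp: transpose_def vec_eq_iff)

lemmas transpose_simps = linear_add[OF linear_transpose] linear_diff[OF linear_transpose]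
  linear_scale[OF linear_transpose] linear_neg[OF linear_transpose] matrix_transpose_mul
  linear_0[OF linear_transpose]

lemmas matrix_distribs = matrix_mult.add_left matrix_mult.add_right matrix_mult.diff_left
  matrix_mult.diff_right matrix_mult.scaleR_left matrix_mult.scaleR_right
  matrix_mult.minus_left matrix_mult.minus_right

lemmas matrix_vector_simps = matrix_vector_mult_add_rdistrib matrix_vector_mult_diff_rdistrib
  matrix_vector_right_distrib matrix_vector_mult_diff_distrib matrix_vector_mult_scaleR
  scaleR_matrix_vector_assoc[symmetric] matrix_vector_mul_assoc[symmetric]

lemma subspace_range_matrix: "subspace (range ((*v) (A :: real^'n^'m)))"
  by (intro linear_subspace_image matrix_vector_mul_linear subspace_UNIV)

lemma inner_matrix_vector_left:
  fixes A :: "real^'n^'m"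
  shows "(A *v x) \<bullet> y = x \<bullet> (transpose A *v y)"
  by (metis dot_lmul_matrix inner_commute transpose_matrix_vector)

lemma matrix_vector_mult_sum_left:
  fixes f :: "'a \<Rightarrow> real^'n^'m"
  shows "(\<Sum>a\<in>A. f a) *v x = (\<Sum>a\<in>A. f a *v x)"
  by (induction A rule: infinite_finite_induct) (auto simp: matrix_vector_mult_add_rdistrib)

text \<open>The Rayleigh quotient attains its maximum on the compact unit sphere of T. At a
  maximiser v the residual w = A v - l v must vanish, since otherwise moving v in the direction w
  would increase the quotient.\<close>

lemma symmetric_invariant_eigenvector:
  fixes A :: "real^'n^'n"
  assumes sym: "transpose A = A" and T: "subspace T" and inv: "\<And>x. x \<in> T \<Longrightarrow> A *v x \<in> T"
    and "T \<noteq> {0}"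
  shows "\<exists>v\<in>T. norm v = 1 \<and> A *v v = (v \<bullet> (A *v v)) *\<^sub>R v"
proof -
  let ?S = "T \<inter> sphere 0 1"
  have "compact ?S" using closed_subspace[OF T] by (simp add: closed_Int_compact)
  obtain w where "w \<in> T" "w \<noteq> 0" using \<open>T \<noteq> {0}\<close> subspace_0[OF T] by auto
  then have "w /\<^sub>R norm w \<in> ?S" using T by (auto simp: subspace_scale)
  then have "?S \<noteq> {}" by blast
  have "continuous_on ?S (\<lambda>x. x \<bullet> (A *v x))"
    by (intro continuous_intros linear_continuous_on matrix_vector_mul_bounded_linear)
  from continuous_attains_sup[OF \<open>compact ?S\<close> \<open>?S \<noteq> {}\<close> this]
  obtain v where v: "v \<in> T" "norm v = 1" and
    sup: "\<And>x. x \<in> T \<Longrightarrow> norm x = 1 \<Longrightarrow> x \<bullet> (A *v x) \<le> v \<bullet> (A *v v)" by auto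
  define l where "l = v \<bullet> (A *v v)"
  have bd: "x \<bullet> (A *v x) \<le> l * (x \<bullet> x)" if "x \<in> T" for x
  proof (cases "x = 0")
    case False
    have "(x /\<^sub>R norm x) \<bullet> (A *v (x /\<^sub>R norm x)) \<le> l"
      unfolding l_def using T that False by (intro sup) (auto simp: subspace_scale)
    then have "x \<bullet> (A *v x) / (norm x)^2 \<le> l"
      by (simp add: matrix_vector_mult_scaleR power2_eq_square divide_simps)
    then show ?thesis using False by (simp add: divide_simps dot_square_norm)
  qed simp
  define w where "w = A *v v - l *\<^sub>R v"
  define C where "C = l * (w \<bullet> w) - w \<bullet> (A *v w)"
  have "w \<in> T" unfolding w_def using T v inv by (auto intro!: subspace_diff subspace_scale)
  have vv: "v \<bullet> v = 1" using v by (simp add: dot_square_norm)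
  have Avw: "v \<bullet> (A *v w) = w \<bullet> (A *v v)"
    using inner_matrix_vector_left[of A v w] sym by (simp add: inner_commute)
  \<comment> \<open>Insert v + t w into the quadratic bound. The first-order term is 2 t |w|^2,
    because w is exactly the residual, and everything else is of second order in t.\<close>
  have key: "2 * t * (w \<bullet> w) \<le> t^2 * C" for t
  proof -
    have "v + t *\<^sub>R w \<in> T" using T v \<open>w \<in> T\<close> by (auto intro!: subspace_add subspace_scale)
    from bd[OF this] have
      "l + 2 * t * (w \<bullet> (A *v v)) + t^2 * (w \<bullet> (A *v w)) \<le> l * (1 + 2 * t * (w \<bullet> v) + t^2 * (w \<bullet> w))"
      by (simp add: matrix_vector_simps inner_add_left inner_add_right Avw vv inner_commute[of w v]
          flip: l_def) (simp add: algebra_simps power2_eq_square)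
    moreover have "w \<bullet> w = w \<bullet> (A *v v) - l * (w \<bullet> v)"
      by (subst (2) w_def) (simp add: inner_diff_right)
    then have "2 * t * (w \<bullet> w) = 2 * t * (w \<bullet> (A *v v)) - l * (2 * t * (w \<bullet> v))"
      by algebra
    ultimately show ?thesis unfolding C_def distrib_left right_diff_distrib
      by (simp add: mult_ac)
  qed
  have "w = 0"
  proof (rule ccontr)
    assume "w \<noteq> 0"
    define a where "a = w \<bullet> w"
    have "a > 0" using \<open>w \<noteq> 0\<close> by (simp add: a_def)
    \<comment> \<open>A positive number above C; with t = a/D the inequality \<open>key\<close>
      becomes 2 a^2/D \<le> a^2/D.\<close>
    define D where "D = \<bar>C\<bar> + 1"
    have "D > 0" "C < D" by (auto simp: D_def)
    have "2 * (a / D) * a \<le> (a/D)^2 * C" using key[of "a/D"] by (simp only: a_def)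
    also have "\<dots> \<le> (a/D)^2 * D" using \<open>C < D\<close> by (intro mult_left_mono) auto
    finally have "2 * a^2 / D \<le> a^2 / D" using \<open>D > 0\<close> by (simp add: power2_eq_square)
    then show False using \<open>a > 0\<close> \<open>D > 0\<close> by (simp add: divide_simps)
  qed
  then show ?thesis using v unfolding w_def l_def by force
qed

lemma eigenvalues_iff:
  fixes A :: "real^'n^'n"
  shows "l \<in> eigenvalues A \<longleftrightarrow> (\<exists>v. v \<noteq> 0 \<and> A *v v = l *\<^sub>R v)"
  by (auto simp: eigenvalues_def eigenspace_def scalar_mult_eq_scaleR)

text \<open>The eigenvalue of a unit vector b is written as its Rayleigh quotient, so that a bare
  set of vectors carries the whole spectral decomposition.\<close>

definition eigenbasis :: "real^'n^'n \<Rightarrow> (real^'n) set \<Rightarrow> (real^'n) set \<Rightarrow> bool" where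
  "eigenbasis A T B \<longleftrightarrow> pairwise orthogonal B \<and> (\<forall>b\<in>B. norm b = 1) \<and> span B = T \<and>
     (\<forall>b\<in>B. A *v b = (b \<bullet> (A *v b)) *\<^sub>R b)"

text \<open>Split off one eigenvector; by symmetry its orthogonal complement in T is again invariant
  and of smaller dimension. The version for invariant subspaces is what later yields principal
  vectors inside the range of a projector.\<close>

lemma eigenbasis_exists:
  fixes A :: "real^'n^'n"
  assumes sym: "transpose A = A" and "subspace T" and "\<And>x. x \<in> T \<Longrightarrow> A *v x \<in> T"
  shows "\<exists>B. eigenbasis A T B"
  using assms(2,3)
proof (induction "dim T" arbitrary: T rule: less_induct)
  case less
  show ?case
  proof (cases "T = {0}")
    case True
    then show ?thesis by (intro exI[of _ "{}"]) (auto simp: eigenbasis_def)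
  next
    case False
    obtain v where v: "v \<in> T" "norm v = 1" "A *v v = (v \<bullet> (A *v v)) *\<^sub>R v"
      using symmetric_invariant_eigenvector[OF sym less.prems False] by blast
    let ?T = "T \<inter> {y. orthogonal v y}"
    have subT: "subspace ?T"
      using less.prems(1) by (intro subspace_inter subspace_orthogonal_to_vector)
    have "v \<notin> ?T" using v by (auto simp: orthogonal_def)
    then have "?T \<subset> T" using v by blast
    then have "dim ?T < dim T"
      by (metis dim_psubset less.prems(1) span_eq_iff subT)
    moreover have "A *v x \<in> ?T" if "x \<in> ?T" for x
    proof -
      have "v \<bullet> (A *v x) = (A *v v) \<bullet> x" by (simp add: inner_matrix_vector_left sym)
      also have "\<dots> = 0" using that by (subst v(3)) (simp add: orthogonal_def)
      finally show ?thesis using that less.prems by (simp add: orthogonal_def)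
    qed
    ultimately obtain B where B: "eigenbasis A ?T B" using less.hyps subT by blast
    have BT: "B \<subseteq> ?T" using B span_superset by (auto simp: eigenbasis_def)
    have "span (insert v B) = T"
    proof
      show "span (insert v B) \<subseteq> T" using v BT less.prems by (intro span_minimal) auto
      show "T \<subseteq> span (insert v B)"
      proof
        fix x assume "x \<in> T"
        then have "x - (v \<bullet> x) *\<^sub>R v \<in> ?T"
          using v less.prems
          by (auto simp: orthogonal_def inner_diff_right dot_square_norm intro!: subspace_diff subspace_scale)
        then have "x - (v \<bullet> x) *\<^sub>R v \<in> span B" using B by (simp add: eigenbasis_def)
        then show "x \<in> span (insert v B)" by (metis span_breakdown_eq)
      qed
    qed
    moreover have "pairwise orthogonal (insert v B)"
      using B BT by (auto simp: pairwise_insert eigenbasis_def orthogonal_commute)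
    ultimately show ?thesis using B v
      by (intro exI[of _ "insert v B"]) (auto simp: eigenbasis_def)
  qed
qed

lemma eigenbasis_finite: "eigenbasis A T B \<Longrightarrow> finite B"
  unfolding eigenbasis_def using pairwise_orthogonal_imp_finite by blast

lemma eigenbasis_expand:
  assumes "eigenbasis A T B" "x \<in> T"
  shows "(\<Sum>b\<in>B. (b \<bullet> x) *\<^sub>R b) = x"
  using orthonormal_basis_expand[of B x] assms eigenbasis_finite[OF assms(1)]
  by (auto simp: eigenbasis_def inner_commute)

lemma eigenbasis_inner:
  assumes "eigenbasis A T B" "b \<in> B" "c \<in> B"
  shows "b \<bullet> c = (if b = c then 1 else 0)"
  using assms by (auto simp: eigenbasis_def pairwise_def orthogonal_def dot_square_norm)

lemma eigenbasis_UNIV_ex: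
  "transpose A = A \<Longrightarrow> \<exists>B. eigenbasis (A::real^'n^'n) UNIV B"
  by (rule eigenbasis_exists) auto

lemma symmetric_eigvec_orthogonal:
  fixes A :: "real^'n^'n"
  assumes "transpose A = A" "A *v v = l *\<^sub>R v" "A *v w = m *\<^sub>R w" "l \<noteq> m"
  shows "v \<bullet> w = 0"
proof -
  have "l * (v \<bullet> w) = (A *v v) \<bullet> w" by (simp add: assms(2))
  also have "\<dots> = m * (v \<bullet> w)" by (simp add: inner_matrix_vector_left assms(1,3))
  finally show ?thesis using \<open>l \<noteq> m\<close> by simp
qed

text \<open>The eigenvectors of a symmetric matrix span the space. Nearly all identities between
  functions of E below are reduced by this rule to scalar identities in l.\<close>

lemma matrix_eqI_eigvec:
  fixes A :: "real^'n^'n" and M N :: "real^'n^'m"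
  assumes sym: "transpose A = A"
    and eq: "\<And>l v. A *v v = l *\<^sub>R v \<Longrightarrow> M *v v = N *v v"
  shows "M = N"
proof -
  obtain B where B: "eigenbasis A UNIV B" using eigenbasis_UNIV_ex[OF sym] by blast
  have "M *v x = N *v x" for x
  proof -
    have "M *v b = N *v b" if "b \<in> B" for b
      using B that by (intro eq[of _ "b \<bullet> (A *v b)"]) (auto simp: eigenbasis_def)
    then have "M *v (\<Sum>b\<in>B. (b \<bullet> x) *\<^sub>R b) = N *v (\<Sum>b\<in>B. (b \<bullet> x) *\<^sub>R b)"
      by (simp add: linear_sum[OF matrix_vector_mul_linear] matrix_vector_mult_scaleR)
    then show ?thesis using eigenbasis_expand[OF B] by simp
  qed
  then show ?thesis by (simp add: matrix_eq)
qed

section \<open>Outer products and functional calculus for symmetric matrices\<close>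

definition outer :: "real^'m \<Rightarrow> real^'n \<Rightarrow> real^'n^'m" where
  "outer b c = (\<chi> i j. b $ i * c $ j)"

lemma outer_mult_vector: "outer b c *v x = (c \<bullet> x) *\<^sub>R b"
  by (simp add: outer_def matrix_vector_mult_def inner_vec_def vec_eq_iff sum_distrib_left mult_ac)

lemma transpose_outer: "transpose (outer b c) = outer c b"
  by (simp add: outer_def transpose_def vec_eq_iff)

lemma inner_outer: "outer b c \<bullet> outer b' c' = (b \<bullet> b') * (c \<bullet> c')"
proof -
  have "outer b c \<bullet> outer b' c' = (\<Sum>i\<in>UNIV. \<Sum>j\<in>UNIV. (b $ i * b' $ i) * (c $ j * c' $ j))"
    by (simp add: outer_def inner_vec_def mult_ac)
  then show ?thesis by (simp add: inner_vec_def sum_product)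
qed

lemma inner_matrix_outer: "M \<bullet> outer b c = b \<bullet> (M *v c)"
  by (simp add: outer_def inner_vec_def matrix_vector_mult_def sum_distrib_left mult_ac)

text \<open>This is f(A) in the sense of the spectral calculus. The chosen eigenbasis is immaterial:
  \<open>matfun_eigvec\<close> determines the matrix on all eigenvectors.\<close>

definition matfun :: "(real \<Rightarrow> real) \<Rightarrow> real^'n^'n \<Rightarrow> real^'n^'n" where
  "matfun f A = (\<Sum>b\<in>(SOME B. eigenbasis A UNIV B). f (b \<bullet> (A *v b)) *\<^sub>R outer b b)"

lemma matfun_eigvec:
  fixes A :: "real^'n^'n"
  assumes sym: "transpose A = A" and v: "A *v v = l *\<^sub>R v"
  shows "matfun f A *v v = f l *\<^sub>R v"
proof -
  define B where "B = (SOME B. eigenbasis A UNIV B)"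
  have B: "eigenbasis A UNIV B" unfolding B_def using eigenbasis_UNIV_ex[OF sym] by (rule someI_ex)
  have "matfun f A *v v = (\<Sum>b\<in>B. (f (b \<bullet> (A *v b)) * (b \<bullet> v)) *\<^sub>R b)"
    unfolding matfun_def B_def[symmetric]
    by (simp add: matrix_vector_mult_sum_left outer_mult_vector flip: scaleR_matrix_vector_assoc)
  also have "\<dots> = (\<Sum>b\<in>B. f l *\<^sub>R ((b \<bullet> v) *\<^sub>R b))"
  proof (rule sum.cong[OF refl])
    fix b assume "b \<in> B"
    then have b: "A *v b = (b \<bullet> (A *v b)) *\<^sub>R b" using B by (auto simp: eigenbasis_def)
    have "b \<bullet> v = 0" if "b \<bullet> (A *v b) \<noteq> l"
      using symmetric_eigvec_orthogonal[OF sym b v that] .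
    then show "(f (b \<bullet> (A *v b)) * (b \<bullet> v)) *\<^sub>R b = f l *\<^sub>R ((b \<bullet> v) *\<^sub>R b)" by fastforce
  qed
  also have "\<dots> = f l *\<^sub>R v" using eigenbasis_expand[OF B, of v] by (metis UNIV_I scaleR_sum_right)
  finally show ?thesis .
qed

lemma transpose_matfun: "transpose (matfun f A) = matfun f A"
  unfolding matfun_def by (simp add: linear_sum[OF linear_transpose] transpose_simps transpose_outer)

text \<open>A matrix commuting with A maps each eigenspace of A into itself, where f(A) is a
  scalar.\<close>

lemma matfun_commute:
  fixes A :: "real^'n^'n"
  assumes sym: "transpose A = A" and com: "A ** M = M ** A"
  shows "matfun f A ** M = M ** matfun f A"
proof (rule matrix_eqI_eigvec[OF sym])
  fix l v assume v: "A *v v = l *\<^sub>R v"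
  have "A *v (M *v v) = l *\<^sub>R (M *v v)"
    by (simp add: matrix_vector_mul_assoc com) (simp add: v matrix_vector_simps)
  from matfun_eigvec[OF sym this, of f] show "(matfun f A ** M) *v v = (M ** matfun f A) *v v"
    using matfun_eigvec[OF sym v, of f]
    by (simp add: matrix_vector_simps)
qed

lemma matfun_inner_ge:
  fixes A :: "real^'n^'n"
  assumes sym: "transpose A = A"
    and f: "\<And>l v. v \<noteq> 0 \<Longrightarrow> A *v v = l *\<^sub>R v \<Longrightarrow> m \<le> f l"
  shows "m * (x \<bullet> x) \<le> x \<bullet> (matfun f A *v x)"
proof -
  obtain B where B: "eigenbasis A UNIV B" using eigenbasis_UNIV_ex[OF sym] by blast
  have fin: "finite B" using B eigenbasis_finite by blast
  have ex: "(\<Sum>b\<in>B. (b \<bullet> x) *\<^sub>R b) = x" using eigenbasis_expand[OF B] by simp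
  have "x \<bullet> x = (\<Sum>b\<in>B. (b \<bullet> x) *\<^sub>R b) \<bullet> x" by (simp add: ex)
  then have 1: "x \<bullet> x = (\<Sum>b\<in>B. (b \<bullet> x)^2)"
    by (simp add: inner_sum_left power2_eq_square)
  have "x \<bullet> (matfun f A *v x) = (\<Sum>b\<in>B. (b \<bullet> x) * (b \<bullet> (matfun f A *v x)))"
    by (subst (1) ex[symmetric]) (simp add: inner_sum_left)
  also have "\<dots> = (\<Sum>b\<in>B. f (b \<bullet> (A *v b)) * (b \<bullet> x)^2)"
  proof (rule sum.cong[OF refl])
    fix b assume "b \<in> B"
    then have b: "A *v b = (b \<bullet> (A *v b)) *\<^sub>R b" using B by (auto simp: eigenbasis_def)
    have "b \<bullet> (matfun f A *v x) = (matfun f A *v b) \<bullet> x"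
      by (simp add: inner_matrix_vector_left transpose_matfun)
    also have "\<dots> = f (b \<bullet> (A *v b)) * (b \<bullet> x)" by (subst matfun_eigvec[OF sym b]) simp
    finally show "(b \<bullet> x) * (b \<bullet> (matfun f A *v x)) = f (b \<bullet> (A *v b)) * (b \<bullet> x)^2"
      by (simp add: power2_eq_square)
  qed
  also have "\<dots> \<ge> (\<Sum>b\<in>B. m * (b \<bullet> x)^2)"
  proof (intro sum_mono mult_right_mono)
    fix b assume "b \<in> B"
    then show "m \<le> f (b \<bullet> (A *v b))" using B by (intro f[of b]) (auto simp: eigenbasis_def)
  qed auto
  finally show ?thesis by (simp add: 1 sum_distrib_left)
qed

section \<open>Curves of class \<open>C\<^sup>k\<close>\<close>

text \<open>Finite orders of differentiability are kept separate so that bootstrapping can be an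
  induction on k. The derivatives are two-sided, which suits open domains.\<close>

primrec Ck_on :: "nat \<Rightarrow> (real \<Rightarrow> 'a::real_normed_vector) \<Rightarrow> real set \<Rightarrow> bool" where
  "Ck_on 0 f J \<longleftrightarrow> continuous_on J f"
| "Ck_on (Suc k) f J \<longleftrightarrow>
     (\<exists>f'. (\<forall>x\<in>J. (f has_vector_derivative f' x) (at x)) \<and> Ck_on k f' J)"

lemma Ck_on_SucI:
  "(\<And>x. x \<in> J \<Longrightarrow> (f has_vector_derivative f' x) (at x)) \<Longrightarrow> Ck_on k f' J \<Longrightarrow> Ck_on (Suc k) f J"
  by auto

lemma Ck_on_cong:
  assumes "open J" "\<And>x. x \<in> J \<Longrightarrow> f x = g x" "Ck_on k f J"
  shows "Ck_on k g J"
proof (cases k)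
  case 0
  then show ?thesis using assms by (auto cong: continuous_on_cong)
next
  case (Suc m)
  with assms(3) obtain f' where
    f': "\<And>x. x \<in> J \<Longrightarrow> (f has_vector_derivative f' x) (at x)" and "Ck_on m f' J" by auto
  have "(g has_vector_derivative f' x) (at x)" if "x \<in> J" for x
    using has_vector_derivative_transform_within_open[OF f'[OF that] assms(1) that assms(2)] by simp
  with \<open>Ck_on m f' J\<close> show ?thesis using Suc by auto
qed

lemma Ck_on_subset: "Ck_on k f J \<Longrightarrow> K \<subseteq> J \<Longrightarrow> Ck_on k f K"
  by (induction k arbitrary: f) (auto intro: continuous_on_subset)

lemma Ck_on_continuous: "Ck_on k f J \<Longrightarrow> continuous_on J f"
  by (cases k) (auto intro!: continuous_at_imp_continuous_on intro: has_vector_derivative_continuous)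

lemma Ck_on_Suc_imp: "Ck_on (Suc k) f J \<Longrightarrow> Ck_on k f J"
proof (induction k arbitrary: f)
  case 0
  then show ?case using Ck_on_continuous[of "Suc 0" f J] by simp
next
  case (Suc k)
  then obtain f' where "\<forall>x\<in>J. (f has_vector_derivative f' x) (at x)" "Ck_on (Suc k) f' J"
    by (auto simp del: Ck_on.simps simp: Ck_on.simps(2)[of "Suc k"])
  with Suc.IH show ?case by (auto intro!: Ck_on_SucI)
qed

lemma Ck_on_add: "Ck_on k f J \<Longrightarrow> Ck_on k g J \<Longrightarrow> Ck_on k (\<lambda>x. f x + g x) J"
proof (induction k arbitrary: f g)
  case (Suc k)
  obtain f' where f': "\<And>x. x \<in> J \<Longrightarrow> (f has_vector_derivative f' x) (at x)" "Ck_on k f' J"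
    using Suc.prems(1) by auto
  obtain g' where "\<And>x. x \<in> J \<Longrightarrow> (g has_vector_derivative g' x) (at x)" "Ck_on k g' J"
    using Suc.prems(2) by auto
  with f' Suc.IH show ?case
    by (intro Ck_on_SucI[of _ _ "\<lambda>x. f' x + g' x"]) (auto intro!: derivative_intros)
qed (auto intro: continuous_intros)

lemma Ck_on_const: "Ck_on k (\<lambda>x. c) J"
  by (induction k arbitrary: c) (auto intro!: exI[of _ "\<lambda>x. 0"] derivative_intros)

lemma Ck_on_bilinear:
  assumes "bounded_bilinear h" "Ck_on k f J" "Ck_on k g J"
  shows "Ck_on k (\<lambda>x. h (f x) (g x)) J"
  using assms(2,3)
proof (induction k arbitrary: f g)
  case 0
  then show ?case using bounded_bilinear.continuous_on[OF assms(1)] by auto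
next
  case (Suc k)
  obtain f' where f': "\<And>x. x \<in> J \<Longrightarrow> (f has_vector_derivative f' x) (at x)" "Ck_on k f' J"
    using Suc.prems(1) by auto
  obtain g' where g': "\<And>x. x \<in> J \<Longrightarrow> (g has_vector_derivative g' x) (at x)" "Ck_on k g' J"
    using Suc.prems(2) by auto
  have "Ck_on k f J" "Ck_on k g J" using Suc.prems Ck_on_Suc_imp by blast+
  with f' g' Suc.IH show ?case
    by (intro Ck_on_SucI[of _ _ "\<lambda>x. h (f x) (g' x) + h (f' x) (g x)"] Ck_on_add
        bounded_bilinear.has_vector_derivative[OF assms(1)]) auto
qed

lemma Ck_on_linear:
  assumes "bounded_linear h" "Ck_on k f J"
  shows "Ck_on k (\<lambda>x. h (f x)) J"
  using assms(2)
proof (induction k arbitrary: f)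
  case 0
  then show ?case using bounded_linear.continuous_on[OF assms(1)] by auto
next
  case (Suc k)
  then obtain f' where "\<And>x. x \<in> J \<Longrightarrow> (f has_vector_derivative f' x) (at x)" "Ck_on k f' J" by auto
  with Suc.IH show ?case
    by (intro Ck_on_SucI[of _ _ "\<lambda>x. h (f' x)"] bounded_linear.has_vector_derivative[OF assms(1)]) auto
qed

lemma Ck_on_diff: "Ck_on k f J \<Longrightarrow> Ck_on k g J \<Longrightarrow> Ck_on k (\<lambda>x. f x - g x) J"
  using Ck_on_add[of k f J "\<lambda>x. - g x"] Ck_on_linear[OF bounded_linear_minus[OF bounded_linear_ident]]
  by auto

lemma Ck_on_sum:
  "(\<And>i. i \<in> I \<Longrightarrow> Ck_on k (f i) J) \<Longrightarrow> Ck_on k (\<lambda>x. \<Sum>i\<in>I. f i x) J"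
  by (induction I rule: infinite_finite_induct) (auto intro: Ck_on_add Ck_on_const)

lemmas Ck_on_scaleR = Ck_on_bilinear[OF bounded_bilinear_scaleR]

lemma Ck_on_euclidean:
  fixes f :: "real \<Rightarrow> 'a::euclidean_space"
  assumes "\<And>b. b \<in> Basis \<Longrightarrow> Ck_on k (\<lambda>x. f x \<bullet> b) J"
  shows "Ck_on k f J"
proof -
  have "Ck_on k (\<lambda>x. \<Sum>b\<in>Basis. (f x \<bullet> b) *\<^sub>R b) J"
    by (intro Ck_on_sum Ck_on_scaleR Ck_on_const assms)
  then show ?thesis by (simp add: euclidean_representation)
qed

text \<open>The derivatives witnessing different k are unrelated choices;
  \<open>vector_derivative\<close> is a canonical one and gives a single sequence. The smaller set K
  may be any subset of the open set, so the component in the theorem need not be examined.\<close>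

lemma smooth_curve_on_if_Ck_on:
  assumes "open J" "K \<subseteq> J" and Ck: "\<And>k. Ck_on k f J"
  shows "smooth_curve_on f K"
proof -
  define d :: "(real \<Rightarrow> 'a) \<Rightarrow> real \<Rightarrow> 'a" where "d = (\<lambda>g x. vector_derivative g (at x))"
  have step: "(g has_vector_derivative d g x) (at x)" "Ck_on k (d g) J"
    if g: "\<And>k. Ck_on k g J" and x: "x \<in> J" for g x k
  proof -
    obtain g' where g': "\<And>x. x \<in> J \<Longrightarrow> (g has_vector_derivative g' x) (at x)" "Ck_on k g' J"
      using g[of "Suc k"] by auto
    have eq: "d g y = g' y" if "y \<in> J" for y
      unfolding d_def using g'(1)[OF that] by (rule vector_derivative_at)
    show "(g has_vector_derivative d g x) (at x)" using g'(1)[OF x] eq[OF x] by simp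
    show "Ck_on k (d g) J" using Ck_on_cong[OF assms(1) _ g'(2)] eq by simp
  qed
  \<comment> \<open>Both conclusions of \<open>step\<close> are stated under x in J, so the empty J
    is treated apart.\<close>
  have Cd: "Ck_on k ((d ^^ n) f) J" for n k
  proof (cases "J = {}")
    case True
    then show ?thesis by (induction k arbitrary: n) auto
  next
    case False
    then show ?thesis by (induction n arbitrary: k) (use Ck step(2) in auto)
  qed
  show ?thesis unfolding smooth_curve_on_def
  proof (intro exI[of _ "\<lambda>n. (d ^^ n) f"] conjI ballI allI)
    fix n x assume "x \<in> K"
    then have "((d ^^ n) f has_vector_derivative (d ^^ Suc n) f x) (at x)"
      using step(1)[of "(d ^^ n) f", OF Cd] assms(2) by auto
    then show "((d ^^ n) f has_vector_derivative (d ^^ Suc n) f x) (at x within K)"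
      by (rule has_vector_derivative_at_within)
  qed simp
qed

text \<open>Solutions of linear equations inherit the smoothness of the coefficients: the derivative
  solves a linear equation with the same left-hand side.\<close>

lemma linear_equation_solution_continuous:
  assumes h: "bounded_bilinear h" and F: "continuous (at x) F" and b: "continuous (at x) b"
    and eq: "\<forall>\<^sub>F y in at x. h (F y) (z y) = b y" "h (F x) (z x) = b x"
    and m: "m > 0" "\<And>v. m * norm v \<le> norm (h (F x) v)"
  shows "continuous (at x) z"
proof -
  interpret h: bounded_bilinear h by (rule h)
  obtain K where K: "\<And>a v. norm (h a v) \<le> norm a * norm v * K" "K \<ge> 0" using h.nonneg_bounded by blast
  define K' where "K' = K + 1"
  have K': "norm (h a v) \<le> K' * norm a * norm v" for a v
    using K(1)[of a v] mult_nonneg_nonneg[OF norm_ge_zero[of a] norm_ge_zero[of v]]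
    unfolding K'_def distrib_right mult_1 by (simp only: mult_ac)
  have "K' > 0" using K(2) by (simp add: K'_def)
  have lF: "((\<lambda>y. F y - F x) \<longlongrightarrow> 0) (at x)" using F by (simp add: continuous_at LIM_zero)
  have lb: "((\<lambda>y. b y - b x) \<longlongrightarrow> 0) (at x)" using b by (simp add: continuous_at LIM_zero)
  let ?B = "\<lambda>y. (2 / m) * (norm (b y - b x) + K' * norm (F y - F x) * norm (z x))"
  \<comment> \<open>So close to x, the perturbation of the coefficient consumes at most half of the
    lower bound m; the other half gives the factor 2/m in \<open>?B\<close>.\<close>
  have ev: "\<forall>\<^sub>F y in at x. norm (F y - F x) < m / (2 * K')"
    using tendstoD[OF lF, of "m / (2 * K')"] m(1) \<open>K' > 0\<close> by (simp add: dist_norm)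
  have "\<forall>\<^sub>F y in at x. norm (z y - z x) \<le>
     ?B y"
    using ev eq(1)
  proof eventually_elim
    fix y assume Fy: "norm (F y - F x) < m / (2 * K')" and e: "h (F y) (z y) = b y"
    let ?d = "norm (z y - z x)"
    have "h (F x) (z y - z x) = (b y - b x) - h (F y - F x) (z y - z x) - h (F y - F x) (z x)"
      using e eq(2) by (simp add: h.diff_right h.diff_left)
    then have "norm (h (F x) (z y - z x)) \<le>
        norm (b y - b x) + norm (h (F y - F x) (z y - z x)) + norm (h (F y - F x) (z x))"
      by (metis (no_types, lifting) add_right_mono norm_triangle_ineq4 order_trans)
    also have "norm (h (F y - F x) (z y - z x)) \<le> K' * (m / (2 * K')) * ?d"
      using Fy \<open>K' > 0\<close> by (intro order_trans[OF K'] mult_right_mono mult_left_mono) auto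
    also have "\<dots> = m / 2 * ?d" using \<open>K' > 0\<close> by simp
    also have "norm (h (F y - F x) (z x)) \<le> K' * norm (F y - F x) * norm (z x)" by (rule K')
    finally have "m * ?d \<le> norm (b y - b x) + m / 2 * ?d + K' * norm (F y - F x) * norm (z x)"
      using m(2)[of "z y - z x"] by simp
    then show "?d \<le> ?B y"
      using m(1) by (simp add: field_simps)
  qed
  moreover have "((\<lambda>y. ?B y) \<longlongrightarrow>
     (2 / m) * (0 + K' * 0 * norm (z x))) (at x)"
    by (intro tendsto_intros tendsto_norm_zero lF lb)
  then have "((\<lambda>y. ?B y) \<longlongrightarrow> 0) (at x)"
    by simp
  ultimately have "((\<lambda>y. z y - z x) \<longlongrightarrow> 0) (at x)"
    by (rule Lim_null_comparison)
  then show ?thesis by (simp add: continuous_at LIM_zero_iff)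
qed

lemma has_vector_derivative_iff_quotient:
  "(f has_vector_derivative D) (at x) \<longleftrightarrow> ((\<lambda>y. (f y - f x) /\<^sub>R (y - x)) \<longlongrightarrow> D) (at x)"
proof -
  have eq: "norm ((f y - f x) - (y - x) *\<^sub>R D) / norm (y - x) = norm ((f y - f x) /\<^sub>R (y - x) - D)"
    if "y \<noteq> x" for y
  proof -
    have "(f y - f x) - (y - x) *\<^sub>R D = (y - x) *\<^sub>R ((f y - f x) /\<^sub>R (y - x) - D)"
      using that by (simp add: scaleR_diff_right)
    then show ?thesis using that by (simp del: scaleR_diff_right)
  qed
  have "(f has_vector_derivative D) (at x) \<longleftrightarrow>
      ((\<lambda>y. norm ((f y - f x) - (y - x) *\<^sub>R D) / norm (y - x)) \<longlongrightarrow> 0) (at x)"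
    by (simp add: has_vector_derivative_def has_derivative_iff_norm bounded_linear_scaleR_left)
  also have "\<dots> \<longleftrightarrow> ((\<lambda>y. norm ((f y - f x) /\<^sub>R (y - x) - D)) \<longlongrightarrow> 0) (at x)"
    by (intro filterlim_cong refl) (auto simp: eventually_at_filter eq simp del: real_norm_def)
  finally show ?thesis by (simp add: tendsto_norm_zero_iff LIM_zero_iff)
qed

text \<open>Subtracting the equations at y and x and dividing by y - x shows that the difference
  quotient of z solves an equation with the fixed coefficient F x and a convergent right-hand side.
  Coercivity turns convergence of the latter into convergence of the quotient; continuity of z comes
  from the preceding lemma.\<close>

lemma linear_equation_solution_derivative:
  fixes z :: "real \<Rightarrow> 'a::real_normed_vector"
  assumes h: "bounded_bilinear h" and F: "(F has_vector_derivative F') (at x)"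
    and b: "(b has_vector_derivative b') (at x)"
    and eq: "\<forall>\<^sub>F y in at x. h (F y) (z y) = b y" "h (F x) (z x) = b x"
    and m: "m > 0" "\<And>v. m * norm v \<le> norm (h (F x) v)"
    and z': "h (F x) z' = b' - h F' (z x)"
  shows "(z has_vector_derivative z') (at x)"
proof -
  interpret h: bounded_bilinear h by (rule h)
  let ?q = "\<lambda>g y. (g y - g x) /\<^sub>R (y - x)"
  let ?e = "\<lambda>y. ?q b y - b' - h (?q F y - F') (z y) - h F' (z y - z x)"
  have z: "(z \<longlongrightarrow> z x) (at x)"
    using linear_equation_solution_continuous[OF h has_vector_derivative_continuous[OF F]
        has_vector_derivative_continuous[OF b] eq m] by (simp add: continuous_at)
  have qF: "(?q F \<longlongrightarrow> F') (at x)" and qb: "(?q b \<longlongrightarrow> b') (at x)"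
    using F b by (simp_all add: has_vector_derivative_iff_quotient)
  have "\<forall>\<^sub>F y in at x. norm (?q z y - z') \<le>
      norm (?e y) / m"
    using eq(1)
  proof eventually_elim
    fix y assume e: "h (F y) (z y) = b y"
    \<comment> \<open>Pure cancellation, with p = h (F x) (z y), q = b y, r = b x, s = h F' (z x)
      and t = h F' (z y).\<close>
    have alg: "c *\<^sub>R p - c *\<^sub>R r - (b' - s) =
        c *\<^sub>R q - c *\<^sub>R r - b' - (c *\<^sub>R q - c *\<^sub>R p - t) - (t - s)" for c p q r s t
      by simp
    have "h (F x) (?q z y - z') = ?e y"
      unfolding h.diff_right h.diff_left h.scaleR_left h.scaleR_right scaleR_diff_right e eq(2) z'
      by (rule alg)
    then have "m * norm (?q z y - z') \<le>
      norm (?e y)"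
      using m(2)[of "?q z y - z'"] by simp
    then show "norm (?q z y - z') \<le>
      norm (?e y) / m"
      by (subst pos_le_divide_eq[OF m(1)]) (simp only: mult.commute)
  qed
  moreover have "((\<lambda>y. norm (?e y) / m)
     \<longlongrightarrow> norm (b' - b' - h (F' - F') (z x) - h F' (z x - z x)) / m) (at x)"
    using m(1) by (intro tendsto_intros h.tendsto qF qb z) auto
  then have "((\<lambda>y. norm (?e y) / m) \<longlongrightarrow> 0) (at x)"
    by (simp add: h.zero_left h.zero_right)
  ultimately have "((\<lambda>y. ?q z y - z') \<longlongrightarrow> 0) (at x)"
    by (rule Lim_null_comparison)
  then show ?thesis by (simp add: LIM_zero_iff has_vector_derivative_iff_quotient)
qed

lemma coercive_linear_surj:
  fixes f :: "'a::euclidean_space \<Rightarrow> 'a"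
  assumes f: "linear f" and m: "m > 0" "\<And>v. m * norm v \<le> norm (f v)"
  shows "\<exists>v. f v = c"
proof -
  have "inj f"
  proof (rule linear_injective_0[OF f, THEN iffD2], intro allI impI)
    fix v assume "f v = 0"
    then show "v = 0" using m(1) m(2)[of v] by (simp add: mult_le_0_iff)
  qed
  then show ?thesis using linear_injective_imp_surjective[OF f] by (metis surjD)
qed

lemma Ck_on_linear_equation_solution:
  fixes h :: "'b::real_normed_vector \<Rightarrow> 'a::euclidean_space \<Rightarrow> 'a"
  assumes h: "bounded_bilinear h" and "open J"
    and "\<And>x. x \<in> J \<Longrightarrow> h (F x) (z x) = b x"
    and m: "\<And>x. x \<in> J \<Longrightarrow> \<exists>m>0. \<forall>v. m * norm v \<le> norm (h (F x) v)"
    and "Ck_on k F J" "Ck_on k b J"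
  shows "Ck_on k z J"
  using assms(3,5,6)
proof (induction k arbitrary: z b)
  case 0
  have "continuous (at x) z" if x: "x \<in> J" for x
  proof -
    obtain m where "m > 0" "\<And>v. m * norm v \<le> norm (h (F x) v)" using m[OF x] by auto
    moreover have "\<forall>\<^sub>F y in at x. h (F y) (z y) = b y"
      using eventually_at_topological \<open>open J\<close> x 0 by blast
    ultimately show ?thesis
      using linear_equation_solution_continuous[OF h, of x F b z] 0 x \<open>open J\<close>
      by (simp add: continuous_on_eq_continuous_at)
  qed
  then show ?case by (auto intro: continuous_at_imp_continuous_on)
next
  case (Suc k)
  obtain F' where F': "\<And>x. x \<in> J \<Longrightarrow> (F has_vector_derivative F' x) (at x)" "Ck_on k F' J"
    using Suc.prems by auto
  obtain b' where b': "\<And>x. x \<in> J \<Longrightarrow> (b has_vector_derivative b' x) (at x)" "Ck_on k b' J"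
    using Suc.prems by auto
  have F: "Ck_on k F J" and b: "Ck_on k b J" using Suc.prems Ck_on_Suc_imp by blast+
  have z: "Ck_on k z J" using Suc.IH[OF Suc.prems(1) F b] .
  have surj: "\<exists>v. h (F x) v = c" if x: "x \<in> J" for x c
  proof -
    obtain m where m: "m > 0" "\<And>v. m * norm v \<le> norm (h (F x) v)" using m[OF x] by auto
    have "linear (h (F x))"
      by (intro bounded_linear.linear bounded_bilinear.bounded_linear_right h)
    then show ?thesis using m by (rule coercive_linear_surj)
  qed
  \<comment> \<open>Coercivity makes this pointwise choice the unique solution of the differentiated
    equation. No regularity of the choice is assumed: the induction hypothesis, applied to z' in
    place of z, supplies it.\<close>
  define z' where "z' x = (SOME v. h (F x) v = b' x - h (F' x) (z x))" for x
  have z': "h (F x) (z' x) = b' x - h (F' x) (z x)" if "x \<in> J" for x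
    unfolding z'_def using surj[OF that] by (rule someI_ex)
  show ?case
  proof (rule Ck_on_SucI)
    fix x assume x: "x \<in> J"
    obtain m where m: "m > 0" "\<And>v. m * norm v \<le> norm (h (F x) v)" using m[OF x] by auto
    have ev: "\<forall>\<^sub>F y in at x. h (F y) (z y) = b y"
      using eventually_at_topological \<open>open J\<close> x Suc.prems by blast
    show "(z has_vector_derivative z' x) (at x)"
      by (rule linear_equation_solution_derivative[OF h F'(1)[OF x] b'(1)[OF x] ev
          Suc.prems(1)[OF x] m z'[OF x]])
  next
    show "Ck_on k z' J"
      using z' F by (rule Suc.IH) (auto intro!: Ck_on_diff Ck_on_bilinear[OF h] F' b' z)
  qed
qed

text \<open>The quotient is the solution z of the linear equation g z = f.\<close>

lemma Ck_on_divide: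
  fixes f g :: "real \<Rightarrow> real"
  assumes "open J" "Ck_on k f J" "Ck_on k g J" "\<And>x. x \<in> J \<Longrightarrow> g x \<noteq> 0"
  shows "Ck_on k (\<lambda>x. f x / g x) J"
proof (rule Ck_on_linear_equation_solution[OF bounded_bilinear_mult assms(1) _ _ assms(3,2)])
  show "\<exists>m>0. \<forall>v. m * norm v \<le> norm (g x * v)" if "x \<in> J" for x
    using assms(4)[OF that] by (intro exI[of _ "\<bar>g x\<bar>"]) (simp add: abs_mult)
qed (use assms in auto)

section \<open>Analytic curves are smooth\<close>

text \<open>Termwise differentiation reproduces analyticity, hence the statement can be
  iterated.\<close>

lemma analytic_deriv:
  fixes f :: "real \<Rightarrow> real"
  assumes "open J" and f: "real_analytic_curve_on f J"
  shows "\<forall>x\<in>J. (f has_vector_derivative deriv f x) (at x)" "real_analytic_curve_on (deriv f) J"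
proof -
  have *: "\<exists>c e. e > 0 \<and> (\<forall>y. \<bar>y - x\<bar> < e \<longrightarrow> (\<lambda>k. c k * (y - x) ^ k) sums deriv f y \<and>
      (f has_field_derivative deriv f y) (at y))" if x: "x \<in> J" for x
  proof -
    obtain a e where e: "e > 0" and
      a: "\<And>y. y \<in> J \<Longrightarrow> \<bar>y - x\<bar> < e \<Longrightarrow> (\<lambda>k. (y - x) ^ k *\<^sub>R a k) sums f y"
      using f x unfolding real_analytic_curve_on_def by blast
    obtain d where d: "d > 0" "ball x d \<subseteq> J" using \<open>open J\<close> x openE by blast
    \<comment> \<open>The series is known to represent f only at points of J, so the radius is
      shrunk until the interval lies in J.\<close>
    define K where "K = min d e"
    have K: "K > 0" "\<And>y. \<bar>y - x\<bar> < K \<Longrightarrow> y \<in> J"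
      using d e by (auto simp: K_def dist_real_def subset_eq abs_minus_commute)
    have sm: "(\<lambda>k. a k * z ^ k) sums f (x + z)" if "norm z < K" for z
      using a[of "x + z"] K(2)[of "x + z"] that by (simp add: K_def mult.commute)
    define D where "D z = (\<Sum>n. diffs a n * z ^ n)" for z
    have D: "((\<lambda>z. \<Sum>n. a n * z ^ n) has_field_derivative D z) (at z)" if "norm z < K" for z
      unfolding D_def using sums_summable[OF sm] that by (rule termdiffs_strong')
    have sD: "(\<lambda>k. diffs a k * z ^ k) sums D z" if "norm z < K" for z
      unfolding D_def using termdiff_converges[OF that] sums_summable[OF sm] by (simp add: summable_sums)
    have fD: "(f has_field_derivative D (y - x)) (at y)" if y: "\<bar>y - x\<bar> < K" for y
    proof -
      have "((\<lambda>y. \<Sum>n. a n * (y - x) ^ n) has_field_derivative D (y - x)) (at y)"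
      proof (rule DERIV_cong[OF DERIV_chain2[OF D]])
        show "((\<lambda>y. y - x) has_real_derivative 1) (at y)" by (auto intro!: derivative_eq_intros)
      qed (use y in auto)
      moreover have "open {y. \<bar>y - x\<bar> < K}"
        by (intro open_Collect_less continuous_intros)
      moreover have "(\<Sum>n. a n * (y - x) ^ n) = f y" if "\<bar>y - x\<bar> < K" for y
        using sums_unique[OF sm[of "y - x"]] that by simp
      ultimately show ?thesis
        using y by (auto intro: has_field_derivative_transform_within_open)
    qed
    have "deriv f y = D (y - x)" if "\<bar>y - x\<bar> < K" for y
      using fD[OF that] by (rule DERIV_imp_deriv)
    then show ?thesis using K(1) sD fD by (intro exI[of _ "diffs a"] exI[of _ K]) auto
  qed
  show "\<forall>x\<in>J. (f has_vector_derivative deriv f x) (at x)"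
    using * by (force simp: has_real_derivative_iff_has_vector_derivative)
  show "real_analytic_curve_on (deriv f) J"
    unfolding real_analytic_curve_on_def
  proof
    fix x assume "x \<in> J"
    from *[OF this] obtain c e where "e > 0"
      "\<And>y. \<bar>y - x\<bar> < e \<Longrightarrow> (\<lambda>k. c k * (y - x) ^ k) sums deriv f y" by blast
    then show "\<exists>a e. e > 0 \<and> (\<forall>y\<in>J. \<bar>y - x\<bar> < e \<longrightarrow> (\<lambda>k. (y - x) ^ k *\<^sub>R a k) sums deriv f y)"
      by (intro exI[of _ c] exI[of _ e]) (simp add: mult.commute)
  qed
qed

lemma analytic_Ck_on_real:
  fixes f :: "real \<Rightarrow> real"
  assumes "open J" "real_analytic_curve_on f J"
  shows "Ck_on k f J"
  using assms(2)
proof (induction k arbitrary: f)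
  case 0
  show ?case using analytic_deriv(1)[OF assms(1) 0]
    by (auto intro!: continuous_at_imp_continuous_on intro: has_vector_derivative_continuous)
next
  case (Suc k)
  then show ?case using analytic_deriv[OF assms(1) Suc.prems] by (intro Ck_on_SucI) auto
qed

lemma analytic_Ck_on:
  fixes f :: "real \<Rightarrow> 'a::euclidean_space"
  assumes "open J" "real_analytic_curve_on f J"
  shows "Ck_on k f J"
proof (rule Ck_on_euclidean, rule analytic_Ck_on_real[OF assms(1)])
  fix b :: 'a
  show "real_analytic_curve_on (\<lambda>x. f x \<bullet> b) J"
    unfolding real_analytic_curve_on_def
  proof
    fix x assume "x \<in> J"
    with assms(2) obtain a e where e: "e > 0" and
      a: "\<And>y. y \<in> J \<Longrightarrow> \<bar>y - x\<bar> < e \<Longrightarrow> (\<lambda>k. (y - x) ^ k *\<^sub>R a k) sums f y"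
      unfolding real_analytic_curve_on_def by blast
    show "\<exists>a e. e > 0 \<and> (\<forall>y\<in>J. \<bar>y - x\<bar> < e \<longrightarrow> (\<lambda>k. (y - x) ^ k *\<^sub>R a k) sums (f y \<bullet> b))"
      using e bounded_linear.sums[OF bounded_linear_inner_left a, of _ b]
      by (intro exI[of _ "\<lambda>k. a k \<bullet> b"] exI[of _ e]) auto
  qed
qed

section \<open>Uniqueness of the principal logarithm\<close>

text \<open>If \<open>exp X = exp Y\<close>, then \<open>Z = X - Y\<close> satisfies \<open>\<Sum>k. (\<Sum>i<k. X\<^sup>i Z Y\<^bsup>k-1-i\<^esup>) / k! = 0\<close>. Left multiplication
  by \<open>X\<close> and right multiplication by \<open>Y\<close> commute with this operator, so if its kernel is nonzero, it
  contains some \<open>Z \<noteq> 0\<close> with \<open>X Z = a Z\<close> and \<open>Z Y = b Z\<close>. Then \<open>a \<noteq> b\<close> and \<open>exp a = exp b\<close>, which is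
  impossible in the strip.\<close>

lemma matpow_0 [simp]: "matpow A 0 = mat 1"
  and matpow_Suc: "matpow A (Suc k) = A ** matpow A k"
  by (simp_all add: matpow_def)

lemma exp_m_sums:
  fixes A :: "real^'n^'n"
  shows "(\<lambda>k. matpow A k /\<^sub>R fact k) sums exp_m A"
proof -
  obtain K where K: "K \<ge> 0" "\<And>(B :: real^'n^'n) (C :: real^'n^'n). norm (B ** C) \<le> norm B * norm C * K"
    using matrix_mult.nonneg_bounded by blast
  have bd: "norm (matpow A k) \<le> norm (mat 1 :: real^'n^'n) * (norm A * K) ^ k" for k
  proof (induction k)
    case (Suc k)
    have "norm (matpow A (Suc k)) \<le> (norm A * K) * norm (matpow A k)"
      using K(2)[of A "matpow A k"] by (simp add: matpow_Suc mult_ac)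
    also have "\<dots> \<le> (norm A * K) * (norm (mat 1 :: real^'n^'n) * (norm A * K) ^ k)"
      using Suc K by (intro mult_left_mono) auto
    finally show ?case by (simp add: mult_ac)
  qed simp
  have "summable (\<lambda>k. matpow A k /\<^sub>R fact k)"
  proof (rule summable_comparison_test')
    show "summable (\<lambda>k. norm (mat 1 :: real^'n^'n) * (inverse (fact k) * (norm A * K) ^ k))"
      by (intro summable_mult summable_exp)
    fix k show "norm (matpow A k /\<^sub>R fact k) \<le>
        norm (mat 1 :: real^'n^'n) * (inverse (fact k) * (norm A * K) ^ k)"
      using mult_left_mono[OF bd[of k], of "inverse (fact k)"] by (simp add: mult_ac)
  qed
  then show ?thesis unfolding exp_m_def by (rule summable_sums)
qed

section \<open>Complex matrices and common eigenmatrices\<close>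

definition cpow :: "complex^'n^'n \<Rightarrow> nat \<Rightarrow> complex^'n^'n" where
  "cpow A k = (((**) A) ^^ k) (mat 1)"

lemma cpow_0 [simp]: "cpow A 0 = mat 1"
  and cpow_Suc: "cpow A (Suc k) = A ** cpow A k"
  by (simp_all add: cpow_def)

lemma cpow_commute: "A ** B = B ** A \<Longrightarrow> cpow A k ** B = B ** cpow A k"
proof (induction k)
  case (Suc k)
  then show ?case by (metis cpow_Suc matrix_mul_assoc)
qed simp

text \<open>Complex scaling of a whole matrix; \<open>scaleR\<close> offers real scalars
  only.\<close>

definition cscale :: "complex \<Rightarrow> complex^'m^'n \<Rightarrow> complex^'m^'n" where
  "cscale c Z = (\<chi> i j. c * Z $ i $ j)"

lemma cscale_simps:
  "X ** cscale c Z = cscale c (X ** Z)" "cscale c Z ** W = cscale c (Z ** W)"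
  "cscale c (Z + Y) = cscale c Z + cscale c Y" "cscale (c + d) Z = cscale c Z + cscale d Z"
  "cscale c (cscale d Z) = cscale (c * d) Z" "cscale 1 Z = Z" "cscale 0 Z = 0" "cscale c 0 = 0"
  "cscale c (Z - Y) = cscale c Z - cscale c Y" "cscale (-c) Z = - cscale c Z"
  by (simp_all add: cscale_def vec_eq_iff matrix_matrix_mult_def algebra_simps sum_distrib_left)

lemma complex_matrix_distribs:
  fixes A B :: "complex^'n^'m" and C D :: "complex^'p^'n"
  shows "A ** (C + D) = A ** C + A ** D" "(A + B) ** C = A ** C + B ** C"
    "A ** (C - D) = A ** C - A ** D" "(A - B) ** C = A ** C - B ** C"
    "(r *\<^sub>R A) ** C = r *\<^sub>R (A ** C)" "A ** (r *\<^sub>R C) = r *\<^sub>R (A ** C)"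
  by (simp_all add: vec_eq_iff matrix_matrix_mult_def sum.distrib sum_subtractf scaleR_sum_right
      algebra_simps)

text \<open>This is p(X) Z, evaluated by Horner's scheme.\<close>

definition poly_act :: "complex^'n^'n \<Rightarrow> complex poly \<Rightarrow> complex^'m^'n \<Rightarrow> complex^'m^'n" where
  "poly_act X p Z = fold_coeffs (\<lambda>c W. cscale c Z + X ** W) p 0"

lemma poly_act_0 [simp]: "poly_act X 0 Z = 0"
  by (simp add: poly_act_def)

lemma poly_act_pCons [simp]: "poly_act X (pCons c p) Z = cscale c Z + X ** poly_act X p Z"
  by (cases "p = 0 \<and> c = 0") (auto simp: poly_act_def cscale_simps)

lemma poly_act_add: "poly_act X (p + q) Z = poly_act X p Z + poly_act X q Z"
  by (induction p q rule: poly_induct2) (simp_all add: cscale_simps complex_matrix_distribs)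

lemma poly_act_smult: "poly_act X (smult a p) Z = cscale a (poly_act X p Z)"
  by (induction p) (simp_all add: cscale_simps complex_matrix_distribs)

lemma poly_act_diff_right: "poly_act X p (Z - W) = poly_act X p Z - poly_act X p W"
  by (induction p) (simp_all add: cscale_simps complex_matrix_distribs)

lemma poly_act_cscale: "poly_act X p (cscale a Z) = cscale a (poly_act X p Z)"
  by (induction p) (simp_all add: cscale_simps mult.commute)

lemma poly_act_mult_right: "poly_act X p (X ** Z) = X ** poly_act X p Z"
  by (induction p) (simp_all add: cscale_simps complex_matrix_distribs)

lemma poly_act_linear_factor:
  "poly_act X ([:- a, 1:] * q) Z = poly_act X q (X ** Z - cscale a Z)"
proof -
  have "[:- a, 1:] * q = smult (- a) q + pCons 0 q" by simp
  then show ?thesis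
    by (simp only: poly_act_add poly_act_smult poly_act_diff_right poly_act_cscale
      poly_act_mult_right cscale_simps poly_act_pCons) simp
qed

lemma poly_act_monom: "poly_act X (monom c k) Z = cscale c (cpow X k ** Z)"
  by (induction k) (simp_all add: monom_Suc monom_0 cpow_Suc cscale_simps matrix_mul_assoc)

lemma poly_act_sum: "poly_act X (\<Sum>i\<in>I. p i) Z = (\<Sum>i\<in>I. poly_act X (p i) Z)"
  by (induction I rule: infinite_finite_induct) (simp_all add: poly_act_add)

text \<open>The powers of X with exponents 0 to N are N + 1 elements of a real vector space of
  dimension N, so they satisfy a nontrivial relation, even with real coefficients.\<close>

lemma annihilating_poly_exists:
  fixes X :: "complex^'n^'n"
  shows "\<exists>p. p \<noteq> 0 \<and> (\<forall>Z :: complex^'m^'n. poly_act X p Z = 0)"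
proof -
  let ?N = "DIM(complex^'n^'n)"
  have "\<exists>c :: nat \<Rightarrow> real. (\<exists>i\<le>?N. c i \<noteq> 0) \<and> (\<Sum>i\<le>?N. c i *\<^sub>R cpow X i) = 0"
  proof (cases "inj_on (cpow X) {..?N}")
    case True
    have "dependent (cpow X ` {..?N})"
      by (rule dependent_biggerset) (use card_image[OF True] in simp)
    then obtain u where u: "\<exists>v\<in>cpow X ` {..?N}. u v \<noteq> 0"
      "(\<Sum>v\<in>cpow X ` {..?N}. u v *\<^sub>R v) = 0"
      by (auto simp: dependent_finite)
    then have "(\<Sum>i\<le>?N. u (cpow X i) *\<^sub>R cpow X i) = 0"
      unfolding sum.reindex[OF True] o_def by simp
    with u(1) show ?thesis by (intro exI[of _ "\<lambda>i. u (cpow X i)"]) auto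
  next
    case False
    then obtain i j where ij: "i \<le> ?N" "j \<le> ?N" "i \<noteq> j" "cpow X i = cpow X j"
      by (auto simp: inj_on_def)
    \<comment> \<open>Two equal powers: the set of powers is then too small for the dimension count,
      but their difference is itself a relation.\<close>
    let ?c = "\<lambda>k. (if k = i then 1 else 0) - (if k = j then 1 else 0) :: real"
    have d: "(\<Sum>k\<le>?N. (if k = l then 1 else 0 :: real) *\<^sub>R cpow X k) = cpow X l" if "l \<le> ?N" for l
    proof -
      have "(\<Sum>k\<le>?N. (if k = l then 1 else 0 :: real) *\<^sub>R cpow X k) =
          (\<Sum>k\<in>{..?N}. if k = l then cpow X k else 0)" by (intro sum.cong) auto
      then show ?thesis using that by (simp only: sum.delta finite_atMost atMost_iff if_True)
    qed
    have "(\<Sum>k\<le>?N. ?c k *\<^sub>R cpow X k) = 0"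
      by (simp only: scaleR_left_diff_distrib sum_subtractf d[OF ij(1)] d[OF ij(2)] ij(4) diff_self)
    then show ?thesis using ij by (intro exI[of _ ?c]) auto
  qed
  then obtain c :: "nat \<Rightarrow> real" and i where c: "i \<le> ?N" "c i \<noteq> 0"
    "(\<Sum>i\<le>?N. c i *\<^sub>R cpow X i) = 0" by blast
  define p where "p = (\<Sum>i\<le>?N. monom (complex_of_real (c i)) i)"
  have "coeff p i = (\<Sum>k\<le>?N. if k = i then complex_of_real (c k) else 0)"
    by (simp add: p_def coeff_sum)
  then have "coeff p i = c i" using c(1) by (simp add: sum.delta')
  then have "p \<noteq> 0" using c(2) by auto
  moreover have "poly_act X p Z = 0" for Z :: "complex^'m^'n"
  proof -
    have s: "cscale (complex_of_real r) W = r *\<^sub>R W" for r and W :: "complex^'m^'n"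
      by (simp add: cscale_def vec_eq_iff scaleR_conv_of_real[where 'a = complex])
    have "poly_act X p Z = (\<Sum>i\<le>?N. (c i *\<^sub>R cpow X i) ** Z)"
      by (simp add: p_def poly_act_sum poly_act_monom s complex_matrix_distribs)
    also have "\<dots> = (\<Sum>i\<le>?N. c i *\<^sub>R cpow X i) ** Z"
    proof -
      have "(\<Sum>i\<le>m. f i ** Z) = (\<Sum>i\<le>m. f i) ** Z" for m and f :: "nat \<Rightarrow> complex^'n^'n"
        by (induction m) (simp_all add: complex_matrix_distribs)
      then show ?thesis .
    qed
    finally show ?thesis unfolding c(3) by simp
  qed
  ultimately show ?thesis by blast
qed

text \<open>Remove linear factors X - a from an annihilating polynomial until the next factor kills
  the current matrix. The accumulated Q is a polynomial in X; only its commuting with X is recorded,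
  since this is what lets it pass through \<open>telescope\<close>.\<close>

lemma left_eigenmatrix_exists:
  fixes X :: "complex^'n^'n" and Z :: "complex^'m^'n"
  assumes "Z \<noteq> 0"
  shows "\<exists>Q a. X ** Q = Q ** X \<and> Q ** Z \<noteq> 0 \<and> X ** (Q ** Z) = cscale a (Q ** Z)"
proof -
  obtain p where "p \<noteq> 0" "poly_act X p Z = 0" using annihilating_poly_exists by blast
  then show ?thesis using assms
  proof (induction "degree p" arbitrary: p Z)
    case 0
    then obtain c where "p = [:c:]" "c \<noteq> 0" using degree_eq_zeroE by (metis pCons_eq_0_iff)
    then have "cscale (1 / c) (cscale c Z) = 0" using 0 by (simp add: cscale_simps)
    then show ?case using \<open>c \<noteq> 0\<close> 0 by (simp add: cscale_simps)
  next
    case (Suc d)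
    then have "\<not> constant (poly p)" by (metis constant_degree nat.distinct(1))
    then obtain a where "poly p a = 0" using fundamental_theorem_of_algebra by blast
    then obtain q where q: "p = [:- a, 1:] * q" by (metis dvdE poly_eq_0_iff_dvd)
    then have "q \<noteq> 0" using Suc by auto
    then have "degree q = d" using Suc q by (simp add: degree_mult_eq del: mult_pCons_left)
    let ?Z = "X ** Z - cscale a Z"
    show ?case
    proof (cases "?Z = 0")
      case True
      then show ?thesis using Suc by (intro exI[of _ "mat 1"] exI[of _ a]) simp
    next
      case False
      have "poly_act X q ?Z = 0" using Suc q by (simp only: poly_act_linear_factor)
      from Suc.hyps(1)[OF \<open>degree q = d\<close>[symmetric] \<open>q \<noteq> 0\<close> this False]
      obtain Q b where Q: "X ** Q = Q ** X" "Q ** ?Z \<noteq> 0" "X ** (Q ** ?Z) = cscale b (Q ** ?Z)"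
        by blast
      define R where "R = Q ** (X - cscale a (mat 1))"
      have RZ: "R ** Z = Q ** ?Z"
        by (simp add: R_def matrix_mul_assoc[symmetric] complex_matrix_distribs cscale_simps)
      have "X ** R = R ** X"
        using Q(1) by (simp add: R_def complex_matrix_distribs cscale_simps matrix_mul_assoc)
      then show ?thesis using Q RZ by (intro exI[of _ R] exI[of _ b]) simp
    qed
  qed
qed

text \<open>\<open>telescope X Y Z k = (\<Sum>i<k. X\<^sup>i Z Y\<^bsup>k-1-i\<^esup>)\<close>, so that \<open>X\<^sup>k - Y\<^sup>k\<close> is its value at \<open>Z = X - Y\<close>.\<close>

primrec telescope :: "complex^'n^'n \<Rightarrow> complex^'m^'m \<Rightarrow> complex^'m^'n \<Rightarrow> nat \<Rightarrow> complex^'m^'n" where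
  "telescope X Y Z 0 = 0"
| "telescope X Y Z (Suc k) = X ** telescope X Y Z k + Z ** cpow Y k"

lemma cpow_diff_telescope: "cpow X k - cpow Y k = telescope X Y (X - Y) k"
proof (induction k)
  case (Suc k)
  have "cpow X (Suc k) - cpow Y (Suc k) = X ** (cpow X k - cpow Y k) + (X - Y) ** cpow Y k"
    by (simp add: cpow_Suc complex_matrix_distribs)
  then show ?case by (simp add: Suc)
qed simp

lemma telescope_left:
  "X ** Q = Q ** X \<Longrightarrow> Q ** telescope X Y Z k = telescope X Y (Q ** Z) k"
  by (induction k) (simp_all add: complex_matrix_distribs matrix_mul_assoc, metis matrix_mul_assoc)

lemma telescope_right:
  "Y ** Q = Q ** Y \<Longrightarrow> telescope X Y Z k ** Q = telescope X Y (Z ** Q) k"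
  by (induction k) (simp_all add: complex_matrix_distribs matrix_mul_assoc[symmetric] cpow_commute)

text \<open>The eigenvalue of \<open>telescope\<close> on a common eigenmatrix: (a^k - b^k)/(a - b),
  extended to a = b by k a^(k-1).\<close>

primrec scalar_telescope :: "complex \<Rightarrow> complex \<Rightarrow> nat \<Rightarrow> complex" where
  "scalar_telescope a b 0 = 0"
| "scalar_telescope a b (Suc k) = a * scalar_telescope a b k + b ^ k"

lemma telescope_eigen:
  assumes "X ** Z = cscale a Z" "Z ** Y = cscale b Z"
  shows "telescope X Y Z k = cscale (scalar_telescope a b k) Z"
proof -
  have "Z ** cpow Y k = cscale (b ^ k) Z" for k
  proof (induction k)
    case (Suc k)
    have "Z ** cpow Y (Suc k) = (Z ** Y) ** cpow Y k" by (simp add: cpow_Suc matrix_mul_assoc)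
    then show ?case by (simp add: Suc assms cscale_simps)
  qed (simp add: cscale_simps)
  then show ?thesis by (induction k) (simp_all add: cscale_simps assms mult.commute)
qed

lemma scalar_telescope_diff: "(a - b) * scalar_telescope a b k = a ^ k - b ^ k"
proof (induction k)
  case (Suc k)
  have "(a - b) * scalar_telescope a b (Suc k) =
      a * ((a - b) * scalar_telescope a b k) + (a - b) * b ^ k" by (simp add: algebra_simps)
  then show ?case unfolding Suc by (simp add: algebra_simps)
qed simp

lemma scalar_telescope_same: "scalar_telescope a a (Suc k) = of_nat (Suc k) * a ^ k"
  by (induction k) (simp_all add: algebra_simps)

text \<open>The series sums to (exp a - exp b)/(a - b) for distinct a, b and to exp a, which is
  never 0, for a = b.\<close>

lemma scalar_telescope_series_nonzero:
  assumes "(\<lambda>k. scalar_telescope a b k / fact k) sums 0"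
  shows "a \<noteq> b \<and> exp a = exp b"
proof -
  have e: "(\<lambda>k. c ^ k / fact k) sums exp c" for c :: complex
    using exp_converges[of c] by (simp add: scaleR_conv_of_real divide_inverse mult.commute)
  have "(\<lambda>k. (a - b) * (scalar_telescope a b k / fact k)) sums ((a - b) * 0)"
    by (rule sums_mult[OF assms])
  moreover have "(a - b) * (scalar_telescope a b k / fact k) = a ^ k / fact k - b ^ k / fact k" for k
    by (simp add: scalar_telescope_diff diff_divide_distrib)
  ultimately have "(\<lambda>k. a ^ k / fact k - b ^ k / fact k) sums 0" by simp
  with sums_diff[OF e e] have "exp a - exp b = 0" by (rule sums_unique2)
  moreover have "a \<noteq> b"
  proof
    assume "a = b"
    then have "(\<lambda>k. scalar_telescope a a (Suc k) / fact (Suc k)) sums 0"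
      using assms sums_Suc_iff[of "\<lambda>k. scalar_telescope a a k / fact k" 0] by simp
    moreover have "scalar_telescope a a (Suc k) / fact (Suc k) = a ^ k / fact k" for k
      unfolding scalar_telescope_same fact_Suc using of_nat_neq_0[of k] by (simp del: of_nat_Suc)
    ultimately have "(\<lambda>k. a ^ k / fact k) sums 0" by simp
    with e have "exp a = 0" by (rule sums_unique2)
    then show False by simp
  qed
  ultimately show ?thesis by simp
qed

abbreviation complexify :: "real^'m^'n \<Rightarrow> complex^'m^'n" where
  "complexify \<equiv> map_matrix complex_of_real"

lemma complexify_simps:
  "complexify (A ** B) = complexify A ** complexify B" "complexify (A + C) = complexify A + complexify C"
  "complexify (A - C) = complexify A - complexify C" "complexify (r *\<^sub>R A) = r *\<^sub>R complexify A"
  "complexify (mat 1) = mat 1"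
  by (simp_all add: vec_eq_iff map_matrix_def matrix_matrix_mult_def mat_def scaleR_conv_of_real[where 'a = complex])

lemma complexify_matpow: "complexify (matpow A k) = cpow (complexify A) k"
  by (induction k) (simp_all add: complexify_simps matpow_Suc cpow_Suc)

lemma bounded_linear_complexify: "bounded_linear complexify"
  unfolding linear_conv_bounded_linear[symmetric] by (intro linearI) (simp_all add: complexify_simps)

lemma bounded_linear_complex_matrix_mult:
  fixes Q :: "complex^'n^'m" and R :: "complex^'p^'k"
  shows "bounded_linear (\<lambda>Z :: complex^'k^'n. Q ** Z ** R)"
  unfolding linear_conv_bounded_linear[symmetric]
  by (intro linearI) (simp_all add: complex_matrix_distribs)

lemma eigenvalue_if_left_eigenmatrix:
  fixes W :: "complex^'n^'m"
  assumes "X ** W = cscale a W" "W \<noteq> 0"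
  shows "a \<in> eigenvalues X"
proof -
  obtain i j where "W $ i $ j \<noteq> 0" using assms(2) by (auto simp: vec_eq_iff)
  then have "column j W \<noteq> 0" by (auto simp: column_def vec_eq_iff)
  moreover have "X *v column j W = a *s column j W"
    using assms(1) by (simp add: vec_eq_iff matrix_vector_mult_def matrix_matrix_mult_def column_def cscale_def)
  ultimately show ?thesis by (auto simp: eigenvalues_def eigenspace_def)
qed

lemma transpose_eq_0_iff: "transpose A = 0 \<longleftrightarrow> (A :: 'a::zero^'n^'m) = 0"
  by (auto simp: transpose_def vec_eq_iff)

text \<open>Right multiplication by Y becomes left multiplication by its transpose, so that
  \<open>left_eigenmatrix_exists\<close> can be used on both sides. The eigenvalue b thus arises
  from the transpose of Y, which explains the third hypothesis.\<close>

lemma exp_m_inj_on_strip: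
  fixes X Y :: "real^'n^'n"
  assumes eq: "exp_m X = exp_m Y"
    and X: "\<forall>z\<in>eigenvalues (complexify X). \<bar>Im z\<bar> < pi"
    and Y: "\<forall>z\<in>eigenvalues (complexify (transpose Y)). \<bar>Im z\<bar> < pi"
  shows "X = Y"
proof (rule ccontr)
  assume "X \<noteq> Y"
  define CX CY where "CX = complexify X" and "CY = complexify Y"
  have "(\<lambda>k. matpow X k /\<^sub>R fact k - matpow Y k /\<^sub>R fact k) sums (exp_m X - exp_m Y)"
    by (intro sums_diff exp_m_sums)
  then have "(\<lambda>k. complexify (matpow X k /\<^sub>R fact k - matpow Y k /\<^sub>R fact k)) sums complexify 0"
    unfolding eq by (intro bounded_linear.sums[OF bounded_linear_complexify]) simp
  then have s: "(\<lambda>k. telescope CX CY (CX - CY) k /\<^sub>R fact k) sums 0"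
    by (simp add: complexify_simps complexify_matpow CX_def CY_def flip: cpow_diff_telescope scaleR_diff_right)
      (simp add: map_matrix_def zero_vec_def)
  have "complexify (X - Y) \<noteq> 0" using \<open>X \<noteq> Y\<close> by (auto simp: vec_eq_iff)
  then have "CX - CY \<noteq> 0" by (simp add: complexify_simps CX_def CY_def)
  from left_eigenmatrix_exists[OF this, of CX] obtain Q a where
    Q: "CX ** Q = Q ** CX" "Q ** (CX - CY) \<noteq> 0" "CX ** (Q ** (CX - CY)) = cscale a (Q ** (CX - CY))"
    by blast
  let ?V = "Q ** (CX - CY)"
  have "transpose ?V \<noteq> 0" using Q(2) by (simp add: transpose_eq_0_iff)
  from left_eigenmatrix_exists[OF this, of "transpose CY"] obtain R b where
    R: "transpose CY ** R = R ** transpose CY" "R ** transpose ?V \<noteq> 0"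
    "transpose CY ** (R ** transpose ?V) = cscale b (R ** transpose ?V)"
    by blast
  define Z where "Z = ?V ** transpose R"
  have tZ: "transpose Z = R ** transpose ?V"
    by (simp add: Z_def matrix_transpose_mul)
  have t_cscale: "transpose (cscale c W) = cscale c (transpose W)" for c and W :: "complex^'n^'n"
    by (simp add: cscale_def transpose_def vec_eq_iff)
  have "Z \<noteq> 0" using R(2) tZ transpose_eq_0_iff by metis
  have XZ: "CX ** Z = cscale a Z"
    by (simp add: Z_def matrix_mul_assoc Q(3)[unfolded matrix_mul_assoc] cscale_simps)
  have "transpose CY ** transpose Z = cscale b (transpose Z)" using R(3) tZ by simp
  then have ZY: "Z ** CY = cscale b Z"
    by (metis matrix_transpose_mul t_cscale transpose_transpose)
  have RY: "CY ** transpose R = transpose R ** CY"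
    using R(1) by (metis matrix_transpose_mul transpose_transpose)
  \<comment> \<open>Multiplying by Q and by the transpose of R replaces X - Y by the common
    eigenmatrix Z; a nonzero entry of Z then leaves a scalar series.\<close>
  have "(\<lambda>k. Q ** (telescope CX CY (CX - CY) k /\<^sub>R fact k) ** transpose R) sums (Q ** 0 ** transpose R)"
    by (intro bounded_linear.sums[OF bounded_linear_complex_matrix_mult] s)
  moreover have "Q ** (telescope CX CY (CX - CY) k /\<^sub>R fact k) ** transpose R =
      cscale (scalar_telescope a b k) Z /\<^sub>R fact k" for k
    by (simp only: complex_matrix_distribs(5,6) telescope_left[OF Q(1)] telescope_right[OF RY]
        telescope_eigen[OF XZ ZY] Z_def[symmetric])
  ultimately have sZ: "(\<lambda>k. cscale (scalar_telescope a b k) Z /\<^sub>R fact k) sums 0" by simp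
  obtain i j where ij: "Z $ i $ j \<noteq> 0" using \<open>Z \<noteq> 0\<close> by (auto simp: vec_eq_iff)
  have "(\<lambda>k. (cscale (scalar_telescope a b k) Z /\<^sub>R fact k) $ i $ j) sums (0 $ i $ j)"
    using bounded_linear.sums[OF bounded_linear_vec_nth bounded_linear.sums[OF bounded_linear_vec_nth sZ]]
    by simp
  then have "(\<lambda>k. (cscale (scalar_telescope a b k) Z /\<^sub>R fact k) $ i $ j * (1 / Z $ i $ j)) sums (0 * (1 / Z $ i $ j))"
    by (intro sums_mult2) simp
  moreover have "(cscale (scalar_telescope a b k) Z /\<^sub>R fact k) $ i $ j * (1 / Z $ i $ j) =
      scalar_telescope a b k / fact k" for k
    using ij by (simp add: cscale_def scaleR_conv_of_real[where 'a = complex] divide_inverse mult_ac)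
  ultimately have "(\<lambda>k. scalar_telescope a b k / fact k) sums 0" by simp
  then have ab: "a \<noteq> b" "exp a = exp b" using scalar_telescope_series_nonzero by auto
  have "a \<in> eigenvalues CX" using XZ \<open>Z \<noteq> 0\<close> by (rule eigenvalue_if_left_eigenmatrix)
  then have "\<bar>Im a\<bar> < pi" using X by (simp add: CX_def)
  have "b \<in> eigenvalues (transpose CY)"
    using R(2) R(3) by (intro eigenvalue_if_left_eigenmatrix) 
  moreover have "transpose CY = complexify (transpose Y)"
    by (simp add: CY_def transpose_def vec_eq_iff)
  ultimately have "\<bar>Im b\<bar> < pi" using Y by simp
  have "a = b"
    using exp_complex_eqI[of a b] ab(2) \<open>\<bar>Im a\<bar> < pi\<close> \<open>\<bar>Im b\<bar> < pi\<close> by auto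
  then show False using ab by simp
qed

text \<open>For skew X the transpose is -X, and the strip is symmetric under negation; so X itself
  can take the place of Y in \<open>exp_m_inj_on_strip\<close>, against an arbitrary
  competitor.\<close>

lemma log_m_eqI:
  fixes X :: "real^'n^'n"
  assumes "exp_m X = M" "transpose X = - X"
    and X: "\<And>z. z \<in> eigenvalues (complexify X) \<Longrightarrow> \<bar>Im z\<bar> < pi"
  shows "log_m M = X"
  unfolding log_m_def
proof (rule the_equality)
  show "exp_m X = M \<and> (\<forall>z\<in>eigenvalues (complexify X). \<bar>Im z\<bar> < pi)" using assms by blast
next
  fix Y assume Y: "exp_m Y = M \<and> (\<forall>z\<in>eigenvalues (complexify Y). \<bar>Im z\<bar> < pi)"
  have "\<bar>Im z\<bar> < pi" if z: "z \<in> eigenvalues (complexify (transpose X))" for z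
  proof -
    obtain v where v: "v \<noteq> 0" "complexify (- X) *v v = z *s v"
      using z assms(2) by (auto simp: eigenvalues_def eigenspace_def)
    have "complexify X *v v = - (complexify (- X) *v v)"
      by (simp add: matrix_vector_mult_def vec_eq_iff sum_negf)
    then have "complexify X *v v = (- z) *s v" using v(2) by simp
    then have "- z \<in> eigenvalues (complexify X)"
      using v(1) by (auto simp: eigenvalues_def eigenspace_def)
    from X[OF this] show ?thesis by simp
  qed
  then show "Y = X" using Y assms(1) by (metis exp_m_inj_on_strip)
qed

section \<open>The matrix exponential\<close>

lemma bounded_linear_matrix_vector_left:
  "bounded_linear (\<lambda>M :: real^'n^'m. M *v v)"
  unfolding linear_conv_bounded_linear[symmetric]
  by (intro linearI) (simp_all add: matrix_vector_simps)

text \<open>All powers intertwine, hence the series do. F may be rectangular, as needed for the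
  block column (U, \<Omega> U).\<close>

lemma exp_m_intertwine:
  fixes A :: "real^'m^'m" and B :: "real^'n^'n"
  assumes "F ** B = A ** F"
  shows "F ** exp_m B = exp_m A ** F"
proof -
  have *: "F ** matpow B k = matpow A k ** F" for k
  proof (induction k)
    case (Suc k)
    have "F ** matpow B (Suc k) = A ** (F ** matpow B k)"
      by (simp add: matpow_Suc matrix_mul_assoc assms)
    then show ?case by (simp add: Suc matpow_Suc matrix_mul_assoc)
  qed simp
  have "(\<lambda>k. F ** (matpow B k /\<^sub>R fact k)) sums (F ** exp_m B)"
    by (intro bounded_linear.sums[OF matrix_mult.bounded_linear_right] exp_m_sums)
  moreover have "(\<lambda>k. (matpow A k /\<^sub>R fact k) ** F) sums (exp_m A ** F)"
    by (intro bounded_linear.sums[OF matrix_mult.bounded_linear_left] exp_m_sums)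
  ultimately show ?thesis by (simp add: matrix_distribs * sums_unique2)
qed

text \<open>For \<open>t = 0\<close> the junk value \<open>sin t / t = 0\<close> is harmless because then \<open>w = 0\<close>.\<close>

lemma exp_m_rotation:
  fixes A :: "real^'n^'n"
  assumes v: "A *v v = w" and w: "A *v w = - (t^2) *\<^sub>R v" and t: "t = 0 \<Longrightarrow> w = 0"
  shows "exp_m A *v v = cos t *\<^sub>R v + (sin t / t) *\<^sub>R w"
proof -
  have *: "matpow A k *v v = (fact k * (cos_coeff k * t ^ k)) *\<^sub>R v + (fact k * (sin_coeff k * t ^ k / t)) *\<^sub>R w" for k
  proof (induction k)
    case (Suc k)
    have "matpow A (Suc k) *v v = (fact k * (cos_coeff k * t ^ k)) *\<^sub>R w +
       (fact k * (sin_coeff k * t ^ k / t)) *\<^sub>R (- (t^2) *\<^sub>R v)"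
      by (simp add: matpow_Suc matrix_vector_mul_assoc[symmetric] Suc matrix_vector_right_distrib
         matrix_vector_mult_scaleR v w del: scaleR_scaleR scaleR_minus_right)
    also have "(fact k * (cos_coeff k * t ^ k)) *\<^sub>R w = (fact (Suc k) * (sin_coeff (Suc k) * t ^ Suc k / t)) *\<^sub>R w"
      by (cases "t = 0") (simp_all add: t sin_coeff_Suc del: of_nat_Suc)
    also have "(fact k * (sin_coeff k * t ^ k / t)) *\<^sub>R (- (t^2) *\<^sub>R v) =
       (fact (Suc k) * (cos_coeff (Suc k) * t ^ Suc k)) *\<^sub>R v"
      by (cases "t = 0") (simp_all add: cos_coeff_Suc power2_eq_square del: of_nat_Suc)
    finally show ?case by (simp only: add.commute)
  qed simp
  have "(\<lambda>k. (matpow A k /\<^sub>R fact k) *v v) sums (exp_m A *v v)"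
    by (intro bounded_linear.sums[OF bounded_linear_matrix_vector_left] exp_m_sums)
  moreover have "(\<lambda>k. (cos_coeff k *\<^sub>R t ^ k) *\<^sub>R v + (sin_coeff k *\<^sub>R t ^ k / t) *\<^sub>R w) sums
      (cos t *\<^sub>R v + (sin t / t) *\<^sub>R w)"
    by (intro sums_add bounded_linear.sums[OF bounded_linear_scaleR_left] sums_divide
        cos_converges sin_converges)
  moreover have "(matpow A k /\<^sub>R fact k) *v v =
      (cos_coeff k *\<^sub>R t ^ k) *\<^sub>R v + (sin_coeff k *\<^sub>R t ^ k / t) *\<^sub>R w" for k
  proof -
    have f: "inverse (fact k) * (fact k * x) = x" for x :: real by simp
    show ?thesis
      unfolding scaleR_matrix_vector_assoc[symmetric] * scaleR_add_right scaleR_scaleR f by simp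
  qed
  ultimately show ?thesis by (simp add: sums_unique2)
qed

lemma exp_m_0 [simp]: "exp_m (0 :: real^'n^'n) = mat 1"
proof -
  have "exp_m (0 :: real^'n^'n) *v v = v" for v
    using exp_m_rotation[of "0 :: real^'n^'n" v 0 0] by simp
  then show ?thesis by (simp add: matrix_eq)
qed

lemma matpow_scaleR: "matpow (t *\<^sub>R A) k = t ^ k *\<^sub>R matpow A k"
  by (induction k) (simp_all add: matpow_Suc matrix_distribs)

text \<open>Each coordinate is an everywhere convergent real power series in t, so it can be
  differentiated termwise.\<close>

lemma exp_m_has_vector_derivative:
  fixes A :: "real^'n^'n"
  shows "((\<lambda>t. exp_m (t *\<^sub>R A)) has_vector_derivative A ** exp_m (t *\<^sub>R A)) (at t)"
proof -
  have comp: "((\<lambda>t. exp_m (t *\<^sub>R A) \<bullet> b) has_vector_derivative (A ** exp_m (t *\<^sub>R A)) \<bullet> b) (at t)" for b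
  proof -
    define c where "c k = (matpow A k \<bullet> b) / fact k" for k
    have s: "(\<lambda>k. c k * t ^ k) sums (exp_m (t *\<^sub>R A) \<bullet> b)" for t
      using bounded_linear.sums[OF bounded_linear_inner_left exp_m_sums, of "t *\<^sub>R A" b]
      by (simp add: matpow_scaleR c_def divide_inverse mult_ac)
    have d: "diffs c k = ((A ** matpow A k) \<bullet> b) / fact k" for k
      by (simp add: diffs_def c_def matpow_Suc del: of_nat_Suc)
    have "(\<lambda>k. diffs c k * t ^ k) sums ((A ** exp_m (t *\<^sub>R A)) \<bullet> b)"
      using bounded_linear.sums[OF bounded_linear_inner_left
          bounded_linear.sums[OF matrix_mult.bounded_linear_right exp_m_sums], of A "t *\<^sub>R A" b]
      by (simp add: matpow_scaleR d divide_inverse mult_ac matrix_distribs)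
    then have e: "(\<Sum>k. diffs c k * t ^ k) = (A ** exp_m (t *\<^sub>R A)) \<bullet> b" by (simp add: sums_iff)
    have "((\<lambda>t. \<Sum>k. c k * t ^ k) has_field_derivative (\<Sum>k. diffs c k * t ^ k)) (at t)"
      by (rule termdiffs_strong_converges_everywhere) (use s sums_summable in blast)
    then show ?thesis
      unfolding e using s by (simp add: sums_iff has_real_derivative_iff_has_vector_derivative)
  qed
  have "((\<lambda>t. \<Sum>b\<in>Basis. (exp_m (t *\<^sub>R A) \<bullet> b) *\<^sub>R b) has_vector_derivative
      (\<Sum>b\<in>Basis. ((A ** exp_m (t *\<^sub>R A)) \<bullet> b) *\<^sub>R b)) (at t)"
    by (intro has_vector_derivative_sum bounded_linear.has_vector_derivative[OF bounded_linear_scaleR_left] comp)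
  then show ?thesis by (simp only: euclidean_representation)
qed

lemma exp_m_skew_orthogonal:
  fixes A :: "real^'n^'n"
  assumes skew: "transpose A = - A"
  shows "transpose (exp_m (t *\<^sub>R A)) ** exp_m (t *\<^sub>R A) = mat 1"
proof -
  let ?W = "\<lambda>t. exp_m (t *\<^sub>R A)"
  have tW: "bounded_linear (transpose :: real^'n^'n \<Rightarrow> real^'n^'n)"
    using linear_transpose by (simp add: linear_conv_bounded_linear)
  have "((\<lambda>t. transpose (?W t) ** ?W t) has_vector_derivative 0) (at t)" for t
  proof (rule has_vector_derivative_eq_rhs)
    show "((\<lambda>t. transpose (?W t) ** ?W t) has_vector_derivative
       transpose (?W t) ** (A ** ?W t) + transpose (A ** ?W t) ** ?W t) (at t)"
      by (intro matrix_mult.has_vector_derivative bounded_linear.has_vector_derivative[OF tW]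
          exp_m_has_vector_derivative)
    show "transpose (?W t) ** (A ** ?W t) + transpose (A ** ?W t) ** ?W t = 0"
      by (simp add: matrix_transpose_mul skew matrix_distribs matrix_mul_assoc)
  qed
  then obtain c where "\<And>t. transpose (?W t) ** ?W t = c"
    using has_vector_derivative_zero_constant[of UNIV "\<lambda>t. transpose (?W t) ** ?W t"] by auto
  from this[of 0] this[of t] show ?thesis by simp
qed

lemma finite_symmetric_eigenvalues:
  fixes A :: "real^'n^'n"
  assumes sym: "transpose A = A"
  shows "finite (eigenvalues A)"
proof -
  obtain B where B: "eigenbasis A UNIV B" using eigenbasis_UNIV_ex[OF sym] by blast
  have "eigenvalues A \<subseteq> (\<lambda>b. b \<bullet> (A *v b)) ` B"
  proof
    fix l assume "l \<in> eigenvalues A"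
    then obtain v where v: "v \<noteq> 0" "A *v v = l *\<^sub>R v"
      by (auto simp: eigenvalues_iff)
    have "\<exists>b\<in>B. b \<bullet> v \<noteq> 0"
    proof (rule ccontr)
      assume "\<not> (\<exists>b\<in>B. b \<bullet> v \<noteq> 0)"
      then have "(\<Sum>b\<in>B. (b \<bullet> v) *\<^sub>R b) = 0" by (intro sum.neutral) auto
      then show False using eigenbasis_expand[OF B, of v] v(1) by simp
    qed
    then obtain b where b: "b \<in> B" "b \<bullet> v \<noteq> 0" by blast
    then have "A *v b = (b \<bullet> (A *v b)) *\<^sub>R b" using B by (auto simp: eigenbasis_def)
    with b v(2) have "b \<bullet> (A *v b) = l" using symmetric_eigvec_orthogonal[OF sym] by blast
    then show "l \<in> (\<lambda>b. b \<bullet> (A *v b)) ` B" using b by blast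
  qed
  then show ?thesis using eigenbasis_finite[OF B] finite_subset by blast
qed

text \<open>A real matrix acts separately on real and imaginary parts, so a real operator bound
  passes to complex vectors.\<close>

lemma complex_eigenvalue_bound:
  fixes A :: "real^'n^'n"
  assumes bd: "\<And>x. norm (A *v x) \<le> c * norm x" and z: "z \<in> eigenvalues (complexify A)"
  shows "cmod z \<le> c"
proof -
  obtain v where v: "v \<noteq> 0" "complexify A *v v = z *s v"
    using z by (auto simp: eigenvalues_def eigenspace_def)
  define re im where "re w = (\<chi> i. Re (w $ i))" and "im w = (\<chi> i. Im (w $ i))" for w :: "complex^'n"
  have nrm: "(norm w)^2 = (norm (re w))^2 + (norm (im w))^2" for w
    by (simp add: norm_vec_def L2_set_def sum_nonneg re_def im_def cmod_power2 sum.distrib)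
  have "re (complexify A *v v) = A *v re v" "im (complexify A *v v) = A *v im v"
    by (simp_all add: re_def im_def vec_eq_iff matrix_vector_mult_def)
  then have "(norm (z *s v))^2 = (norm (A *v re v))^2 + (norm (A *v im v))^2"
    by (simp add: nrm v(2)[symmetric])
  also have "\<dots> \<le> (c * norm (re v))^2 + (c * norm (im v))^2"
    by (intro add_mono power_mono bd) auto
  also have "\<dots> = c^2 * (norm v)^2" by (simp add: nrm power_mult_distrib distrib_left)
  also have "(norm (z *s v))^2 = (cmod z)^2 * (norm v)^2"
    by (simp add: norm_vec_def L2_set_def sum_nonneg norm_mult power_mult_distrib sum_distrib_left)
  finally have "(cmod z)^2 \<le> c^2" using v(1) by simp
  moreover have "0 \<le> c"
  proof -
    have "re v \<noteq> 0 \<or> im v \<noteq> 0" using nrm[of v] v(1) by auto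
    then obtain x :: "real^'n" where "x \<noteq> 0" by fast
    have "0 \<le> c * norm x" by (rule order_trans[OF norm_ge_zero bd])
    then show ?thesis using \<open>x \<noteq> 0\<close> by (simp add: zero_le_mult_iff)
  qed
  ultimately show ?thesis by (rule power2_le_imp_le)
qed

section \<open>Column selection, block matrices and frames as matrix algebra\<close>

lemma restrict_cols_eq: "restrict_cols I U = U ** id_on I"
proof -
  have "(\<Sum>k\<in>UNIV. U $ i $ k * (if k = j then 1 else 0)) = U $ i $ j" for i j
    by (simp add: if_distrib[of "(*) _"] cong: if_cong)
  then show ?thesis by (simp add: restrict_cols_def id_on_def matrix_matrix_mult_def mat_def vec_eq_iff)
qed

lemma sum_UNIV_Plus:
  "(\<Sum>x\<in>UNIV. f x) = (\<Sum>a\<in>UNIV. f (Inl a)) + (\<Sum>b\<in>UNIV. f (Inr b :: 'a::finite + 'b::finite))"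
  unfolding UNIV_Plus_UNIV[symmetric] by (subst sum.Plus) auto

lemma hcat_vcat_mult: "hcat X Y ** vcat Z W = X ** Z + Y ** W"
  by (simp add: hcat_def vcat_def matrix_matrix_mult_def vec_eq_iff sum_UNIV_Plus)

lemma mult_hcat: "A ** hcat X Y = hcat (A ** X) (A ** Y)"
  by (simp add: hcat_def matrix_matrix_mult_def vec_eq_iff split: sum.split)

lemma add_hcat: "hcat X Y + hcat X' Y' = hcat (X + X') (Y + Y')"
  by (simp add: hcat_def vec_eq_iff split: sum.split)

lemma stiefel_mult:
  assumes "U \<in> stiefel I"
  shows "transpose U ** U = id_on I" "U ** id_on I = U" "U ** transpose U ** U = U"
  using assms by (simp_all add: stiefel_def restrict_cols_eq matrix_mul_assoc[symmetric])

section \<open>The direct rotation of two projectors\<close>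

text \<open>With \<open>E = (P - R)\<^sup>2\<close> and \<open>K = R P - P R\<close> one has \<open>K\<^sup>2 = E\<^sup>2 - E\<close> and
  \<open>(I - 2R)(I - 2P) = I - 2E + 2K\<close>, and \<open>P, R, K\<close> commute with \<open>E\<close>. An eigenvalue \<open>l\<close> of \<open>E\<close> is the squared
  sine of a principal angle.\<close>

definition proj_gap :: "real^'n^'n \<Rightarrow> real^'n^'n \<Rightarrow> real^'n^'n" where
  "proj_gap P R = (P - R) ** (P - R)"

definition proj_comm :: "real^'n^'n \<Rightarrow> real^'n^'n \<Rightarrow> real^'n^'n" where
  "proj_comm P R = R ** P - P ** R"

text \<open>With l = sin^2 \<theta> this is \<theta> / (sin \<theta> cos \<theta>), continued by its
  limit at 0. On an eigenvector of E the matrix K has size sin \<theta> cos \<theta>, so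
  multiplication by the ratio rescales it to size \<theta>.\<close>

definition angle_ratio :: "real \<Rightarrow> real" where
  "angle_ratio l = (if l = 0 then 1 else arcsin (sqrt l) / (sqrt l * sqrt (1 - l)))"

definition rotation_log :: "real^'n^'n \<Rightarrow> real^'n^'n \<Rightarrow> real^'n^'n" where
  "rotation_log P R = proj_comm P R ** matfun angle_ratio (proj_gap P R)"

text \<open>The last assumption says that no principal angle is a right angle; in this form the
  condition on the cut locus enters the computations.\<close>

locale projector_pair =
  fixes P R :: "real^'n^'n"
  assumes P_sym: "transpose P = P" and P_idem: "P ** P = P"
    and R_sym: "transpose R = R" and R_idem: "R ** R = R"
    and no_right_angle: "\<And>v. proj_gap P R *v v = v \<Longrightarrow> v = 0"
begin

abbreviation "E \<equiv> proj_gap P R"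
abbreviation "K \<equiv> proj_comm P R"
abbreviation "Om \<equiv> rotation_log P R"

lemma P_idem_right: "X ** P ** P = X ** P" and R_idem_right: "X ** R ** R = X ** R"
  for X :: "real^'n^'k"
  by (simp_all add: matrix_mul_assoc[symmetric] P_idem R_idem)

lemmas ring_simps = proj_gap_def proj_comm_def matrix_distribs matrix_mul_assoc P_idem R_idem
  P_idem_right R_idem_right

lemma E_sym: "transpose E = E"
  by (simp add: proj_gap_def transpose_simps P_sym R_sym)

lemma K_skew: "transpose K = - K"
  by (simp add: proj_comm_def transpose_simps P_sym R_sym)

lemma E_P: "E ** P = P ** E" and E_K: "E ** K = K ** E"
  and K_square: "K ** K = E ** E - E" and P_K_P: "P ** K ** P = 0"
  and E_mult_P: "E ** P = P - P ** R ** P"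
  by (simp_all add: ring_simps)

lemma K_minus_E: "K - E = 2 *\<^sub>R (R ** P) - P - R"
  by (simp add: ring_simps scaleR_2)

text \<open>Behind both equations is I - E + K = R P + (I - R)(I - P), the unnormalised intertwiner
  of P and R.\<close>

lemma R_left_factor: "R ** (mat 1 - E + K) = R ** P" and P_right_factor: "(mat 1 - E + K) ** P = R ** P"
proof -
  have *: "mat 1 - E + K = mat 1 - P - R + 2 *\<^sub>R (R ** P)"
    using K_minus_E by (simp add: algebra_simps)
  show "R ** (mat 1 - E + K) = R ** P" "(mat 1 - E + K) ** P = R ** P"
    unfolding * matrix_distribs matrix_mul_assoc R_idem P_idem P_idem_right matrix_mul_lid matrix_mul_rid
    by (simp_all add: scaleR_2)
qed

text \<open>E is the square of a symmetric matrix, so l \<ge> 0. K is skew with K^2 = E^2 - E, so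
  l^2 - l \<le> 0. The value 1 is excluded by the absence of right angles.\<close>

lemma eigenvalue_range:
  assumes v: "E *v v = l *\<^sub>R v" and "v \<noteq> 0"
  shows "0 \<le> l" "l < 1"
proof -
  have vv: "v \<bullet> v > 0" using \<open>v \<noteq> 0\<close> by simp
  have "v \<bullet> (E *v v) = ((P - R) *v v) \<bullet> ((P - R) *v v)"
    by (simp add: proj_gap_def matrix_vector_mul_assoc[symmetric] inner_matrix_vector_left
        transpose_simps P_sym R_sym)
  then have "l * (v \<bullet> v) \<ge> 0" by (simp add: v)
  then show "0 \<le> l" using vv by (simp add: zero_le_mult_iff)
  have "(K *v v) \<bullet> (K *v v) = - (v \<bullet> ((K ** K) *v v))"
    by (simp add: inner_matrix_vector_left K_skew matrix_vector_mul_assoc[symmetric])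
      (simp add: matrix_vector_mult_def vec_eq_iff inner_vec_def sum_negf)
  also have "(K ** K) *v v = (l^2 - l) *\<^sub>R v"
    by (simp add: K_square matrix_vector_simps v power2_eq_square algebra_simps)
  finally have "(l^2 - l) * (v \<bullet> v) \<le> 0" using inner_ge_zero[of "K *v v"] by simp
  then have "l^2 - l \<le> 0" using vv by (simp add: mult_le_0_iff)
  then have "l \<le> 1" using \<open>0 \<le> l\<close> by (cases "l = 0") (auto simp: power2_eq_square)
  moreover have "l \<noteq> 1" using no_right_angle[of v] v \<open>v \<noteq> 0\<close> by auto
  ultimately show "l < 1" by simp
qed

lemma angle_range:
  assumes "0 \<le> l" "l < 1"
  shows "0 \<le> arcsin (sqrt l)" "arcsin (sqrt l) < pi / 2" "sin (arcsin (sqrt l)) = sqrt l"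
    "cos (arcsin (sqrt l)) = sqrt (1 - l)"
proof -
  have "0 \<le> sqrt l" "- 1 \<le> sqrt l" "sqrt l < 1"
    using assms by (auto intro: order_trans[of _ 0])
  then show "0 \<le> arcsin (sqrt l)" "arcsin (sqrt l) < pi / 2" "sin (arcsin (sqrt l)) = sqrt l"
    using arcsin_less_mono[of "sqrt l" 1] arcsin_le_mono[of 0 "sqrt l"] by auto
  show "cos (arcsin (sqrt l)) = sqrt (1 - l)"
    using \<open>- 1 \<le> sqrt l\<close> \<open>sqrt l < 1\<close> assms by (simp add: cos_arcsin)
qed

text \<open>On the span of v and K v, \<Omega> generates rotations with angular speed \<theta> =
  arcsin (sqrt l). The last part provides the side condition of \<open>exp_m_rotation\<close> at
  angle 0.\<close>

lemma Om_eigvec: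
  assumes v: "E *v v = l *\<^sub>R v"
  shows "Om *v v = angle_ratio l *\<^sub>R (K *v v)"
    and "Om *v (Om *v v) = - ((arcsin (sqrt l))^2) *\<^sub>R v"
    and "arcsin (sqrt l) = 0 \<Longrightarrow> Om *v v = 0"
proof -
  have 1: "Om *v v = angle_ratio l *\<^sub>R (K *v v)" if "E *v v = l *\<^sub>R v" for v
    using that by (simp add: rotation_log_def matrix_vector_simps matfun_eigvec[OF E_sym that])
  from 1[OF v] show "Om *v v = angle_ratio l *\<^sub>R (K *v v)" .
  have Kv: "E *v (K *v v) = l *\<^sub>R (K *v v)"
    by (simp add: matrix_vector_mul_assoc E_K) (simp add: matrix_vector_simps v)
  have KKv: "K *v (K *v v) = (l^2 - l) *\<^sub>R v"
    by (simp add: matrix_vector_mul_assoc K_square)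
      (simp add: matrix_vector_simps v power2_eq_square algebra_simps)
  show "Om *v (Om *v v) = - ((arcsin (sqrt l))^2) *\<^sub>R v"
  proof (cases "v = 0")
    case False
    note r = eigenvalue_range[OF v False]
    have "angle_ratio l * (angle_ratio l * (l\<^sup>2 - l)) = - ((arcsin (sqrt l))^2)"
    proof (cases "l = 0")
      case False
      have sq: "sqrt l * sqrt l = l" "sqrt (1 - l) * sqrt (1 - l) = 1 - l" "l \<noteq> 0" "1 - l \<noteq> 0"
        using r False by auto
      have "angle_ratio l * (angle_ratio l * (l\<^sup>2 - l)) =
          (arcsin (sqrt l))^2 / ((sqrt l * sqrt l) * (sqrt (1 - l) * sqrt (1 - l))) * (l^2 - l)"
      proof -
        have "t / (a * b) * (t / (a * b) * d) = t^2 / ((a * a) * (b * b)) * d" for t a b d :: real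
          by (simp add: power2_eq_square mult_ac)
        from this[of "arcsin (sqrt l)" "sqrt l" "sqrt (1 - l)" "l^2 - l"] show ?thesis
          using False by (simp only: angle_ratio_def if_False)
      qed
      also have "\<dots> = - ((arcsin (sqrt l))^2)"
        unfolding sq using sq(3,4) by (simp add: power2_eq_square field_simps)
      finally show ?thesis .
    qed simp
    then show ?thesis
      by (simp add: 1[OF v] matrix_vector_mult_scaleR 1[OF Kv] KKv)
  qed simp
  show "Om *v v = 0" if "arcsin (sqrt l) = 0"
  proof (cases "v = 0")
    case False
    note r = eigenvalue_range[OF v False]
    have "sqrt l = 0" using angle_range(3)[OF r] that by simp
    then have "l = 0" by simp
    \<comment> \<open>At angle 0 also K^2 v = 0, and for a skew matrix this forces K v = 0.\<close>
    have "(K *v v) \<bullet> (K *v v) = - (v \<bullet> (K *v (K *v v)))"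
      by (simp add: inner_matrix_vector_left K_skew)
        (simp add: matrix_vector_mult_def inner_vec_def sum_negf)
    then have "K *v v = 0" using KKv \<open>l = 0\<close> by simp
    then show ?thesis by (simp add: 1[OF v])
  qed simp
qed

lemma Om_skew: "transpose Om = - Om"
  by (simp add: rotation_log_def matrix_transpose_mul transpose_matfun K_skew matrix_distribs
      matfun_commute[OF E_sym E_K])

lemma exp_Om_eigvec:
  assumes v: "E *v v = l *\<^sub>R v"
  shows "exp_m (s *\<^sub>R Om) *v v =
    cos (s * arcsin (sqrt l)) *\<^sub>R v + (sin (s * arcsin (sqrt l)) / (s * arcsin (sqrt l)) * s) *\<^sub>R (Om *v v)"
proof -
  have "(s *\<^sub>R Om) *v (s *\<^sub>R (Om *v v)) = - ((s * arcsin (sqrt l))^2) *\<^sub>R v"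
    by (simp add: matrix_vector_simps Om_eigvec(2)[OF v] power_mult_distrib power2_eq_square)
  moreover have "s *\<^sub>R (Om *v v) = 0" if "s * arcsin (sqrt l) = 0"
    using that Om_eigvec(3)[OF v] by auto
  ultimately show ?thesis
    using exp_m_rotation[of "s *\<^sub>R Om" v "s *\<^sub>R (Om *v v)" "s * arcsin (sqrt l)"]
    by (simp add: scaleR_matrix_vector_assoc)
qed

text \<open>Double angles: cos 2\<theta> = 1 - 2 l, and the coefficient of K v is sin 2\<theta> /
  (sin \<theta> cos \<theta>) = 2. So exp (2 \<Omega>) is I - 2 E + 2 K, the product of the two
  reflections.\<close>

lemma exp_2_Om: "exp_m (2 *\<^sub>R Om) = (mat 1 - 2 *\<^sub>R R) ** (mat 1 - 2 *\<^sub>R P)"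
proof -
  have "exp_m (2 *\<^sub>R Om) = mat 1 - 2 *\<^sub>R E + 2 *\<^sub>R K"
  proof (rule matrix_eqI_eigvec[OF E_sym])
    fix l v assume v: "E *v v = l *\<^sub>R v"
    show "exp_m (2 *\<^sub>R Om) *v v = (mat 1 - 2 *\<^sub>R E + 2 *\<^sub>R K) *v v"
    proof (cases "v = 0")
      case False
      note r = eigenvalue_range[OF v False]
      let ?t = "arcsin (sqrt l)"
      have c: "cos (2 * ?t) = 1 - 2 * l"
        using r by (simp add: cos_double_sin angle_range)
      have s: "sin (2 * ?t) / (2 * ?t) * 2 * angle_ratio l = 2" if "l \<noteq> 0"
      proof -
        have "sqrt l \<noteq> 0" "sqrt (1 - l) \<noteq> 0" "?t \<noteq> 0" using r that angle_range(3)[OF r] by auto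
        then show ?thesis using that r by (simp add: sin_double angle_range angle_ratio_def)
      qed
      \<comment> \<open>For l = 0 the coefficient evaluates to a default of division by 0; it
        multiplies the zero vector.\<close>
      have K0: "K *v v = 0" if "l = 0"
        using Om_eigvec(1,3)[OF v] that by (simp add: angle_ratio_def)
      have "exp_m (2 *\<^sub>R Om) *v v = (1 - 2 * l) *\<^sub>R v + 2 *\<^sub>R (K *v v)"
        using exp_Om_eigvec[OF v, of 2] s K0
        by (cases "l = 0") (simp_all add: c Om_eigvec(1)[OF v])
      then show ?thesis by (simp add: matrix_vector_simps v algebra_simps)
    qed simp
  qed
  also have "\<dots> = (mat 1 - 2 *\<^sub>R R) ** (mat 1 - 2 *\<^sub>R P)"
  proof -
    have "mat 1 - 2 *\<^sub>R E + 2 *\<^sub>R K = mat 1 + 2 *\<^sub>R (K - E)"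
      by (simp add: scaleR_diff_right)
    then show ?thesis
      unfolding K_minus_E by (simp add: matrix_distribs scaleR_diff_right algebra_simps)
  qed
  finally show ?thesis .
qed

text \<open>On an eigenvector the rotation is cos \<theta> v + (1 / cos \<theta>) K v, and 1 / cos
  \<theta> can be factored out because cos^2 \<theta> = 1 - l.\<close>

lemma exp_Om: "exp_m Om = (mat 1 - E + K) ** matfun (\<lambda>l. 1 / sqrt (1 - l)) E"
proof (rule matrix_eqI_eigvec[OF E_sym])
  fix l v assume v: "E *v v = l *\<^sub>R v"
  show "exp_m Om *v v = ((mat 1 - E + K) ** matfun (\<lambda>l. 1 / sqrt (1 - l)) E) *v v"
  proof (cases "v = 0")
    case False
    note r = eigenvalue_range[OF v False]
    let ?t = "arcsin (sqrt l)"
    have nz: "sqrt (1 - l) \<noteq> 0" using r by simp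
    have s: "sin ?t / ?t * angle_ratio l = 1 / sqrt (1 - l)" if "l \<noteq> 0"
    proof -
      have "sqrt l \<noteq> 0" "?t \<noteq> 0" using r that angle_range(3)[OF r] by auto
      then show ?thesis using that r nz by (simp add: angle_range angle_ratio_def)
    qed
    have K0: "K *v v = 0" if "l = 0"
      using Om_eigvec(1,3)[OF v] that by (simp add: angle_ratio_def)
    have "exp_m Om *v v = sqrt (1 - l) *\<^sub>R v + (1 / sqrt (1 - l)) *\<^sub>R (K *v v)"
      using exp_Om_eigvec[OF v, of 1] s K0 r
      by (cases "l = 0") (simp_all add: angle_range Om_eigvec(1)[OF v])
    moreover have "sqrt (1 - l) = 1 / sqrt (1 - l) * (1 - l)" using r by (simp add: real_div_sqrt)
    moreover have "(mat 1 - E + K) *v v = (1 - l) *\<^sub>R v + K *v v"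
      by (simp add: matrix_vector_simps v scaleR_diff_left)
    ultimately show ?thesis
      by (simp add: matrix_vector_mul_assoc[symmetric] matfun_eigvec[OF E_sym v]
          matrix_vector_mult_scaleR scaleR_add_right)
  qed simp
qed

lemma R_exp_Om: "R ** exp_m Om = exp_m Om ** P"
proof -
  let ?T = "matfun (\<lambda>l. 1 / sqrt (1 - l)) E"
  have "exp_m Om ** P = (mat 1 - E + K) ** (?T ** P)" by (simp add: exp_Om matrix_mul_assoc)
  also have "?T ** P = P ** ?T" by (rule matfun_commute[OF E_sym E_P])
  finally show ?thesis by (simp add: exp_Om matrix_mul_assoc R_left_factor P_right_factor)
qed

text \<open>By \<open>R_exp_Om\<close> a factor R on the left changes nothing on the range of P, and
  it turns I - E + K into R P. The result contains neither K nor an angle; smoothness is proved for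
  this form.\<close>

lemma exp_Om_P: "exp_m Om ** P = R ** matfun (\<lambda>l. 1 / sqrt (1 - l)) E ** P"
proof -
  let ?T = "matfun (\<lambda>l. 1 / sqrt (1 - l)) E"
  have "R ** exp_m Om ** P = R ** ?T ** P"
  proof -
    have "R ** exp_m Om ** P = R ** (P ** ?T) ** P"
      by (simp add: exp_Om matrix_mul_assoc R_left_factor)
    also have "P ** ?T = ?T ** P" using matfun_commute[OF E_sym E_P] by metis
    finally show ?thesis by (simp add: matrix_mul_assoc P_idem_right)
  qed
  moreover have "R ** exp_m Om ** P = exp_m Om ** P" by (simp add: R_exp_Om P_idem_right)
  ultimately show ?thesis by simp
qed

lemma Om_square: "Om ** Om = matfun (\<lambda>l. - ((arcsin (sqrt l))^2)) E"
proof (rule matrix_eqI_eigvec[OF E_sym])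
  fix l v assume v: "E *v v = l *\<^sub>R v"
  show "(Om ** Om) *v v = matfun (\<lambda>l. - ((arcsin (sqrt l))^2)) E *v v"
    by (simp add: matrix_vector_mul_assoc[symmetric] Om_eigvec(2)[OF v] matfun_eigvec[OF E_sym v])
qed

text \<open>The angles are finitely many and each is below \<pi>/2, so their maximum is too.
  Inserting 0 makes c nonnegative.\<close>

lemma Om_bound: "\<exists>c. 0 \<le> c \<and> c < pi / 2 \<and> (\<forall>x. norm (Om *v x) \<le> c * norm x)"
proof -
  define T where "T = insert 0 ((\<lambda>l. arcsin (sqrt l)) ` eigenvalues E)"
  define c where "c = Max T"
  have fin: "finite T" unfolding T_def using finite_symmetric_eigenvalues[OF E_sym] by simp
  have "0 \<le> c" unfolding c_def using fin by (intro Max_ge) (auto simp: T_def)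
  have ev: "l \<in> eigenvalues E" if "E *v v = l *\<^sub>R v" "v \<noteq> 0" for l v
    using that by (auto simp: eigenvalues_iff)
  have "t < pi / 2" if "t \<in> T" for t
  proof -
    consider "t = 0" | l v where "t = arcsin (sqrt l)" "v \<noteq> 0" "E *v v = l *\<^sub>R v"
      using \<open>t \<in> T\<close> by (auto simp: T_def eigenvalues_iff)
    then show ?thesis
    proof cases
      case 2
      then show ?thesis using angle_range(2)[OF eigenvalue_range[OF 2(3,2)]] by simp
    qed simp
  qed
  then have "c < pi / 2" unfolding c_def using fin by (subst Max_less_iff) (auto simp: T_def)
  have "norm (Om *v x) \<le> c * norm x" for x
  proof (rule power2_le_imp_le)
    have "- (c^2) * (x \<bullet> x) \<le> x \<bullet> (matfun (\<lambda>l. - ((arcsin (sqrt l))^2)) E *v x)"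
    proof (rule matfun_inner_ge[OF E_sym])
      fix l v assume "v \<noteq> 0" and v: "E *v v = l *\<^sub>R v"
      have "arcsin (sqrt l) \<le> c" unfolding c_def using fin ev[OF v \<open>v \<noteq> 0\<close>]
        by (intro Max_ge) (auto simp: T_def)
      then show "- (c^2) \<le> - ((arcsin (sqrt l))^2)"
        using angle_range(1)[OF eigenvalue_range[OF v \<open>v \<noteq> 0\<close>]] by (simp add: power_mono)
    qed
    then have "- (x \<bullet> (Om *v (Om *v x))) \<le> c^2 * (x \<bullet> x)"
      by (simp add: Om_square[symmetric] matrix_vector_mul_assoc)
    moreover have "(norm (Om *v x))^2 = - (x \<bullet> (Om *v (Om *v x)))"
      unfolding dot_square_norm[symmetric] inner_matrix_vector_left Om_skew
      by (simp add: matrix_vector_mult_def inner_vec_def sum_negf)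
    ultimately show "(norm (Om *v x))^2 \<le> (c * norm x)^2"
      by (simp add: power_mult_distrib dot_square_norm)
  qed (simp add: \<open>0 \<le> c\<close>)
  then show ?thesis using \<open>0 \<le> c\<close> \<open>c < pi / 2\<close> by blast
qed

lemma log_m_rotation: "log_m ((mat 1 - 2 *\<^sub>R R) ** (mat 1 - 2 *\<^sub>R P)) = 2 *\<^sub>R Om"
proof (rule log_m_eqI[OF exp_2_Om])
  show "transpose (2 *\<^sub>R Om) = - (2 *\<^sub>R Om)" by (simp add: transpose_simps Om_skew)
next
  fix z assume z: "z \<in> eigenvalues (complexify (2 *\<^sub>R Om))"
  obtain c where c: "c < pi / 2" "\<And>x. norm (Om *v x) \<le> c * norm x" using Om_bound by blast
  have "norm ((2 *\<^sub>R Om) *v x) \<le> (2 * c) * norm x" for x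
    using c(2)[of x] by (simp add: scaleR_matrix_vector_assoc[symmetric])
  from complex_eigenvalue_bound[OF this z] have "cmod z \<le> 2 * c" .
  then show "\<bar>Im z\<bar> < pi" using c(1) abs_Im_le_cmod[of z] by linarith
qed

lemma grassmann_log_rotation: "grassmann_log P R = Om ** P - P ** Om"
  by (simp add: grassmann_log_def log_m_rotation Let_def)

text \<open>\<Omega> has no diagonal block on the range of P, since already P K P = 0. Hence the
  lift \<Omega> U is horizontal and the term A of the exponential vanishes.\<close>

lemma P_Om_P: "P ** Om ** P = 0"
proof -
  have "P ** Om ** P = P ** K ** (matfun angle_ratio E ** P)"
    by (simp add: rotation_log_def matrix_mul_assoc)
  also have "\<dots> = (P ** K ** P) ** matfun angle_ratio E"
    by (simp add: matfun_commute[OF E_sym E_P] matrix_mul_assoc)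
  finally show ?thesis by (simp add: P_K_P)
qed

text \<open>With D = \<Omega> U one has A = 0 and U C = - \<Omega> D, because \<Omega>^2 commutes
  with P. Thus (U, D) carries the block matrix to \<Omega>, and therefore its exponential to exp
  \<Omega>.\<close>

lemma holonomy_eq_rotation:
  fixes U :: "real^'m^'n"
  assumes U: "U \<in> stiefel I" and UP: "U ** transpose U = P"
  shows "holonomy I P R U = exp_m Om ** U"
proof -
  note UU = stiefel_mult(1)[OF U] and Uid = stiefel_mult(2)[OF U]
  have PU: "P ** U = U" using stiefel_mult(3)[OF U] by (simp add: UP)
  have tUP: "transpose U ** P = transpose U" by (metis PU P_sym matrix_transpose_mul)
  define D where "D = Om ** U"
  have "P ** Om ** U = P ** Om ** P ** U" by (simp add: PU matrix_mul_assoc[symmetric])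
  then have POmU: "P ** Om ** U = 0" by (simp add: P_Om_P)
  then have D: "horizontal_lift U (grassmann_log P R) = D"
    by (simp add: horizontal_lift_def grassmann_log_rotation D_def matrix_distribs)
      (simp add: matrix_mul_assoc[symmetric] PU)
  have "transpose U ** D = transpose U ** (P ** Om ** U)"
    by (simp add: D_def matrix_mul_assoc tUP)
  then have A: "transpose U ** D = 0" by (simp add: POmU)
  have "U ** (transpose D ** D) = - (P ** (Om ** Om) ** U)"
    by (simp add: D_def matrix_transpose_mul Om_skew matrix_distribs matrix_mul_assoc UP)
  also have "P ** (Om ** Om) = (Om ** Om) ** P"
    unfolding Om_square using matfun_commute[OF E_sym E_P] by metis
  finally have C: "U ** (transpose D ** D) = - (Om ** D)"
    by (simp add: D_def matrix_mul_assoc[symmetric] PU)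
  have Did: "D ** id_on I = D" by (simp add: D_def matrix_mul_assoc[symmetric] Uid)
  \<comment> \<open>The block matrix of \<open>stiefel_exp\<close> at A = 0. After exponentiation,
    \<open>vcat (id_on I) 0\<close> selects the block U of (U, D).\<close>
  let ?B = "vcat (hcat 0 (- (transpose D ** D))) (hcat (id_on I) 0)"
  have "hcat U D ** ?B = Om ** hcat U D"
    by (simp add: hcat_vcat_mult mult_hcat add_hcat matrix_distribs C Did) (simp add: D_def)
  from exp_m_intertwine[OF this]
  have "hcat U D ** exp_m ?B ** vcat (id_on I) 0 = exp_m Om ** U"
    by (simp add: matrix_mul_assoc[symmetric] hcat_vcat_mult Uid)
  then show ?thesis by (simp add: holonomy_def stiefel_exp_def D A Let_def)
qed

lemma exp_Om_orthogonal: "transpose (exp_m Om) ** exp_m Om = mat 1" "exp_m Om ** transpose (exp_m Om) = mat 1"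
proof -
  show 1: "transpose (exp_m Om) ** exp_m Om = mat 1"
    using exp_m_skew_orthogonal[OF Om_skew, of 1] by simp
  then show "exp_m Om ** transpose (exp_m Om) = mat 1" by (simp add: matrix_left_right_inverse)
qed

lemma holonomy_stiefel:
  fixes U :: "real^'m^'n"
  assumes U: "U \<in> stiefel I" and UP: "U ** transpose U = P"
  shows "holonomy I P R U \<in> stiefel I"
    "holonomy I P R U ** transpose (holonomy I P R U) = R"
    "holonomy I P R U = R ** matfun (\<lambda>l. 1 / sqrt (1 - l)) E ** U"
proof -
  let ?W = "exp_m Om"
  note UU = stiefel_mult(1)[OF U] and Uid = stiefel_mult(2)[OF U]
  have PU: "P ** U = U" using stiefel_mult(3)[OF U] by (simp add: UP)
  have "transpose (?W ** U) ** (?W ** U) = transpose U ** (transpose ?W ** ?W) ** U"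
    by (simp add: matrix_transpose_mul matrix_mul_assoc)
  then have "transpose (?W ** U) ** (?W ** U) = id_on I" by (simp add: exp_Om_orthogonal UU)
  moreover have "?W ** U ** id_on I = ?W ** U" by (simp add: matrix_mul_assoc[symmetric] Uid)
  ultimately show "holonomy I P R U \<in> stiefel I"
    by (simp add: holonomy_eq_rotation[OF assms] stiefel_def restrict_cols_eq)
  have "?W ** U ** transpose (?W ** U) = ?W ** P ** transpose ?W"
    by (simp add: matrix_transpose_mul matrix_mul_assoc UP[symmetric])
  also have "\<dots> = R" by (simp add: R_exp_Om[symmetric]) (simp add: matrix_mul_assoc[symmetric] exp_Om_orthogonal)
  finally show "holonomy I P R U ** transpose (holonomy I P R U) = R"
    by (simp add: holonomy_eq_rotation[OF assms])
  have "?W ** U = ?W ** P ** U" by (simp add: PU matrix_mul_assoc[symmetric])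
  then show "holonomy I P R U = R ** matfun (\<lambda>l. 1 / sqrt (1 - l)) E ** U"
    by (simp add: holonomy_eq_rotation[OF assms] exp_Om_P) (simp add: PU matrix_mul_assoc[symmetric])
qed

end

section \<open>Lengths of curves\<close>

text \<open>Integrate f' \<le> c |\<gamma>'|. The bound is required only where \<gamma> is
  differentiable, which leaves out finitely many parameters, and f is continuous across
  them.\<close>

lemma curve_length_ge_difference:
  fixes \<gamma> :: "real \<Rightarrow> 'a::euclidean_space" and f :: "real \<Rightarrow> real"
  assumes \<gamma>: "\<gamma> piecewise_C1_differentiable_on {0..1}" and f: "continuous_on {0..1} f" and "c > 0"
    and f': "\<And>t D. 0 < t \<Longrightarrow> t < 1 \<Longrightarrow> (\<gamma> has_vector_derivative D) (at t) \<Longrightarrow>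
       \<exists>d. (f has_vector_derivative d) (at t) \<and> d \<le> c * norm D"
  shows "ennreal (f 1 - f 0) \<le> ennreal c * curve_length \<gamma>"
proof -
  obtain S D where S: "finite S" and
    D: "\<And>t. t \<in> {0..1} - S \<Longrightarrow> (\<gamma> has_vector_derivative D t) (at t)" "continuous_on ({0..1} - S) D"
    using \<gamma> unfolding piecewise_C1_differentiable_on_def C1_differentiable_on_def by metis
  \<comment> \<open>The speed, set to 0 at the break points, where \<open>vector_derivative\<close>
    is uncontrolled; this makes it measurable and changes it on a null set only.\<close>
  define h where "h t = indicator ({0..1} - S) t *\<^sub>R norm (D t)" for t
  have h0: "h t \<ge> 0" for t by (simp add: h_def)
  have meas: "h \<in> borel_measurable borel"
    unfolding h_def using S D(2)
    by (intro borel_measurable_continuous_on_indicator continuous_on_norm sets.Diff borel_closed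
        finite_imp_closed closed_atLeastAtMost)
  have "AE t in lborel. t \<notin> S"
    using S by (intro AE_not_in) (auto simp: finite_imp_null_set_lborel)
  then have len: "curve_length \<gamma> = (\<integral>\<^sup>+t. ennreal (h t) \<partial>lborel)"
    unfolding curve_length_def
  proof (intro nn_integral_cong_AE, elim AE_mp, intro AE_I2 impI)
    fix t assume "t \<notin> S"
    then show "ennreal (norm (vector_derivative \<gamma> (at t))) * indicator {0..1} t = ennreal (h t)"
      using D(1)[of t] by (auto simp: h_def indicator_def vector_derivative_at)
  qed
  show ?thesis
  proof (cases "curve_length \<gamma> = \<infinity>")
    case True
    then show ?thesis using \<open>c > 0\<close> by (simp add: ennreal_mult_top)
  next
    case False
    then obtain L where L: "curve_length \<gamma> = ennreal L" "L \<ge> 0"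
      by (cases "curve_length \<gamma>") auto
    have "(h has_integral L) UNIV"
      by (rule nn_integral_has_integral[OF meas h0]) (use len L in auto)
    moreover have "h = (\<lambda>t. if t \<in> {0..1} then h t else 0)" by (auto simp: h_def indicator_def)
    ultimately have hL: "(h has_integral L) {0..1}" by (metis has_integral_restrict_UNIV)
    define d where "d t = (if t \<in> {0<..<1} - S then
       SOME d. (f has_vector_derivative d) (at t) \<and> d \<le> c * norm (D t) else 0)" for t
    have d: "(f has_vector_derivative d t) (at t) \<and> d t \<le> c * norm (D t)" if "t \<in> {0<..<1} - S" for t
    proof -
      have "\<exists>d. (f has_vector_derivative d) (at t) \<and> d \<le> c * norm (D t)"
        using that by (intro f' D(1)) auto
      from someI_ex[OF this] show ?thesis using that by (simp add: d_def)
    qed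
    have "(d has_integral (f 1 - f 0)) {0..1}"
      by (rule fundamental_theorem_of_calculus_interior_strong[OF S _ _ f]) (use d in auto)
    moreover have "((\<lambda>t. c * h t) has_integral (c * L)) {0..1}"
      using hL by (rule has_integral_mult_right)
    moreover have "d t \<le> c * h t" for t
    proof (cases "t \<in> {0<..<1} - S")
      case True
      then show ?thesis using d[OF True] by (simp add: h_def indicator_def)
    next
      case False
      then show ?thesis using h0[of t] \<open>c > 0\<close> by (auto simp: d_def)
    qed
    ultimately have "f 1 - f 0 \<le> c * L" by (rule has_integral_le)
    then show ?thesis using \<open>c > 0\<close> L by (simp add: ennreal_mult[symmetric] ennreal_leI)
  qed
qed

lemma inner_matrix_mult_left:
  fixes A :: "real^'n^'m"
  shows "(A ** X) \<bullet> Y = X \<bullet> (transpose A ** Y)"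
proof -
  have "(A ** X) \<bullet> Y = (\<Sum>i\<in>UNIV. \<Sum>j\<in>UNIV. \<Sum>k\<in>UNIV. A $ i $ k * X $ k $ j * Y $ i $ j)"
    by (simp add: inner_vec_def matrix_matrix_mult_def sum_distrib_right)
  also have "\<dots> = (\<Sum>i\<in>UNIV. \<Sum>k\<in>UNIV. \<Sum>j\<in>UNIV. A $ i $ k * X $ k $ j * Y $ i $ j)"
    by (intro sum.cong refl sum.swap)
  also have "\<dots> = (\<Sum>k\<in>UNIV. \<Sum>i\<in>UNIV. \<Sum>j\<in>UNIV. A $ i $ k * X $ k $ j * Y $ i $ j)"
    by (rule sum.swap)
  also have "\<dots> = (\<Sum>k\<in>UNIV. \<Sum>j\<in>UNIV. \<Sum>i\<in>UNIV. A $ i $ k * X $ k $ j * Y $ i $ j)"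
    by (intro sum.cong refl sum.swap)
  also have "\<dots> = X \<bullet> (transpose A ** Y)"
    by (simp add: inner_vec_def matrix_matrix_mult_def transpose_def sum_distrib_left mult_ac)
  finally show ?thesis .
qed

lemma norm_orthogonal_mult:
  fixes W :: "real^'n^'n"
  assumes "transpose W ** W = mat 1"
  shows "norm (W ** X) = norm X"
  by (simp add: norm_eq_sqrt_inner inner_matrix_mult_left matrix_mul_assoc assms)

text \<open>Outer products with orthonormal second factors are orthogonal for the Frobenius inner
  product, so Pythagoras applies.\<close>

lemma norm_sum_outer:
  assumes "finite B" "\<And>b c. b \<in> B \<Longrightarrow> c \<in> B \<Longrightarrow> \<beta> b \<bullet> \<beta> c = (if b = c then 1 else 0)"
  shows "(norm (\<Sum>b\<in>B. outer (e b) (\<beta> b)))^2 = (\<Sum>b\<in>B. (norm (e b))^2)"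
proof -
  have "(norm (\<Sum>b\<in>B. outer (e b) (\<beta> b)))^2 = (\<Sum>b\<in>B. (norm (outer (e b) (\<beta> b)))^2)"
    using assms
    by (intro norm_sum_Pythagorean) (auto simp: pairwise_def orthogonal_def inner_outer)
  also have "\<dots> = (\<Sum>b\<in>B. (norm (e b))^2)"
    using assms by (intro sum.cong) (auto simp: dot_square_norm[symmetric] inner_outer)
  finally show ?thesis .
qed

context projector_pair
begin

text \<open>These are the principal vectors of P relative to R: an eigenbasis of E inside the range
  of P. \<open>angle\<close> gives the principal angles.\<close>

definition principal_basis :: "(real^'n) set" where
  "principal_basis = (SOME B. eigenbasis E (range ((*v) P)) B)"

definition angle :: "real^'n \<Rightarrow> real" where
  "angle b = arcsin (sqrt (b \<bullet> (E *v b)))"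

lemma principal_basis: "eigenbasis E (range ((*v) P)) principal_basis"
  unfolding principal_basis_def
proof (rule someI_ex, rule eigenbasis_exists[OF E_sym])
  show "subspace (range ((*v) P))" by (rule subspace_range_matrix)
  fix x assume "x \<in> range ((*v) P)"
  then obtain y where "x = P *v y" by blast
  then have "E *v x = P *v (E *v y)" by (simp add: matrix_vector_mul_assoc E_P)
  then show "E *v x \<in> range ((*v) P)" by blast
qed

lemma principal_vector:
  assumes b: "b \<in> principal_basis"
  shows "P *v b = b" "norm b = 1" "E *v b = (b \<bullet> (E *v b)) *\<^sub>R b"
    "0 \<le> angle b" "angle b < pi / 2" "norm (Om *v b) = angle b" "norm (R *v b) = cos (angle b)"
proof -
  have "b \<in> range ((*v) P)"
    using principal_basis span_base[OF b] by (auto simp: eigenbasis_def)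
  then show Pb: "P *v b = b" by (auto simp: matrix_vector_mul_assoc P_idem)
  show nb: "norm b = 1" and ev: "E *v b = (b \<bullet> (E *v b)) *\<^sub>R b"
    using principal_basis b by (auto simp: eigenbasis_def)
  have "b \<noteq> 0" using nb by auto
  note r = eigenvalue_range[OF ev this]
  show a: "0 \<le> angle b" "angle b < pi / 2" using angle_range[OF r] by (simp_all add: angle_def)
  have "(norm (Om *v b))^2 = - (b \<bullet> (Om *v (Om *v b)))"
    unfolding dot_square_norm[symmetric] inner_matrix_vector_left Om_skew
    by (simp add: matrix_vector_mult_def inner_vec_def sum_negf)
  also have "\<dots> = (angle b)^2"
    unfolding Om_eigvec(2)[OF ev] using nb by (simp add: angle_def dot_square_norm)
  finally show "norm (Om *v b) = angle b" using a by (simp add: power2_eq_iff_nonneg)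
  \<comment> \<open>From E P = P - P R P one gets |R b|^2 = 1 - sin^2 \<theta>, so |R b| is the
    cosine.\<close>
  have "E *v b = E *v (P *v b)" by (simp add: Pb)
  also have "\<dots> = b - P *v (R *v b)"
    by (simp add: matrix_vector_mul_assoc E_mult_P) (simp add: matrix_vector_simps Pb)
  finally have "b \<bullet> (E *v b) = b \<bullet> b - b \<bullet> (P *v (R *v b))" by (simp add: inner_diff_right)
  also have "b \<bullet> (P *v (R *v b)) = (R *v b) \<bullet> (R *v b)"
    by (metis P_sym Pb R_idem R_sym inner_matrix_vector_left matrix_vector_mul_assoc)
  finally have "(norm (R *v b))^2 = 1 - b \<bullet> (E *v b)"
    using nb by (simp add: dot_square_norm)
  then have "norm (R *v b) = sqrt (1 - b \<bullet> (E *v b))" by (metis norm_ge_zero real_sqrt_unique)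
  then show "norm (R *v b) = cos (angle b)" using angle_range(4)[OF r] by (simp add: angle_def)
qed

lemma finite_principal_basis: "finite principal_basis"
  using principal_basis eigenbasis_finite by blast

context
  fixes U :: "real^'m^'n" and I :: "'m set"
  assumes U: "U \<in> stiefel I" and UP: "U ** transpose U = P"
begin

lemma frame_inner:
  assumes "b \<in> principal_basis" "c \<in> principal_basis"
  shows "(transpose U *v b) \<bullet> (transpose U *v c) = (if b = c then 1 else 0)"
  using eigenbasis_inner[OF principal_basis assms] principal_vector(1)[OF assms(2)]
  by (simp add: inner_matrix_vector_left matrix_vector_mul_assoc UP)

text \<open>The coordinate vector of b in the frame U is supported on I, and there every frame Z
  acts isometrically. This follows b along a curve of frames.\<close>

lemma norm_stiefel_frame:
  assumes Z: "Z \<in> stiefel I" and b: "b \<in> principal_basis"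
  shows "norm (Z *v (transpose U *v b)) = 1"
proof -
  have "transpose (U ** id_on I) = transpose U" using U by (simp add: stiefel_def restrict_cols_eq)
  moreover have "transpose (id_on I :: real^'m^'m) = id_on I"
    by (auto simp: id_on_def restrict_cols_def mat_def transpose_def vec_eq_iff)
  ultimately have "id_on I ** transpose U = transpose U" by (simp add: matrix_transpose_mul)
  then have "transpose Z *v (Z *v (transpose U *v b)) = transpose U *v b"
    using Z by (simp add: matrix_vector_mul_assoc matrix_mul_assoc stiefel_def)
  then have "(norm (Z *v (transpose U *v b)))^2 = 1"
    using frame_inner[OF b b] by (simp add: dot_square_norm[symmetric] inner_matrix_vector_left)
  then show ?thesis using norm_ge_zero[of "Z *v (transpose U *v b)"]
    by (auto simp: power2_eq_1_iff simp del: norm_ge_zero)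
qed

text \<open>Expanding in principal vectors writes \<Omega> U as a sum of outer products of \<Omega>
  b with the orthonormal vectors of coordinates. The norm will be the length of the minimal
  curve.\<close>

lemma norm_Om_U: "(norm (Om ** U))^2 = (\<Sum>b\<in>principal_basis. (angle b)^2)"
proof -
  have "Om ** U = (\<Sum>b\<in>principal_basis. outer (Om *v b) (transpose U *v b))"
  proof -
    have "(Om ** U) *v x = (\<Sum>b\<in>principal_basis. outer (Om *v b) (transpose U *v b)) *v x" for x
    proof -
      have "U *v x = P *v (U *v x)"
        by (simp add: matrix_vector_mul_assoc UP[symmetric] stiefel_mult(3)[OF U])
      then have "U *v x \<in> range ((*v) P)" by blast
      from eigenbasis_expand[OF principal_basis this]
      have "Om *v (U *v x) = (\<Sum>b\<in>principal_basis. (b \<bullet> (U *v x)) *\<^sub>R (Om *v b))"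
        by (metis (no_types, lifting) linear_sum matrix_vector_mul_linear matrix_vector_mult_scaleR sum.cong)
      then show ?thesis
        by (simp add: matrix_vector_mult_sum_left outer_mult_vector inner_matrix_vector_left
            matrix_vector_mul_assoc)
    qed
    then show ?thesis by (simp add: matrix_eq)
  qed
  then show ?thesis
    using norm_sum_outer[OF finite_principal_basis, of "\<lambda>b. transpose U *v b" "\<lambda>b. Om *v b"]
    by (simp add: frame_inner principal_vector)
qed

text \<open>Each column \<open>Z (U\<^sup>T b)\<close> moves on the unit sphere and ends in the range of \<open>R\<close>, at angle at
  least \<open>angle b\<close> from \<open>b\<close>. The factor \<open>k < 1\<close> keeps the arguments of \<open>arccos\<close> away from its
  singularities.\<close>

lemma angle_sum_derivative:
  assumes k: "0 < k" "k < 1" and t: "0 < t" "t < 1"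
    and \<gamma>: "\<And>s. s \<in> {0..1} \<Longrightarrow> \<gamma> s \<in> stiefel I" and D: "(\<gamma> has_vector_derivative D) (at t)"
  shows "\<exists>d. ((\<lambda>s. \<Sum>b\<in>principal_basis. angle b * arccos (k * (b \<bullet> (\<gamma> s *v (transpose U *v b)))))
      has_vector_derivative d) (at t) \<and> d \<le> norm (Om ** U) * norm D"
proof -
  define z where "z b s = \<gamma> s *v (transpose U *v b)" for b s
  define f where "f b s = b \<bullet> z b s" for b s
  define q where "q b = sqrt (1 - (k * f b t)^2)" for b
  \<comment> \<open>Up to the component along z, this is the weighted gradient of arccos (k (b
    \<bullet> z)). Removing that component leaves the derivative unchanged by \<open>orth\<close>
    and gives |e b| \<le> \<open>angle b\<close>.\<close>
  define e where "e b = - (angle b * k / q b) *\<^sub>R (b - f b t *\<^sub>R z b t)" for b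
  let ?M = "\<Sum>b\<in>principal_basis. outer (e b) (transpose U *v b)"
  let ?d = "\<Sum>b\<in>principal_basis. angle b * (inverse (- q b) * (k * (b \<bullet> (D *v (transpose U *v b)))))"
  have zd: "(z b has_vector_derivative D *v (transpose U *v b)) (at t)" for b
    unfolding z_def by (rule bounded_linear.has_vector_derivative[OF bounded_linear_matrix_vector_left D])
  have fd: "(f b has_real_derivative b \<bullet> (D *v (transpose U *v b))) (at t)" for b
    unfolding f_def has_real_derivative_iff_has_vector_derivative
    by (rule bounded_linear.has_vector_derivative[OF bounded_linear_inner_right zd])
  have z1: "norm (z b s) = 1" if "s \<in> {0..1}" "b \<in> principal_basis" for b s
    unfolding z_def using norm_stiefel_frame[OF \<gamma>] that by blast
  have tt: "t \<in> {0..1}" using t by simp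
  have f1: "\<bar>f b t\<bar> \<le> 1" if "b \<in> principal_basis" for b
    using Cauchy_Schwarz_ineq2[of b "z b t"] z1[OF tt that] principal_vector(2)[OF that] by (simp add: f_def)
  have kf: "\<bar>k * f b t\<bar> < 1" if "b \<in> principal_basis" for b
  proof -
    have "\<bar>k * f b t\<bar> \<le> k * 1" using f1[OF that] k by (simp add: abs_mult)
    then show ?thesis using k by simp
  qed
  have q: "q b > 0" if "b \<in> principal_basis" for b
    unfolding q_def using kf[OF that] by (simp add: abs_square_less_1)
  have dd: "((\<lambda>s. \<Sum>b\<in>principal_basis. angle b * arccos (k * f b s)) has_real_derivative ?d) (at t)"
  proof (rule DERIV_sum)
    fix b assume b: "b \<in> principal_basis"
    have "((\<lambda>s. arccos (k * f b s)) has_real_derivative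
        inverse (- sqrt (1 - (k * f b t)^2)) * (k * (b \<bullet> (D *v (transpose U *v b))))) (at t)"
      using kf[OF b] by (intro DERIV_chain2[OF DERIV_arccos] DERIV_cmult fd) auto
    then show "((\<lambda>s. angle b * arccos (k * f b s)) has_real_derivative
        angle b * (inverse (- q b) * (k * (b \<bullet> (D *v (transpose U *v b)))))) (at t)"
      unfolding q_def by (rule DERIV_cmult)
  qed
  \<comment> \<open>Differentiate |z|^2 = 1, which holds in a neighbourhood of the interior
    parameter t.\<close>
  have orth: "z b t \<bullet> (D *v (transpose U *v b)) = 0" if b: "b \<in> principal_basis" for b
  proof -
    have "((\<lambda>s. z b s \<bullet> z b s) has_real_derivative
        z b t \<bullet> (D *v (transpose U *v b)) + (D *v (transpose U *v b)) \<bullet> z b t) (at t)"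
      unfolding has_real_derivative_iff_has_vector_derivative
      by (intro bounded_bilinear.has_vector_derivative[OF bounded_bilinear_inner] zd)
    moreover have "((\<lambda>s. z b s \<bullet> z b s) has_real_derivative 0) (at t)"
      by (rule has_field_derivative_transform_within_open[of "\<lambda>s. 1" _ _ "{0<..<1}"])
        (use t z1 b in \<open>auto simp: dot_square_norm\<close>)
    ultimately show ?thesis using DERIV_unique by (fastforce simp: inner_commute)
  qed
  have "?d = (\<Sum>b\<in>principal_basis. e b \<bullet> (D *v (transpose U *v b)))"
    by (intro sum.cong refl) (simp add: e_def inner_diff_left orth divide_inverse mult_ac)
  also have "\<dots> = D \<bullet> ?M"
    by (simp add: inner_sum_right inner_matrix_outer)
  also have "\<dots> \<le> norm D * norm ?M"
    by (rule norm_cauchy_schwarz)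
  finally have d_le: "?d \<le> norm D * norm ?M" .
  have "norm ?M \<le> norm (Om ** U)"
  proof (rule power2_le_imp_le)
    have "(norm (e b))^2 \<le> (angle b)^2" if b: "b \<in> principal_basis" for b
    proof -
      have bz: "b \<bullet> b = 1" "z b t \<bullet> z b t = 1"
        using principal_vector(2)[OF b] z1[OF tt b] by (simp_all add: dot_square_norm)
      have "(norm (b - f b t *\<^sub>R z b t))^2 = 1 - (f b t)^2"
        unfolding dot_square_norm[symmetric]
        by (simp add: inner_diff_left inner_diff_right bz inner_commute[of "z b t" b]
            power2_eq_square flip: f_def)
      then have "(norm (e b))^2 = (angle b)^2 * (k^2 * (1 - (f b t)^2) / (q b)^2)"
        by (simp add: e_def power_mult_distrib power_divide)
      \<comment> \<open>This is k^2 - k^2 f^2 \<le> 1 - k^2 f^2.\<close>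
      also have "k^2 * (1 - (f b t)^2) \<le> (q b)^2"
      proof -
        have "(q b)^2 = 1 - (k * f b t)^2"
          unfolding q_def using kf[OF b] by (simp add: abs_square_le_1)
        moreover have "k^2 \<le> 1" using k by (simp add: power_le_one)
        ultimately show ?thesis by (simp add: power_mult_distrib algebra_simps)
      qed
      then have "k^2 * (1 - (f b t)^2) / (q b)^2 \<le> 1" using q[OF b] by simp
      then have "(angle b)^2 * (k^2 * (1 - (f b t)^2) / (q b)^2) \<le> (angle b)^2 * 1"
        by (intro mult_left_mono) auto
      finally show ?thesis by simp
    qed
    then show "(norm ?M)^2 \<le> (norm (Om ** U))^2"
      unfolding norm_Om_U
      by (subst norm_sum_outer[OF finite_principal_basis]) (auto simp: frame_inner intro!: sum_mono)
  qed simp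
  then have "norm D * norm ?M \<le> norm D * norm (Om ** U)"
    by (rule mult_left_mono) simp
  with d_le have "?d \<le> norm (Om ** U) * norm D" by (simp only: mult.commute[of "norm (Om ** U)"])
  then show ?thesis
    using dd unfolding has_real_derivative_iff_has_vector_derivative f_def z_def by blast
qed

text \<open>Let c^2 be the sum of the squared angles. The weighted angle sum grows by at least c^2,
  up to a multiple of \<epsilon>, and by at most c times the length L. As \<epsilon> tends to 0, c^2
  \<le> c L, and c can be cancelled.\<close>

lemma geodesic_dist_ge:
  assumes W: "W \<in> stiefel I" and WR: "W ** transpose W = R"
  shows "ennreal (norm (Om ** U)) \<le> geodesic_dist (stiefel I) U W"
  unfolding geodesic_dist_def
proof (rule INF_greatest)
  fix \<gamma> assume "\<gamma> \<in> {\<gamma>. \<gamma> piecewise_C1_differentiable_on {0..1} \<and> \<gamma> ` {0..1} \<subseteq> stiefel I \<and>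
     \<gamma> 0 = U \<and> \<gamma> 1 = W}"
  then have C1: "\<gamma> piecewise_C1_differentiable_on {0..1}" and st: "\<And>s. s \<in> {0..1} \<Longrightarrow> \<gamma> s \<in> stiefel I"
    and \<gamma>0: "\<gamma> 0 = U" and \<gamma>1: "\<gamma> 1 = W" by auto
  define c where "c = norm (Om ** U)"
  have c2: "c^2 = (\<Sum>b\<in>principal_basis. (angle b)^2)" unfolding c_def by (rule norm_Om_U)
  show "ennreal (norm (Om ** U)) \<le> curve_length \<gamma>"
  proof (cases "c = 0 \<or> curve_length \<gamma> = \<infinity>")
    case True
    then show ?thesis by (auto simp: c_def)
  next
    case False
    then have "c > 0" by (simp add: c_def)
    obtain L where L: "curve_length \<gamma> = ennreal L" "L \<ge> 0" using False by (cases "curve_length \<gamma>") auto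
    have contg: "continuous_on {0..1} \<gamma>" using C1 by (simp add: piecewise_C1_differentiable_on_def)
    have bound: "c^2 \<le> c * L + \<epsilon> * (\<Sum>b\<in>principal_basis. angle b)" if eps: "0 < \<epsilon>" "\<epsilon> < pi / 2" for \<epsilon>
    proof -
      \<comment> \<open>At the start b \<bullet> z = 1, so with this k each arccos there equals
        \<epsilon>.\<close>
      define k where "k = cos \<epsilon>"
      have k: "0 < k" "k < 1"
        using eps cos_gt_zero_pi[of \<epsilon>] cos_monotone_0_pi[of 0 \<epsilon>] by (auto simp: k_def)
      define f where "f s = (\<Sum>b\<in>principal_basis. angle b * arccos (k * (b \<bullet> (\<gamma> s *v (transpose U *v b)))))" for s
      have le1: "\<bar>b \<bullet> (\<gamma> s *v (transpose U *v b))\<bar> \<le> 1" if "b \<in> principal_basis" "s \<in> {0..1}" for b s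
        using Cauchy_Schwarz_ineq2[of b "\<gamma> s *v (transpose U *v b)"]
          norm_stiefel_frame[OF st[OF that(2)] that(1)] principal_vector(2)[OF that(1)] by simp
      have kle1: "\<bar>k * (b \<bullet> (\<gamma> s *v (transpose U *v b)))\<bar> \<le> 1" if "b \<in> principal_basis" "s \<in> {0..1}" for b s
        using mult_mono[OF less_imp_le[OF k(2)] le1[OF that]] k by (simp add: abs_mult)
      have "continuous_on {0..1} f"
        unfolding f_def
      proof (intro continuous_on_sum continuous_on_mult continuous_on_const continuous_on_arccos
          continuous_on_inner ballI)
        show "continuous_on {0..1} (\<lambda>s. \<gamma> s *v (transpose U *v b))" for b
          by (rule bounded_linear.continuous_on[OF bounded_linear_matrix_vector_left contg])
      next
        fix b s assume "b \<in> principal_basis" "s \<in> {0..1::real}"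
        from kle1[OF this] show "- 1 \<le> k * (b \<bullet> (\<gamma> s *v (transpose U *v b))) \<and>
            k * (b \<bullet> (\<gamma> s *v (transpose U *v b))) \<le> 1" by linarith
      qed
      from this \<open>c > 0\<close> have "ennreal (f 1 - f 0) \<le> ennreal c * curve_length \<gamma>"
      proof (rule curve_length_ge_difference[OF C1])
        fix t D assume "0 < t" "t < 1" "(\<gamma> has_vector_derivative D) (at t)"
        from angle_sum_derivative[where \<gamma> = \<gamma>, OF k this(1,2) st this(3)]
        show "\<exists>d. (f has_vector_derivative d) (at t) \<and> d \<le> c * norm D"
          unfolding f_def c_def .
      qed
      then have "f 1 - f 0 \<le> c * L"
        using \<open>c > 0\<close> L by (simp add: ennreal_mult[symmetric] ennreal_le_iff)
      moreover have "f 0 = \<epsilon> * (\<Sum>b\<in>principal_basis. angle b)"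
      proof -
        have "b \<bullet> (U *v (transpose U *v b)) = 1" if "b \<in> principal_basis" for b
          using principal_vector(1,2)[OF that] by (simp add: matrix_vector_mul_assoc UP dot_square_norm)
        moreover have "arccos k = \<epsilon>" using eps by (simp add: k_def arccos_cos)
        ultimately show ?thesis by (simp add: f_def \<gamma>0 sum_distrib_left mult.commute)
      qed
      moreover have "c^2 \<le> f 1"
        unfolding c2 f_def
      proof (rule sum_mono)
        fix b assume b: "b \<in> principal_basis"
        let ?x = "b \<bullet> (W *v (transpose U *v b))"
        \<comment> \<open>The end point lies in the range of R, so only the projection R b, of norm
          cos \<theta>, contributes to its inner product with b.\<close>
        have "R ** W = W"
          using W by (simp add: WR[symmetric] stiefel_def restrict_cols_eq matrix_mul_assoc[symmetric])
        then have "?x = (R *v b) \<bullet> (W *v (transpose U *v b))"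
          by (simp add: inner_matrix_vector_left R_sym matrix_vector_mul_assoc matrix_mul_assoc)
        also have "\<dots> \<le> norm (R *v b) * norm (W *v (transpose U *v b))" by (rule norm_cauchy_schwarz)
        also have "\<dots> = cos (angle b)"
          using norm_stiefel_frame[OF W b] principal_vector(7)[OF b] by simp
        finally have "k * ?x \<le> k * cos (angle b)" using k by simp
        also have "\<dots> \<le> cos (angle b)"
          using k principal_vector(4,5)[OF b] by (simp add: cos_ge_zero mult_left_le_one_le)
        finally have "arccos (cos (angle b)) \<le> arccos (k * ?x)"
          using kle1[OF b, of 1] by (intro arccos_le_arccos) (auto simp: \<gamma>1)
        then have "angle b \<le> arccos (k * ?x)"
          using principal_vector(4,5)[OF b] by (simp add: arccos_cos)
        then show "(angle b)^2 \<le> angle b * arccos (k * (b \<bullet> (\<gamma> 1 *v (transpose U *v b))))"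
          using principal_vector(4)[OF b] by (simp add: \<gamma>1 power2_eq_square mult_left_mono)
      qed
      ultimately show ?thesis by simp
    qed
    define A where "A = (\<Sum>b\<in>principal_basis. angle b)"
    have "A \<ge> 0" unfolding A_def using principal_vector(4) by (simp add: sum_nonneg)
    have "c^2 \<le> c * L"
    proof (rule field_le_epsilon)
      fix e :: real assume "e > 0"
      \<comment> \<open>The bound 1 keeps \<epsilon> below \<pi>/2; the summand 1 in the denominator
        covers A = 0.\<close>
      define \<epsilon> where "\<epsilon> = min 1 (e / (A + 1))"
      have "0 < \<epsilon>" "\<epsilon> \<le> 1" using \<open>e > 0\<close> \<open>A \<ge> 0\<close> by (auto simp: \<epsilon>_def)
      then have "0 < \<epsilon>" "\<epsilon> < pi / 2" using pi_gt3 by linarith+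
      then have "c^2 \<le> c * L + \<epsilon> * A" using bound by (simp add: A_def)
      also have "\<epsilon> * A \<le> (e / (A + 1)) * (A + 1)"
        using \<open>A \<ge> 0\<close> \<open>e > 0\<close> by (intro mult_mono) (auto simp: \<epsilon>_def)
      finally show "c^2 \<le> c * L + e" using \<open>A \<ge> 0\<close> by simp
    qed
    then have "c \<le> L" using \<open>c > 0\<close> by (simp add: power2_eq_square)
    then show ?thesis using L by (simp add: c_def ennreal_leI)
  qed
qed

text \<open>The curve exp (t \<Omega>) U has constant speed |\<Omega> U|, as exp (t \<Omega>) is
  orthogonal and commutes with \<Omega>.\<close>

lemma geodesic_dist_holonomy_le:
  "geodesic_dist (stiefel I) U (holonomy I P R U) \<le> ennreal (norm (Om ** U))"
proof -
  define \<gamma> where "\<gamma> t = exp_m (t *\<^sub>R Om) ** U" for t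
  define D where "D t = Om ** exp_m (t *\<^sub>R Om) ** U" for t
  have D: "(\<gamma> has_vector_derivative D t) (at t)" for t
    unfolding \<gamma>_def D_def
    by (rule bounded_linear.has_vector_derivative[OF matrix_mult.bounded_linear_left exp_m_has_vector_derivative])
  have comm: "Om ** exp_m (t *\<^sub>R Om) = exp_m (t *\<^sub>R Om) ** Om" for t
    by (rule exp_m_intertwine) (simp add: matrix_distribs)
  have "norm (D t) = norm (Om ** U)" for t
    by (simp add: D_def comm matrix_mul_assoc[symmetric] norm_orthogonal_mult exp_m_skew_orthogonal[OF Om_skew])
  then have len: "curve_length \<gamma> = ennreal (norm (Om ** U))"
    by (simp add: curve_length_def vector_derivative_at[OF D] nn_integral_cmult_indicator)
  have "continuous_on UNIV \<gamma>"
    using D by (auto intro!: continuous_at_imp_continuous_on has_vector_derivative_continuous)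
  moreover have "D = (\<lambda>t. Om ** \<gamma> t)" by (rule ext) (simp add: D_def \<gamma>_def matrix_mul_assoc)
  ultimately have "continuous_on {0..1} D"
    using bounded_linear.continuous_on[OF matrix_mult.bounded_linear_right, of "{0..1}" \<gamma> Om]
    by (auto intro: continuous_on_subset)
  then have "\<gamma> C1_differentiable_on {0..1}" using D by (auto simp: C1_differentiable_on_def)
  then have C1: "\<gamma> piecewise_C1_differentiable_on {0..1}" by (rule C1_differentiable_imp_piecewise)
  note UU = stiefel_mult(1)[OF U] and Uid = stiefel_mult(2)[OF U]
  have st: "\<gamma> t \<in> stiefel I" for t
  proof -
    have "transpose (\<gamma> t) ** \<gamma> t = transpose U ** (transpose (exp_m (t *\<^sub>R Om)) ** exp_m (t *\<^sub>R Om)) ** U"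
      by (simp add: \<gamma>_def matrix_transpose_mul matrix_mul_assoc)
    then have "transpose (\<gamma> t) ** \<gamma> t = id_on I" by (simp add: exp_m_skew_orthogonal[OF Om_skew] UU)
    then show ?thesis
      by (simp add: stiefel_def restrict_cols_eq) (simp add: \<gamma>_def matrix_mul_assoc[symmetric] Uid)
  qed
  have "\<gamma> 0 = U" "\<gamma> 1 = holonomy I P R U"
    by (simp_all add: \<gamma>_def holonomy_eq_rotation[OF U UP])
  then show ?thesis
    unfolding geodesic_dist_def using C1 st by (intro INF_lower2[of \<gamma>]) (auto simp: len)
qed

lemma holonomy_is_arg_min:
  "is_arg_min (geodesic_dist (stiefel I) U) (\<lambda>W. W \<in> stiefel I \<and> W ** transpose W = R)
     (holonomy I P R U)"
  unfolding is_arg_min_def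
proof (intro conjI notI)
  assume "\<exists>W. (W \<in> stiefel I \<and> W ** transpose W = R) \<and>
    geodesic_dist (stiefel I) U W < geodesic_dist (stiefel I) U (holonomy I P R U)"
  then obtain W where W: "W \<in> stiefel I" "W ** transpose W = R"
    and less: "geodesic_dist (stiefel I) U W < geodesic_dist (stiefel I) U (holonomy I P R U)" by blast
  from less geodesic_dist_holonomy_le geodesic_dist_ge[OF W] show False by order
qed (use holonomy_stiefel(1,2)[OF U UP] in auto)

end

end

section \<open>Eigenprojectors of a symmetric matrix\<close>

text \<open>Each projector fixes the common range, so P Q = Q and Q P = P; transposing the second
  gives P Q = P.\<close>

lemma orthogonal_projector_unique:
  fixes P Q :: "real^'n^'n"
  assumes P: "transpose P = P" "P ** P = P" and Q: "transpose Q = Q" "Q ** Q = Q"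
    and range: "range ((*v) P) = range ((*v) Q)"
  shows "P = Q"
proof -
  have fix_range: "A ** B = B" if "A ** A = A" "range ((*v) B) = range ((*v) A)" for A B :: "real^'n^'n"
  proof -
    have "A *v (B *v x) = B *v x" for x
    proof -
      have "B *v x \<in> range ((*v) A)" using that(2) by blast
      then obtain y where "B *v x = A *v y" by blast
      then show ?thesis using that(1) by (metis matrix_vector_mul_assoc)
    qed
    then show ?thesis by (simp add: matrix_eq matrix_vector_mul_assoc)
  qed
  have "P ** Q = Q" by (rule fix_range[OF P(2) range[symmetric]])
  moreover have QP: "Q ** P = P" by (rule fix_range[OF Q(2) range])
  have "P ** Q = transpose (Q ** P)" by (simp only: matrix_transpose_mul P(1) Q(1))
  then have "P ** Q = P" by (simp only: QP P(1))
  ultimately show ?thesis by simp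
qed

lemma orthogonal_projector_props:
  fixes V :: "(real^'n) set"
  assumes V: "subspace V"
  defines "P \<equiv> orthogonal_projector V"
  shows "transpose P = P" "P ** P = P" "range ((*v) P) = V" "P \<bullet> P = real (rank P)"
proof -
  \<comment> \<open>An eigenbasis of the identity is just an orthonormal basis.\<close>
  obtain B where B: "eigenbasis (mat 1) V B" using eigenbasis_exists[of "mat 1" V] V by auto
  have fin: "finite B" using B by (rule eigenbasis_finite)
  define Q where "Q = (\<Sum>b\<in>B. outer b b)"
  have Qx: "Q *v x = (\<Sum>b\<in>B. (b \<bullet> x) *\<^sub>R b)" for x
    by (simp add: Q_def matrix_vector_mult_sum_left outer_mult_vector)
  have BV: "b \<in> V" if "b \<in> B" for b using B span_base[OF that] by (auto simp: eigenbasis_def)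
  have QV: "Q *v x \<in> V" for x
    unfolding Qx using V BV by (intro subspace_sum subspace_scale) auto
  have Qid: "Q *v x = x" if "x \<in> V" for x using eigenbasis_expand[OF B that] by (simp add: Qx)
  have Q: "transpose Q = Q" "Q ** Q = Q" "range ((*v) Q) = V"
  proof -
    show "transpose Q = Q" by (simp add: Q_def linear_sum[OF linear_transpose] transpose_outer)
    show "Q ** Q = Q" using Qid[OF QV] by (simp add: matrix_eq matrix_vector_mul_assoc[symmetric])
    show "range ((*v) Q) = V" 
    proof (intro equalityI subsetI)
      fix x assume "x \<in> V"
      then show "x \<in> range ((*v) Q)" using Qid[of x] by (intro image_eqI[of _ _ x]) auto
    qed (use QV in auto)
  qed
  have "P = Q"
    unfolding P_def orthogonal_projector_def
  proof (rule the_equality)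
    show "transpose Q = Q \<and> Q ** Q = Q \<and> range ((*v) Q) = V" using Q by blast
    fix Q' assume "transpose Q' = Q' \<and> Q' ** Q' = Q' \<and> range ((*v) Q') = V"
    then show "Q' = Q" using Q by (intro orthogonal_projector_unique[of Q' Q]) simp_all
  qed
  then show "transpose P = P" "P ** P = P" "range ((*v) P) = V" using Q by simp_all
  have "independent B"
    using B by (intro pairwise_orthogonal_independent) (auto simp: eigenbasis_def)
  then have "card B = dim (span B)" by (simp add: dim_eq_card_independent)
  moreover have "span B = V" using B by (simp add: eigenbasis_def)
  ultimately have "card B = dim V" by metis
  then have "rank Q = card B" using Q(3) by (simp add: rank_dim_range)
  moreover have "(norm Q)^2 = real (card B)"
  proof -
    have "(norm Q)^2 = (\<Sum>b\<in>B. (norm b)^2)"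
      unfolding Q_def using fin eigenbasis_inner[OF B] by (rule norm_sum_outer)
    then show ?thesis using B by (simp add: eigenbasis_def)
  qed
  ultimately show "P \<bullet> P = real (rank P)" using \<open>P = Q\<close> by (simp add: dot_square_norm)
qed

lemma subspace_eigenspace: "subspace (eigenspace (A :: real^'n^'n) l)"
  by (auto simp: subspace_def eigenspace_def scalar_mult_eq_scaleR matrix_vector_simps scaleR_add_right)

lemma eigval_antimono:
  fixes A :: "real^'n^'n"
  assumes "1 \<le> i" "i < j" "j \<le> card (eigenvalues A)"
  shows "eigval A j < eigval A i"
proof -
  let ?l = "sorted_list_of_set (eigenvalues A)"
  have "sorted_wrt (<) ?l" by simp
  then have "?l ! (length ?l - j) < ?l ! (length ?l - i)"
    using assms by (intro sorted_wrt_nth_less[of "(<)" ?l]) auto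
  then show ?thesis using assms by (simp add: eigval_def rev_nth)
qed

lemma eigval_image:
  fixes A :: "real^'n^'n"
  assumes "transpose A = A"
  shows "eigval A ` {1..card (eigenvalues A)} = eigenvalues A"
proof -
  let ?l = "rev (sorted_list_of_set (eigenvalues A))"
  have "eigenvalues A = set ?l" using finite_symmetric_eigenvalues[OF assms] by simp
  also have "\<dots> = (\<lambda>k. ?l ! k) ` {..<card (eigenvalues A)}"
    by (auto simp: set_conv_nth image_def)
  also have "\<dots> = eigval A ` {1..card (eigenvalues A)}"
  proof -
    have "{..<card (eigenvalues A)} = (\<lambda>i. i - 1) ` {1..card (eigenvalues A)}"
    proof (intro equalityI subsetI)
      fix k assume "k \<in> {..<card (eigenvalues A)}"
      then show "k \<in> (\<lambda>i. i - 1) ` {1..card (eigenvalues A)}"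
        by (intro image_eqI[of _ _ "Suc k"]) auto
    qed auto
    then show ?thesis by (simp add: image_image eigval_def)
  qed
  finally show ?thesis by simp
qed

text \<open>A finite set has only one strictly decreasing enumeration; this lets perturbed
  eigenvalues be matched by index.\<close>

lemma eigval_unique:
  fixes A :: "real^'n^'n"
  assumes sym: "transpose A = A" and f: "f ` {1..r} = eigenvalues A" and r: "card (eigenvalues A) = r"
    and dec: "\<And>i j. 1 \<le> i \<Longrightarrow> i < j \<Longrightarrow> j \<le> r \<Longrightarrow> f j < f i"
    and i: "i \<in> {1..r}"
  shows "eigval A i = f i"
proof -
  let ?xs = "map f [1..<Suc r]"
  have "sorted_wrt (<) (rev ?xs)"
    unfolding sorted_wrt_rev sorted_wrt_map by (rule sorted_wrt_mono_rel[OF _ sorted_wrt_upt]) (auto intro: dec)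
  moreover have "sorted_wrt (<) (sorted_list_of_set (eigenvalues A))" by simp
  moreover have "set (sorted_list_of_set (eigenvalues A)) = set (rev ?xs)"
  proof -
    have "set (rev ?xs) = f ` {1..r}" by auto
    then show ?thesis using f finite_symmetric_eigenvalues[OF sym] by simp
  qed
  ultimately have "sorted_list_of_set (eigenvalues A) = rev ?xs" by (intro strict_sorted_equal) auto
  then have "eigval A i = ?xs ! (i - 1)" by (simp add: eigval_def)
  also have "\<dots> = f i" using i by (auto simp del: upt_Suc)
  finally show ?thesis .
qed

locale symmetric_matrix =
  fixes A :: "real^'n^'n"
  assumes A_sym: "transpose A = A"
begin

abbreviation "r \<equiv> card (eigenvalues A)"

lemma eigproj_props:
  shows "transpose (eigproj A i) = eigproj A i" "eigproj A i ** eigproj A i = eigproj A i"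
    "range ((*v) (eigproj A i)) = eigenspace A (eigval A i)"
    "eigproj A i \<bullet> eigproj A i = real (flag_type A i)"
  using orthogonal_projector_props[OF subspace_eigenspace, of A "eigval A i"]
  by (auto simp: eigproj_def flag_type_def)

lemma eigval_inj: "i \<in> {1..r} \<Longrightarrow> j \<in> {1..r} \<Longrightarrow> i \<noteq> j \<Longrightarrow> eigval A i \<noteq> eigval A j"
  using eigval_antimono[of i j A] eigval_antimono[of j i A] by (cases "i < j") auto

lemma eigproj_mult_vector: "A *v (eigproj A i *v x) = eigval A i *\<^sub>R (eigproj A i *v x)"
proof -
  have "eigproj A i *v x \<in> eigenspace A (eigval A i)" using eigproj_props(3)[of i] by blast
  then show ?thesis by (simp add: eigenspace_def scalar_mult_eq_scaleR)
qed

lemma eigproj_left: "A ** eigproj A i = eigval A i *\<^sub>R eigproj A i"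
  by (simp add: matrix_eq matrix_vector_mul_assoc[symmetric] eigproj_mult_vector
      scaleR_matrix_vector_assoc[symmetric])

lemma eigproj_right: "eigproj A i ** A = eigval A i *\<^sub>R eigproj A i"
  by (metis A_sym eigproj_left eigproj_props(1) matrix_transpose_mul transpose_scalar)

lemma eigproj_id: "A *v v = eigval A i *\<^sub>R v \<Longrightarrow> eigproj A i *v v = v"
proof -
  assume "A *v v = eigval A i *\<^sub>R v"
  then have "v \<in> range ((*v) (eigproj A i))"
    by (simp add: eigproj_props(3) eigenspace_def scalar_mult_eq_scaleR)
  then show ?thesis by (auto simp: matrix_vector_mul_assoc eigproj_props(2))
qed

lemma eigproj_orthogonal:
  assumes "i \<in> {1..r}" "j \<in> {1..r}" "i \<noteq> j"
  shows "eigproj A i ** eigproj A j = 0"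
proof -
  have "x \<bullet> (eigproj A i *v (eigproj A j *v y)) = 0" for x y
    using symmetric_eigvec_orthogonal[OF A_sym eigproj_mult_vector eigproj_mult_vector eigval_inj[OF assms]]
    by (metis eigproj_props(1) inner_matrix_vector_left)
  then have "eigproj A i *v (eigproj A j *v y) = 0" for y by (metis inner_eq_zero_iff)
  then show ?thesis by (simp add: matrix_eq matrix_vector_mul_assoc)
qed

lemma sum_eigproj: "(\<Sum>i\<in>{1..r}. eigproj A i) = mat 1"
proof (rule matrix_eqI_eigvec[OF A_sym])
  fix l v assume v: "A *v v = l *\<^sub>R v"
  show "(\<Sum>i\<in>{1..r}. eigproj A i) *v v = mat 1 *v v"
  proof (cases "v = 0")
    case False
    then have "l \<in> eigenvalues A"
      using v by (auto simp: eigenvalues_iff)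
    then obtain i where i: "i \<in> {1..r}" "l = eigval A i" using eigval_image[OF A_sym] by blast
    have Pi: "eigproj A i *v v = v" using v i by (intro eigproj_id) simp
    have "eigproj A k *v v = 0" if "k \<in> {1..r}" "k \<noteq> i" for k
      using eigproj_orthogonal[OF that(1) i(1) that(2)] Pi
      by (metis matrix_vector_mul_assoc matrix_vector_mult_0)
    then have "(\<Sum>k\<in>{1..r}. eigproj A k *v v) = (\<Sum>k\<in>{1..r}. if k = i then v else 0)"
      using Pi by (intro sum.cong) auto
    then show ?thesis using i by (simp add: matrix_vector_mult_sum_left)
  qed simp
qed

lemma eigproj_nonzero: "i \<in> {1..r} \<Longrightarrow> eigproj A i \<noteq> 0"
proof
  assume i: "i \<in> {1..r}" "eigproj A i = 0"
  then have "eigval A i \<in> eigenvalues A" using eigval_image[OF A_sym] by blast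
  then obtain v where "v \<noteq> 0" "A *v v = eigval A i *\<^sub>R v"
    by (auto simp: eigenvalues_iff)
  then show False using eigproj_id[of v i] i by simp
qed

text \<open>P and I - P are orthogonal summands of I. The bound is uniform in A and serves before
  continuity of the projectors is known.\<close>

lemma norm_eigproj_le: "norm (eigproj A i) \<le> norm (mat 1 :: real^'n^'n)"
proof (rule power2_le_imp_le)
  let ?P = "eigproj A i"
  have "mat 1 \<bullet> (mat 1 :: real^'n^'n) = ?P \<bullet> ?P + (mat 1 - ?P) \<bullet> (mat 1 - ?P) + 2 * (?P \<bullet> (mat 1 - ?P))"
    by (simp add: inner_diff_left inner_diff_right inner_commute)
  moreover have "?P \<bullet> (mat 1 - ?P) = 0"
    using inner_matrix_mult_left[of ?P "mat 1" "mat 1 - ?P"]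
    by (simp add: eigproj_props matrix_distribs)
  ultimately show "(norm ?P)^2 \<le> (norm (mat 1 :: real^'n^'n))^2"
    by (simp add: dot_square_norm[symmetric])
qed simp

end

section \<open>Perturbation of eigenvalues and eigenprojectors\<close>

lemma norm_matrix_vector_mult_le: "norm (M *v x) \<le> norm M * norm (x :: real^'n)"
proof (rule power2_le_imp_le)
  have "(norm (M *v x))^2 = (\<Sum>i\<in>UNIV. (M $ i \<bullet> x)^2)"
    by (simp add: norm_vec_def L2_set_def sum_nonneg matrix_vector_mul_component)
  also have "\<dots> \<le> (\<Sum>i\<in>UNIV. (norm (M $ i))^2 * (norm x)^2)"
  proof (rule sum_mono)
    fix i show "(M $ i \<bullet> x)^2 \<le> (norm (M $ i))^2 * (norm x)^2"
      using power_mono[OF Cauchy_Schwarz_ineq2[of "M $ i" x], of 2] by (simp add: power_mult_distrib)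
  qed
  also have "\<dots> = (norm M * norm x)^2"
    by (simp add: norm_vec_def[of M] L2_set_def sum_nonneg power_mult_distrib sum_distrib_right)
  finally show "(norm (M *v x))^2 \<le> (norm M * norm x)^2" .
qed simp

text \<open>If all eigenvalues of B were farther than e from l, then |(B - l) v| > e |v| by
  expansion in an eigenbasis of B; but (B - l) v = (B - A) v.\<close>

lemma eigenvalue_near:
  fixes A B :: "real^'n^'n"
  assumes sym: "transpose B = B" and v: "A *v v = l *\<^sub>R v" "v \<noteq> 0" and e: "norm (B - A) \<le> e"
  shows "\<exists>m\<in>eigenvalues B. \<bar>m - l\<bar> \<le> e"
proof (rule ccontr)
  assume "\<not> ?thesis"
  then have far: "\<bar>m - l\<bar> > e" if "m \<in> eigenvalues B" for m using that by force
  have "e \<ge> 0" using e norm_ge_zero by (rule order_trans[rotated])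
  obtain C where C: "eigenbasis B UNIV C" using eigenbasis_UNIV_ex[OF sym] by blast
  have fin: "finite C" using C by (rule eigenbasis_finite)
  have pyth: "(norm x)^2 = (\<Sum>c\<in>C. (c \<bullet> x)^2)" for x
  proof -
    have "x \<bullet> x = (\<Sum>c\<in>C. (c \<bullet> x) *\<^sub>R c) \<bullet> x" using eigenbasis_expand[OF C, of x] by simp
    also have "\<dots> = (\<Sum>c\<in>C. (c \<bullet> x)^2)" by (simp add: inner_sum_left power2_eq_square)
    finally show ?thesis by (simp add: dot_square_norm)
  qed
  have "e^2 * (c \<bullet> v)^2 \<le> (c \<bullet> (B *v v - l *\<^sub>R v))^2 \<and>
      (c \<bullet> v \<noteq> 0 \<longrightarrow> e^2 * (c \<bullet> v)^2 < (c \<bullet> (B *v v - l *\<^sub>R v))^2)" if c: "c \<in> C" for c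
  proof -
    define m where "m = c \<bullet> (B *v c)"
    have Bc: "B *v c = m *\<^sub>R c" "norm c = 1" using C c by (auto simp: eigenbasis_def m_def)
    then have "m \<in> eigenvalues B"
      by (auto simp: eigenvalues_iff intro!: exI[of _ c])
    from far[OF this] have "e^2 < (m - l)^2" using \<open>e \<ge> 0\<close> by (metis power2_abs power_strict_mono zero_less_numeral)
    moreover have "c \<bullet> (B *v v - l *\<^sub>R v) = (m - l) * (c \<bullet> v)"
    proof -
      have "c \<bullet> (B *v v) = (B *v c) \<bullet> v" by (simp add: inner_matrix_vector_left sym)
      then show ?thesis by (simp add: inner_diff_right Bc algebra_simps)
    qed
    ultimately show ?thesis by (auto simp: power_mult_distrib mult_right_mono mult_strict_right_mono)
  qed
  then have le: "\<And>c. c \<in> C \<Longrightarrow> e^2 * (c \<bullet> v)^2 \<le> (c \<bullet> (B *v v - l *\<^sub>R v))^2"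
    and less: "\<And>c. c \<in> C \<Longrightarrow> c \<bullet> v \<noteq> 0 \<Longrightarrow> e^2 * (c \<bullet> v)^2 < (c \<bullet> (B *v v - l *\<^sub>R v))^2" by auto
  have "\<exists>c\<in>C. c \<bullet> v \<noteq> 0"
  proof (rule ccontr)
    assume "\<not> ?thesis"
    then have "(norm v)^2 = 0" unfolding pyth by (intro sum.neutral) auto
    then show False using v(2) by simp
  qed
  then have "(\<Sum>c\<in>C. e^2 * (c \<bullet> v)^2) < (\<Sum>c\<in>C. (c \<bullet> (B *v v - l *\<^sub>R v))^2)"
    using le less by (intro sum_strict_mono_ex1[OF fin]) auto
  then have "e^2 * (norm v)^2 < (norm (B *v v - l *\<^sub>R v))^2" by (simp add: pyth sum_distrib_left)
  moreover have "norm (B *v v - l *\<^sub>R v) \<le> e * norm v"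
  proof -
    have "B *v v - l *\<^sub>R v = (B - A) *v v" by (simp add: matrix_vector_simps v)
    then have "norm (B *v v - l *\<^sub>R v) \<le> norm (B - A) * norm v" by (simp add: norm_matrix_vector_mult_le)
    also have "\<dots> \<le> e * norm v" using e by (rule mult_right_mono) simp
    finally show ?thesis .
  qed
  then have "(norm (B *v v - l *\<^sub>R v))^2 \<le> e^2 * (norm v)^2"
    using power_mono[of _ _ 2] by (fastforce simp: power_mult_distrib)
  ultimately show False by simp
qed

text \<open>Choose an eigenvalue of B within e of each eigenvalue of A. Gaps above 2 e make the
  choices strictly decreasing, hence distinct, and since B has only r eigenvalues these are all of
  them. Here the constant number of eigenvalues is decisive.\<close>

lemma eigval_near:
  fixes A B :: "real^'n^'n"
  assumes symA: "transpose A = A" and symB: "transpose B = B"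
    and rA: "card (eigenvalues A) = r" and rB: "card (eigenvalues B) = r"
    and gap: "\<And>i j. 1 \<le> i \<Longrightarrow> i < j \<Longrightarrow> j \<le> r \<Longrightarrow> eigval A j + 2 * e < eigval A i"
    and e: "norm (B - A) \<le> e" and i: "i \<in> {1..r}"
  shows "\<bar>eigval B i - eigval A i\<bar> \<le> e"
proof -
  have "\<exists>m\<in>eigenvalues B. \<bar>m - eigval A i\<bar> \<le> e" if "i \<in> {1..r}" for i
  proof -
    have "eigval A i \<in> eigenvalues A" using eigval_image[OF symA] rA that by blast
    then obtain v where "v \<noteq> 0" "A *v v = eigval A i *\<^sub>R v"
      by (auto simp: eigenvalues_iff)
    then show ?thesis using eigenvalue_near[OF symB _ _ e] by blast
  qed
  then obtain f where f: "\<And>i. i \<in> {1..r} \<Longrightarrow> f i \<in> eigenvalues B"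
    "\<And>i. i \<in> {1..r} \<Longrightarrow> \<bar>f i - eigval A i\<bar> \<le> e" by metis
  have dec: "f j < f i" if "1 \<le> i" "i < j" "j \<le> r" for i j
    using gap[OF that] f(2)[of i] f(2)[of j] that by auto
  have "inj_on f {1..r}"
    by (rule inj_onI) (metis atLeastAtMost_iff dec less_irrefl linorder_neqE_nat)
  then have "card (f ` {1..r}) = card (eigenvalues B)" by (simp add: card_image rB)
  then have "f ` {1..r} = eigenvalues B"
    using f(1) finite_symmetric_eigenvalues[OF symB] by (intro card_subset_eq) auto
  from eigval_unique[OF symB this rB dec i] show ?thesis using f(2)[OF i] by simp
qed

section \<open>Curves of symmetric matrices with a constant number of eigenvalues\<close>

locale isospectral_type_curve =
  fixes S :: "real \<Rightarrow> real^'n^'n" and J :: "real set" and r :: nat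
  assumes open_J: "open J" and S_sym: "\<And>x. x \<in> J \<Longrightarrow> transpose (S x) = S x"
    and S_card: "\<And>x. x \<in> J \<Longrightarrow> card (eigenvalues (S x)) = r"
    and S_Ck: "\<And>k. Ck_on k S J"
begin

abbreviation "ev i x \<equiv> eigval (S x) i"
abbreviation "pr i x \<equiv> eigproj (S x) i"

lemma S_matrix: "x \<in> J \<Longrightarrow> symmetric_matrix (S x)"
  by (simp add: symmetric_matrix_def S_sym)

lemma ev_inj: "x \<in> J \<Longrightarrow> i \<in> {1..r} \<Longrightarrow> j \<in> {1..r} \<Longrightarrow> i \<noteq> j \<Longrightarrow> ev i x \<noteq> ev j x"
  using symmetric_matrix.eigval_inj[OF S_matrix] S_card by metis

lemma eventually_J: "x \<in> J \<Longrightarrow> \<forall>\<^sub>F y in at x. y \<in> J"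
  using open_J eventually_at_topological by blast

lemma S_tendsto: "x \<in> J \<Longrightarrow> (S \<longlongrightarrow> S x) (at x)"
  using S_Ck[of 0] open_J by (simp add: continuous_on_eq_continuous_at continuous_at)

lemma ev_tendsto:
  assumes x: "x \<in> J" and i: "i \<in> {1..r}"
  shows "(ev i \<longlongrightarrow> ev i x) (at x)"
proof (rule tendstoI)
  fix d :: real assume "d > 0"
  \<comment> \<open>The target accuracy together with the half gaps at x; e, half the minimum, is
    below all of them.\<close>
  define G where "G = insert d ((\<lambda>(i, j). (ev i x - ev j x) / 2) ` {(i, j) \<in> {1..r} \<times> {1..r}. i < j})"
  have fin: "finite G" unfolding G_def by (intro finite.insertI finite_imageI) (auto intro: finite_subset[of _ "{1..r} \<times> {1..r}"])
  have "g > 0" if "g \<in> G" for g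
    using that \<open>d > 0\<close> eigval_antimono[of _ _ "S x"] S_card[OF x] by (auto simp: G_def)
  then have "Min G > 0" using fin by (simp add: G_def)
  define e where "e = Min G / 2"
  have e: "e > 0" "\<And>g. g \<in> G \<Longrightarrow> e < g"
  proof -
    show "e > 0" using \<open>Min G > 0\<close> by (simp add: e_def)
    fix g assume "g \<in> G"
    then have "Min G \<le> g" using fin by simp
    then show "e < g" using \<open>Min G > 0\<close> by (simp add: e_def)
  qed
  have gap: "ev j x + 2 * e < ev i x" if "1 \<le> i" "i < j" "j \<le> r" for i j
    using e(2)[of "(ev i x - ev j x) / 2"] that by (force simp: G_def)
  have "\<forall>\<^sub>F y in at x. dist (S y) (S x) < e" using tendstoD[OF S_tendsto[OF x] e(1)] .
  then show "\<forall>\<^sub>F y in at x. dist (ev i y) (ev i x) < d"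
    using eventually_J[OF x]
  proof eventually_elim
    fix y assume y: "dist (S y) (S x) < e" "y \<in> J"
    have "\<bar>ev i y - ev i x\<bar> \<le> e"
      by (rule eigval_near[OF S_sym[OF x] S_sym[OF y(2)] S_card[OF x] S_card[OF y(2)] gap _ i])
        (use y in \<open>auto simp: dist_norm\<close>)
    then show "dist (ev i y) (ev i x) < d" using e(2)[of d] by (simp add: dist_real_def G_def)
  qed
qed

text \<open>The source of all perturbation formulas: for j \<noteq> i it is divided by the gap and
  controls the projectors, for j = i it yields the derivative of the eigenvalue.\<close>

lemma pr_product:
  assumes "x \<in> J" "y \<in> J"
  shows "pr j x ** (S y - S x) ** pr i y = (ev i y - ev j x) *\<^sub>R (pr j x ** pr i y)"
proof -
  have "pr j x ** (S y - S x) ** pr i y = pr j x ** (S y ** pr i y) - (pr j x ** S x) ** pr i y"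
    by (simp add: matrix_distribs matrix_mul_assoc)
  then show ?thesis
    using symmetric_matrix.eigproj_left[OF S_matrix[OF assms(2)]]
      symmetric_matrix.eigproj_right[OF S_matrix[OF assms(1)]]
    by (simp add: matrix_distribs scaleR_diff_left)
qed

lemma eventually_ev_neq:
  assumes x: "x \<in> J" and i: "i \<in> {1..r}" and j: "j \<in> {1..r}" and "i \<noteq> j"
  shows "\<forall>\<^sub>F y in at x. ev i y \<noteq> ev j x"
  using tendsto_imp_eventually_ne[OF ev_tendsto[OF x i] ev_inj[OF x i j \<open>i \<noteq> j\<close>]] .

text \<open>Insert the resolution of the identity at x to the left of P_i(y) and that at y to the
  right of P_i(x); the terms with j = i cancel.\<close>

lemma pr_diff:
  assumes "x \<in> J" "y \<in> J" and i: "i \<in> {1..r}"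
  shows "pr i y - pr i x = (\<Sum>j\<in>{1..r} - {i}. pr j x ** pr i y - pr i x ** pr j y)"
proof -
  have s: "(\<Sum>j\<in>{1..r}. pr j z) = mat 1" if "z \<in> J" for z
    using symmetric_matrix.sum_eigproj[OF S_matrix[OF that]] S_card[OF that] by simp
  have "pr i y = (\<Sum>j\<in>{1..r}. pr j x) ** pr i y" "pr i x = pr i x ** (\<Sum>j\<in>{1..r}. pr j y)"
    using s assms by simp_all
  then have "pr i y - pr i x = (\<Sum>j\<in>{1..r}. pr j x ** pr i y - pr i x ** pr j y)"
    by (simp add: matrix_mult.sum_left matrix_mult.sum_right sum_subtractf)
  then show ?thesis by (simp only: sum.remove[OF finite_atLeastAtMost i]) simp
qed

lemma pr_product_quotient:
  assumes "x \<in> J" "i \<in> {1..r}" "j \<in> {1..r}" "i \<noteq> j"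
  shows "\<forall>\<^sub>F y in at x. pr j x ** pr i y = (1 / (ev i y - ev j x)) *\<^sub>R (pr j x ** (S y - S x) ** pr i y)
    \<and> pr i x ** pr j y = (1 / (ev j y - ev i x)) *\<^sub>R (pr i x ** (S y - S x) ** pr j y)"
  using eventually_J[OF assms(1)] eventually_ev_neq[OF assms]
    eventually_ev_neq[OF assms(1,3,2) assms(4)[symmetric]]
  by eventually_elim (simp add: pr_product assms(1))

lemma pr_tendsto:
  assumes x: "x \<in> J" and i: "i \<in> {1..r}"
  shows "(pr i \<longlongrightarrow> pr i x) (at x)"
proof -
  obtain K where K: "K \<ge> 0" "\<And>(a :: real^'n^'n) (b :: real^'n^'n). norm (a ** b) \<le> norm a * norm b * K"
    using matrix_mult.nonneg_bounded by blast
  let ?N = "norm (mat 1 :: real^'n^'n)"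
  let ?B = "\<lambda>y. ?N * norm (S y - S x) * K * ?N * K"
  \<comment> \<open>By \<open>pr_product_quotient\<close> this is a multiple of |S y - S x| over a
    gap whose limit is nonzero; the projectors are bounded uniformly.\<close>
  have cross: "((\<lambda>y. pr a x ** pr b y) \<longlongrightarrow> 0) (at x)"
    if "a \<in> {1..r}" "b \<in> {1..r}" "a \<noteq> b" for a b
  proof (rule Lim_null_comparison)
    have "norm (pr a x ** (S y - S x) ** pr b y) \<le> ?B y" if "y \<in> J" for y
    proof -
      have "norm (pr a x ** (S y - S x) ** pr b y) \<le> norm (pr a x ** (S y - S x)) * norm (pr b y) * K" by (rule K)
      also have "\<dots> \<le> (norm (pr a x) * norm (S y - S x) * K) * norm (pr b y) * K"
        using K by (intro mult_right_mono) auto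
      also have "\<dots> \<le> (?N * norm (S y - S x) * K) * ?N * K"
        using K symmetric_matrix.norm_eigproj_le[OF S_matrix] x \<open>y \<in> J\<close> by (intro mult_right_mono mult_mono) auto
      finally show ?thesis .
    qed note bd = this
    show "\<forall>\<^sub>F y in at x. norm (pr a x ** pr b y) \<le>
        \<bar>1 / (ev b y - ev a x)\<bar> * ?B y"
      using pr_product_quotient[OF x that(2,1) that(3)[symmetric]] eventually_J[OF x]
      by eventually_elim (use that bd in \<open>auto intro!: divide_right_mono\<close>)
    have "((\<lambda>y. S y - S x) \<longlongrightarrow> 0) (at x)" using S_tendsto[OF x] by (simp add: LIM_zero)
    then have "((\<lambda>y. norm (S y - S x)) \<longlongrightarrow> 0) (at x)" by (rule tendsto_norm_zero)
    moreover have "ev b x - ev a x \<noteq> 0" using ev_inj[OF x that(2,1)] that(3) by auto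
    ultimately have "((\<lambda>y. \<bar>1 / (ev b y - ev a x)\<bar> * ?B y) \<longlongrightarrow>
        \<bar>1 / (ev b x - ev a x)\<bar> * (?N * 0 * K * ?N * K)) (at x)"
      by (intro tendsto_intros ev_tendsto x that) auto
    then show "((\<lambda>y. \<bar>1 / (ev b y - ev a x)\<bar> * ?B y) \<longlongrightarrow> 0) (at x)" by simp
  qed
  have "((\<lambda>y. \<Sum>j\<in>{1..r} - {i}. pr j x ** pr i y - pr i x ** pr j y) \<longlongrightarrow> (\<Sum>j\<in>{1..r} - {i}. 0 - 0)) (at x)"
    using i by (intro tendsto_sum tendsto_diff cross) auto
  moreover have "\<forall>\<^sub>F y in at x. (\<Sum>j\<in>{1..r} - {i}. pr j x ** pr i y - pr i x ** pr j y) = pr i y - pr i x"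
    using eventually_J[OF x] by eventually_elim (use pr_diff[OF x _ i] in simp)
  ultimately have "((\<lambda>y. pr i y - pr i x) \<longlongrightarrow> 0) (at x)" by (simp add: tendsto_cong)
  then show ?thesis by (simp add: LIM_zero_iff)
qed

text \<open>Replace the products in \<open>pr_diff\<close> by their quotient forms, divide by y - x
  and pass to the limit.\<close>

lemma pr_has_vector_derivative:
  assumes x: "x \<in> J" and i: "i \<in> {1..r}" and S': "(S has_vector_derivative S') (at x)"
  shows "(pr i has_vector_derivative (\<Sum>j\<in>{1..r} - {i}.
      (1 / (ev i x - ev j x)) *\<^sub>R (pr j x ** S' ** pr i x) - (1 / (ev j x - ev i x)) *\<^sub>R (pr i x ** S' ** pr j x))) (at x)"
  unfolding has_vector_derivative_iff_quotient
proof (rule Lim_transform_eventually)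
  let ?q = "\<lambda>y. (S y - S x) /\<^sub>R (y - x)"
  let ?g = "\<lambda>y j. (1 / (ev i y - ev j x)) *\<^sub>R (pr j x ** ?q y ** pr i y) - (1 / (ev j y - ev i x)) *\<^sub>R (pr i x ** ?q y ** pr j y)"
  have q: "(?q \<longlongrightarrow> S') (at x)" using S' by (simp add: has_vector_derivative_iff_quotient)
  show "((\<lambda>y. \<Sum>j\<in>{1..r} - {i}. ?g y j) \<longlongrightarrow> (\<Sum>j\<in>{1..r} - {i}.
      (1 / (ev i x - ev j x)) *\<^sub>R (pr j x ** S' ** pr i x) - (1 / (ev j x - ev i x)) *\<^sub>R (pr i x ** S' ** pr j x))) (at x)"
    using i ev_inj[OF x]
    by (intro tendsto_intros matrix_mult.tendsto ev_tendsto pr_tendsto q x) auto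
  have "\<forall>\<^sub>F y in at x. \<forall>j\<in>{1..r} - {i}. pr j x ** pr i y = (1 / (ev i y - ev j x)) *\<^sub>R (pr j x ** (S y - S x) ** pr i y)
    \<and> pr i x ** pr j y = (1 / (ev j y - ev i x)) *\<^sub>R (pr i x ** (S y - S x) ** pr j y)"
    using pr_product_quotient[OF x i] by (intro eventually_ball_finite) auto
  then show "\<forall>\<^sub>F y in at x. (\<Sum>j\<in>{1..r} - {i}. ?g y j) = (pr i y - pr i x) /\<^sub>R (y - x)"
    using eventually_J[OF x]
  proof eventually_elim
    case (elim y)
    have "(pr i y - pr i x) /\<^sub>R (y - x) =
        (\<Sum>j\<in>{1..r} - {i}. inverse (y - x) *\<^sub>R (pr j x ** pr i y) - inverse (y - x) *\<^sub>R (pr i x ** pr j y))"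
      by (simp only: pr_diff[OF x elim(2) i] scaleR_sum_right scaleR_diff_right)
    also have "\<dots> = (\<Sum>j\<in>{1..r} - {i}. ?g y j)"
    proof (rule sum.cong[OF refl])
      fix j assume "j \<in> {1..r} - {i}"
      with elim(1) have e: "pr j x ** pr i y = (1 / (ev i y - ev j x)) *\<^sub>R (pr j x ** (S y - S x) ** pr i y)"
        "pr i x ** pr j y = (1 / (ev j y - ev i x)) *\<^sub>R (pr i x ** (S y - S x) ** pr j y)" by blast+
      show "inverse (y - x) *\<^sub>R (pr j x ** pr i y) - inverse (y - x) *\<^sub>R (pr i x ** pr j y) =
        ?g y j"
        unfolding e matrix_mult.scaleR_left matrix_mult.scaleR_right scaleR_scaleR
        by (simp only: mult.commute)
    qed
    finally show ?case by simp
  qed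
qed

text \<open>Take \<open>pr_product\<close> with j = i and pair it with P_i(x): the eigenvalue
  increment is a quotient whose denominator tends to |P_i(x)|^2, which is not 0.\<close>

lemma ev_has_vector_derivative:
  assumes x: "x \<in> J" and i: "i \<in> {1..r}" and S': "(S has_vector_derivative S') (at x)"
  shows "(ev i has_vector_derivative ((pr i x ** S' ** pr i x) \<bullet> pr i x) / (pr i x \<bullet> pr i x)) (at x)"
  unfolding has_vector_derivative_iff_quotient
proof (rule Lim_transform_eventually)
  let ?q = "\<lambda>y. (S y - S x) /\<^sub>R (y - x)"
  have q: "(?q \<longlongrightarrow> S') (at x)" using S' by (simp add: has_vector_derivative_iff_quotient)
  have idem: "pr i x ** pr i x = pr i x" using symmetric_matrix.eigproj_props(2)[OF S_matrix[OF x]] .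
  have nz: "pr i x \<bullet> pr i x \<noteq> 0"
    using symmetric_matrix.eigproj_nonzero[OF S_matrix[OF x]] i S_card[OF x] by simp
  have t: "((\<lambda>y. (pr i x ** pr i y) \<bullet> pr i x) \<longlongrightarrow> pr i x \<bullet> pr i x) (at x)"
    using tendsto_inner[OF matrix_mult.tendsto[OF tendsto_const pr_tendsto[OF x i]] tendsto_const, of "pr i x" "pr i x"]
    by (simp add: idem)
  show "((\<lambda>y. ((pr i x ** ?q y ** pr i y) \<bullet> pr i x) / ((pr i x ** pr i y) \<bullet> pr i x)) \<longlongrightarrow>
     ((pr i x ** S' ** pr i x) \<bullet> pr i x) / (pr i x \<bullet> pr i x)) (at x)"
    by (intro tendsto_divide tendsto_inner tendsto_const matrix_mult.tendsto q t pr_tendsto x i nz)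
  show "\<forall>\<^sub>F y in at x. ((pr i x ** ?q y ** pr i y) \<bullet> pr i x) / ((pr i x ** pr i y) \<bullet> pr i x) =
      (ev i y - ev i x) /\<^sub>R (y - x)"
    using eventually_J[OF x] tendsto_imp_eventually_ne[OF t nz]
  proof eventually_elim
    case (elim y)
    have "pr i x ** ?q y ** pr i y = (inverse (y - x) * (ev i y - ev i x)) *\<^sub>R (pr i x ** pr i y)"
      by (simp only: matrix_mult.scaleR_left matrix_mult.scaleR_right pr_product[OF x elim(1)] scaleR_scaleR)
    then show ?case using elim(2) by simp
  qed
qed

text \<open>The induction is joint: the derivative of each eigenvalue contains projectors, and that
  of each projector contains eigenvalue gaps.\<close>

lemma ev_pr_Ck:
  "\<forall>i\<in>{1..r}. Ck_on k (ev i) J \<and> Ck_on k (pr i) J"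
proof (induction k)
  case 0
  then show ?case
    using ev_tendsto pr_tendsto open_J by (simp add: continuous_on_eq_continuous_at continuous_at)
next
  case (Suc k)
  obtain S' where S': "\<And>x. x \<in> J \<Longrightarrow> (S has_vector_derivative S' x) (at x)" "Ck_on k S' J"
    using S_Ck[of "Suc k"] by auto
  show ?case
  proof (intro ballI conjI)
    fix i assume i: "i \<in> {1..r}"
    have nz: "pr i x \<bullet> pr i x \<noteq> 0" if "x \<in> J" for x
      using symmetric_matrix.eigproj_nonzero[OF S_matrix[OF that]] i S_card[OF that] by simp
    note Ck_mult = Ck_on_bilinear[OF bounded_bilinear_matrix_mult]
      and Ck_inner = Ck_on_bilinear[OF bounded_bilinear_inner]
    show "Ck_on (Suc k) (ev i) J"
      using Suc i nz open_J
      by (intro Ck_on_SucI[OF ev_has_vector_derivative[OF _ i S'(1)]] Ck_on_divide Ck_inner Ck_mult S') auto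
    show "Ck_on (Suc k) (pr i) J"
      using Suc i ev_inj open_J
      by (intro Ck_on_SucI[OF pr_has_vector_derivative[OF _ i S'(1)]] Ck_on_sum Ck_on_diff Ck_on_scaleR
          Ck_on_divide Ck_on_const Ck_mult S') auto
  qed
qed

text \<open>The squared Frobenius norm of an eigenprojector is its rank, so it is both continuous
  and integer-valued on a connected set.\<close>

lemma flag_type_constant:
  assumes "connected J" "x \<in> J" "y \<in> J" "i \<in> {1..r}"
  shows "flag_type (S x) i = flag_type (S y) i"
proof -
  have eq: "pr i x \<bullet> pr i x = real (flag_type (S x) i)" if "x \<in> J" for x
    using symmetric_matrix.eigproj_props(4)[OF S_matrix[OF that]] .
  have "continuous_on J (\<lambda>x. pr i x \<bullet> pr i x)"
    using ev_pr_Ck[of 0] assms(4) by (intro continuous_on_inner) auto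
  then have "(\<lambda>x. pr i x \<bullet> pr i x) constant_on J"
  proof (rule continuous_discrete_range_constant[OF assms(1)])
    fix x assume "x \<in> J"
    then show "\<exists>e>0. \<forall>y. y \<in> J \<and> pr i y \<bullet> pr i y \<noteq> pr i x \<bullet> pr i x \<longrightarrow> e \<le> norm (pr i y \<bullet> pr i y - pr i x \<bullet> pr i x)"
      by (intro exI[of _ 1]) (auto simp: eq)
  qed
  then obtain c where "\<And>z. z \<in> J \<Longrightarrow> pr i z \<bullet> pr i z = c" unfolding constant_on_def by blast
  then show ?thesis using eq assms by (metis of_nat_eq_iff)
qed

end

section \<open>Smoothness of the direct rotation\<close>

lemma inner_matrix_columns: "X \<bullet> Y = (\<Sum>j\<in>UNIV. column j X \<bullet> column j (Y :: real^'m^'n))"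
  unfolding inner_vec_def column_def by (subst sum.swap) simp

lemma inner_transpose: "transpose X \<bullet> transpose Y = X \<bullet> (Y :: real^'m^'n)"
  unfolding inner_vec_def transpose_def by (subst sum.swap) simp

lemma inner_mult_left_ge:
  fixes X :: "real^'m^'n"
  assumes "\<And>v. m * (v \<bullet> v) \<le> v \<bullet> (F *v v)"
  shows "m * (X \<bullet> X) \<le> X \<bullet> (F ** X)"
proof -
  have "column j (F ** X) = F *v column j X" for j
    by (simp add: column_def matrix_matrix_mult_def matrix_vector_mult_def vec_eq_iff)
  then show ?thesis
    unfolding inner_matrix_columns sum_distrib_left using assms by (intro sum_mono) simp
qed

lemma inner_mult_right_ge:
  fixes X :: "real^'n^'m"
  assumes "\<And>v. m * (v \<bullet> v) \<le> v \<bullet> (F *v v)" "transpose F = F"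
  shows "m * (X \<bullet> X) \<le> X \<bullet> (X ** F)"
  using inner_mult_left_ge[OF assms(1), of "transpose X"] assms(2)
    inner_transpose[of X X] inner_transpose[of X "X ** F"]
  by (simp add: matrix_transpose_mul)

text \<open>The two coefficients are packed into one argument, so that the map is bilinear and the
  results on linear equations apply.\<close>

definition sylvester :: "(real^'n^'n) \<times> (real^'n^'n) \<Rightarrow> real^'n^'n \<Rightarrow> real^'n^'n" where
  "sylvester p X = fst p ** X + X ** snd p"

lemma bounded_bilinear_sylvester: "bounded_bilinear sylvester"
  unfolding bilinear_conv_bounded_bilinear[symmetric] bilinear_def
  by (auto intro!: linearI simp: sylvester_def matrix_distribs scaleR_add_right)

lemma norm_mult_le_if_inner_ge: "m * (v \<bullet> v) \<le> v \<bullet> w \<Longrightarrow> m * norm v \<le> norm w"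
proof (cases "v = 0")
  case False
  assume "m * (v \<bullet> v) \<le> v \<bullet> w"
  then have "norm v * (m * norm v) \<le> norm v * norm w"
    using norm_cauchy_schwarz[of v w] by (simp add: dot_square_norm power2_eq_square mult_ac)
  then show ?thesis using False by simp
qed simp

locale projector_curve =
  fixes P :: "real^'n^'n" and R :: "real \<Rightarrow> real^'n^'n" and J :: "real set"
  assumes open_J: "open J" and pair: "\<And>x. x \<in> J \<Longrightarrow> projector_pair P (R x)"
    and R_Ck: "\<And>k. Ck_on k R J"
begin

definition "gap x = proj_gap P (R x)"
definition "cosine x = matfun (\<lambda>l. sqrt (1 - l)) (gap x)"
definition "secant x = matfun (\<lambda>l. 1 / sqrt (1 - l)) (gap x)"

lemma gap_sym: "x \<in> J \<Longrightarrow> transpose (gap x) = gap x"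
  using projector_pair.E_sym[OF pair] by (simp add: gap_def)

lemma gap_range: "x \<in> J \<Longrightarrow> gap x *v v = l *\<^sub>R v \<Longrightarrow> v \<noteq> 0 \<Longrightarrow> 0 \<le> l \<and> l < 1"
  using projector_pair.eigenvalue_range[OF pair] by (simp add: gap_def)

lemma cosine_sym: "transpose (cosine x) = cosine x"
  by (simp add: cosine_def transpose_matfun)

lemma cosine_square: "x \<in> J \<Longrightarrow> cosine x ** cosine x = mat 1 - gap x"
proof (rule matrix_eqI_eigvec[OF gap_sym])
  fix l v assume x: "x \<in> J" and v: "gap x *v v = l *\<^sub>R v"
  show "(cosine x ** cosine x) *v v = (mat 1 - gap x) *v v"
  proof (cases "v = 0")
    case False
    then have "l < 1" using gap_range[OF x v] by simp
    then show ?thesis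
      by (simp add: cosine_def matrix_vector_simps matfun_eigvec[OF gap_sym[OF x] v] v scaleR_diff_left)
  qed simp
qed

lemma cosine_secant: "x \<in> J \<Longrightarrow> cosine x ** secant x = mat 1"
proof (rule matrix_eqI_eigvec[OF gap_sym])
  fix l v assume x: "x \<in> J" and v: "gap x *v v = l *\<^sub>R v"
  show "(cosine x ** secant x) *v v = mat 1 *v v"
  proof (cases "v = 0")
    case False
    then have "sqrt (1 - l) \<noteq> 0" using gap_range[OF x v] by simp
    then show ?thesis
      by (simp add: cosine_def secant_def matrix_vector_simps matfun_eigvec[OF gap_sym[OF x] v])
  qed simp
qed

lemma cosine_coercive: "x \<in> J \<Longrightarrow> \<exists>m>0. \<forall>v. m * (v \<bullet> v) \<le> v \<bullet> (cosine x *v v)"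
proof -
  assume x: "x \<in> J"
  define M where "M = insert 1 ((\<lambda>l. sqrt (1 - l)) ` eigenvalues (gap x))"
  have fin: "finite M" using finite_symmetric_eigenvalues[OF gap_sym[OF x]] by (simp add: M_def)
  have "0 < m" if "m \<in> M" for m
    using that gap_range[OF x] by (auto simp: M_def eigenvalues_iff)
  then have "0 < Min M" using fin by (simp add: M_def)
  moreover have "Min M * (v \<bullet> v) \<le> v \<bullet> (cosine x *v v)" for v
    unfolding cosine_def
  proof (rule matfun_inner_ge[OF gap_sym[OF x]])
    fix l w assume "w \<noteq> 0" "gap x *v w = l *\<^sub>R w"
    then have "l \<in> eigenvalues (gap x)"
      by (auto simp: eigenvalues_iff)
    then show "Min M \<le> sqrt (1 - l)" using fin by (intro Min_le) (auto simp: M_def)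
  qed
  ultimately show ?thesis by blast
qed

lemma sylvester_cosine_coercive: "x \<in> J \<Longrightarrow> \<exists>m>0. \<forall>X. m * norm X \<le> norm (sylvester (cosine x, cosine x) X)"
proof -
  assume "x \<in> J"
  from cosine_coercive[OF this] obtain m where m: "m > 0" "\<And>v. m * (v \<bullet> v) \<le> v \<bullet> (cosine x *v v)" by blast
  have "(2 * m) * (X \<bullet> X) \<le> X \<bullet> sylvester (cosine x, cosine x) X" for X
    using inner_mult_left_ge[OF m(2), of X] inner_mult_right_ge[OF m(2) cosine_sym, of X]
    by (simp add: sylvester_def inner_add_right)
  then have "(2 * m) * norm X \<le> norm (sylvester (cosine x, cosine x) X)" for X
    by (rule norm_mult_le_if_inner_ge)
  then show ?thesis using m(1) by (intro exI[of _ "2 * m"]) auto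
qed

lemma gap_Ck: "Ck_on k gap J"
  unfolding gap_def proj_gap_def
  by (intro Ck_on_bilinear[OF bounded_bilinear_matrix_mult] Ck_on_diff Ck_on_const R_Ck)

text \<open>C_y^2 - C_x^2 = C_y (C_y - C_x) + (C_y - C_x) C_x: the increment of the square root
  solves an exact linear equation, although the matrices need not commute.\<close>

lemma cosine_difference:
  assumes "x \<in> J" "y \<in> J"
  shows "sylvester (cosine y, cosine x) (cosine y - cosine x) = gap x - gap y"
  using cosine_square[OF assms(1)] cosine_square[OF assms(2)]
  by (simp add: sylvester_def matrix_distribs)

lemma cosine_isCont:
  assumes x: "x \<in> J"
  shows "isCont cosine x"
proof -
  obtain m where m: "m > 0" "\<And>v. m * (v \<bullet> v) \<le> v \<bullet> (cosine x *v v)" using cosine_coercive[OF x] by blast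
  have "\<forall>\<^sub>F y in at x. y \<in> J" using open_J x eventually_at_topological by blast
  then have "\<forall>\<^sub>F y in at x. norm (cosine y - cosine x) \<le> norm (gap x - gap y) / m"
  proof eventually_elim
    fix y assume y: "y \<in> J"
    let ?X = "cosine y - cosine x"
    obtain n where "n > 0" "\<And>v. n * (v \<bullet> v) \<le> v \<bullet> (cosine y *v v)" using cosine_coercive[OF y] by blast
    \<comment> \<open>Only the lower bound at x is used quantitatively; at y nonnegativity suffices,
      so the constant does not depend on y.\<close>
    then have "0 * (v \<bullet> v) \<le> v \<bullet> (cosine y *v v)" for v
      by (metis inner_ge_zero less_imp_le mult_nonneg_nonneg mult_zero_left order_trans)
    from inner_mult_left_ge[OF this, of ?X] inner_mult_right_ge[OF m(2) cosine_sym, of ?X]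
    have "m * (?X \<bullet> ?X) \<le> ?X \<bullet> sylvester (cosine y, cosine x) ?X"
      unfolding sylvester_def by (simp add: inner_add_right)
    then have "m * norm ?X \<le> norm (gap x - gap y)"
      unfolding cosine_difference[OF x y] by (rule norm_mult_le_if_inner_ge)
    then show "norm ?X \<le> norm (gap x - gap y) / m" using m(1) by (simp add: field_simps)
  qed
  moreover have "((\<lambda>y. norm (gap x - gap y) / m) \<longlongrightarrow> norm (gap x - gap x) / m) (at x)"
    using gap_Ck[of 0] open_J x m(1)
    by (intro tendsto_intros) (auto simp: continuous_on_eq_continuous_at continuous_at)
  then have "((\<lambda>y. norm (gap x - gap y) / m) \<longlongrightarrow> 0) (at x)" by simp
  ultimately have "((\<lambda>y. cosine y - cosine x) \<longlongrightarrow> 0) (at x)" by (rule Lim_null_comparison)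
  then show ?thesis by (simp add: continuous_at LIM_zero_iff)
qed

text \<open>The difference quotients solve Sylvester equations whose coefficients and right-hand sides
  converge.\<close>

lemma cosine_has_vector_derivative:
  assumes x: "x \<in> J" and d: "(gap has_vector_derivative d) (at x)"
    and Z: "sylvester (cosine x, cosine x) Z = - d"
  shows "(cosine has_vector_derivative Z) (at x)"
proof -
  \<comment> \<open>The quotients are completed at x by their expected limits; differentiability
    becomes continuity of q at x.\<close>
  define q where "q y = (if y = x then Z else (cosine y - cosine x) /\<^sub>R (y - x))" for y
  define b where "b y = (if y = x then - d else - ((gap y - gap x) /\<^sub>R (y - x)))" for y
  have ev: "\<forall>\<^sub>F y in at x. y \<in> J \<and> y \<noteq> x"
    using open_J x eventually_at_topological by blast
  have "((\<lambda>y. - ((gap y - gap x) /\<^sub>R (y - x))) \<longlongrightarrow> - d) (at x)"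
    using d by (intro tendsto_minus) (simp add: has_vector_derivative_iff_quotient)
  then have "(b \<longlongrightarrow> - d) (at x)"
    by (rule Lim_transform_eventually) (rule eventually_mono[OF ev], simp add: b_def)
  moreover have bx: "b x = - d" by (simp add: b_def)
  moreover have "\<forall>\<^sub>F y in at x. sylvester (cosine y, cosine x) (q y) = b y"
    using ev
  proof eventually_elim
    case (elim y)
    then show ?case
      using cosine_difference[OF x, of y]
      by (simp add: q_def b_def bounded_bilinear.scaleR_right[OF bounded_bilinear_sylvester]
          flip: scaleR_minus_right)
  qed
  moreover obtain m where "m > 0" "\<And>X. m * norm X \<le> norm (sylvester (cosine x, cosine x) X)"
    using sylvester_cosine_coercive[OF x] by blast
  ultimately have "continuous (at x) q"
    using cosine_isCont[OF x] Z
    by (intro linear_equation_solution_continuous[OF bounded_bilinear_sylvester, of x "\<lambda>y. (cosine y, cosine x)" b q m])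
      (auto simp: continuous_at q_def bx intro!: tendsto_intros)
  then have "(q \<longlongrightarrow> Z) (at x)" by (simp add: continuous_at q_def)
  then have "((\<lambda>y. (cosine y - cosine x) /\<^sub>R (y - x)) \<longlongrightarrow> Z) (at x)"
    by (rule Lim_transform_eventually) (rule eventually_mono[OF ev], simp add: q_def)
  then show ?thesis by (simp add: has_vector_derivative_iff_quotient)
qed

text \<open>The coefficients of the equation for the derivative Z are the square root itself: if
  that is C^k then so is Z, which lifts the square root to C^(k+1).\<close>

lemma cosine_Ck: "Ck_on k cosine J"
proof (induction k)
  case 0
  then show ?case using cosine_isCont by (auto intro: continuous_at_imp_continuous_on)
next
  case (Suc k)
  obtain d where d: "\<And>x. x \<in> J \<Longrightarrow> (gap has_vector_derivative d x) (at x)" "Ck_on k d J"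
    using gap_Ck[of "Suc k"] by auto
  define Z where "Z x = (SOME Z. sylvester (cosine x, cosine x) Z = - d x)" for x
  have Z: "sylvester (cosine x, cosine x) (Z x) = - d x" if "x \<in> J" for x
  proof -
    have "linear (sylvester (cosine x, cosine x))"
      by (intro bounded_linear.linear bounded_bilinear.bounded_linear_right bounded_bilinear_sylvester)
    then have "\<exists>Z. sylvester (cosine x, cosine x) Z = - d x"
      using sylvester_cosine_coercive[OF that] coercive_linear_surj by blast
    then show ?thesis unfolding Z_def by (rule someI_ex)
  qed
  have "Ck_on k (\<lambda>x. (cosine x, 0) + (0, cosine x)) J"
    by (intro Ck_on_add Ck_on_linear[OF _ Suc, of "\<lambda>a. (a, 0)"] Ck_on_linear[OF _ Suc, of "Pair 0"]
        bounded_linear_Pair bounded_linear_ident bounded_linear_zero)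
  then have "Ck_on k (\<lambda>x. (cosine x, cosine x)) J" by simp
  moreover have "Ck_on k (\<lambda>x. - d x) J"
    by (intro Ck_on_linear[OF bounded_linear_minus[OF bounded_linear_ident]] d)
  ultimately have "Ck_on k Z J"
    using Ck_on_linear_equation_solution[OF bounded_bilinear_sylvester open_J,
        where F = "\<lambda>x. (cosine x, cosine x)" and z = Z and b = "\<lambda>x. - d x"]
      Z sylvester_cosine_coercive by blast
  then show ?case using d Z by (intro Ck_on_SucI[OF cosine_has_vector_derivative]) auto
qed

lemma secant_Ck: "Ck_on k secant J"
proof (rule Ck_on_linear_equation_solution[OF bounded_bilinear_matrix_mult open_J cosine_secant _ cosine_Ck Ck_on_const])
  fix x assume "x \<in> J"
  from cosine_coercive[OF this] obtain m where m: "m > 0" "\<And>v. m * (v \<bullet> v) \<le> v \<bullet> (cosine x *v v)" by blast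
  then show "\<exists>m>0. \<forall>X. m * norm X \<le> norm (cosine x ** X)"
    using inner_mult_left_ge norm_mult_le_if_inner_ge by (intro exI[of _ m]) blast
qed

lemma holonomy_Ck:
  fixes U :: "real^'m^'n"
  assumes "U \<in> stiefel I" "U ** transpose U = P"
  shows "Ck_on k (\<lambda>x. holonomy I P (R x) U) J"
proof (rule Ck_on_cong[OF open_J])
  show "Ck_on k (\<lambda>x. R x ** secant x ** U) J"
    by (intro Ck_on_bilinear[OF bounded_bilinear_matrix_mult] R_Ck secant_Ck Ck_on_const)
  show "R x ** secant x ** U = holonomy I P (R x) U" if "x \<in> J" for x
    using projector_pair.holonomy_stiefel(3)[OF pair[OF that] assms] by (simp add: secant_def gap_def)
qed

end

section \<open>Frames and the cut locus\<close>

lemma column_mult: "column j (A ** B) = A *v column j B"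
  by (simp add: column_def matrix_matrix_mult_def matrix_vector_mult_def vec_eq_iff)

lemma column_restrict_cols: "column j (restrict_cols I Q) = (if j \<in> I then column j Q else 0)"
  by (simp add: column_def restrict_cols_def vec_eq_iff)

lemma id_on_component: "id_on I $ j $ k = (if j = k \<and> k \<in> I then 1 else 0)"
  by (simp add: id_on_def restrict_cols_def mat_def)

lemma transpose_id_on: "transpose (id_on I) = id_on I"
  by (auto simp: vec_eq_iff transpose_def id_on_component)

lemma stiefel_iff:
  "U \<in> stiefel I \<longleftrightarrow> restrict_cols I U = U \<and>
    (\<forall>j\<in>I. \<forall>k\<in>I. column j U \<bullet> column k U = (if j = k then 1 else 0))"
proof -
  have gram: "(transpose U ** U) $ j $ k = column j U \<bullet> column k U" for j k
    by (simp add: matrix_matrix_mult_def transpose_def column_def inner_vec_def)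
  have "column j U = 0" if "restrict_cols I U = U" "j \<notin> I" for j
    using column_restrict_cols[of j I U] that by simp
  then show ?thesis
    by (auto simp: stiefel_def vec_eq_iff[of "transpose U ** U"] vec_eq_iff[of "(transpose U ** U) $ _"]
        gram id_on_component split: if_splits) (metis inner_zero_left inner_zero_right)+
qed

lemma orthonormal_basis_stiefel:
  assumes "orthonormal_basis I (\<lambda>j. column j Q) V"
  shows "restrict_cols I Q \<in> stiefel I"
  unfolding stiefel_iff using assms
  by (auto simp: orthonormal_basis_def column_restrict_cols) (simp add: restrict_cols_def vec_eq_iff)

lemma stiefel_projector:
  assumes "U \<in> stiefel I"
  shows "transpose (U ** transpose U) = U ** transpose U"
    "(U ** transpose U) ** (U ** transpose U) = U ** transpose U"
    "orthonormal_basis I (\<lambda>j. column j U) (range ((*v) (U ** transpose U)))"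
proof -
  note UU = stiefel_mult(3)[OF assms]
  show "transpose (U ** transpose U) = U ** transpose U" by (simp add: matrix_transpose_mul)
  show "(U ** transpose U) ** (U ** transpose U) = U ** transpose U" by (simp add: UU matrix_mul_assoc)
  have "span ((\<lambda>j. column j U) ` I) = range ((*v) (U ** transpose U))"
  proof
    have "column j U = (U ** transpose U) *v column j U" for j
      using column_mult[of j "U ** transpose U" U] by (simp add: UU)
    then show "span ((\<lambda>j. column j U) ` I) \<subseteq> range ((*v) (U ** transpose U))"
      by (intro span_minimal subspace_range_matrix) blast
    show "range ((*v) (U ** transpose U)) \<subseteq> span ((\<lambda>j. column j U) ` I)"
    proof
      fix y assume "y \<in> range ((*v) (U ** transpose U))"
      then obtain x where "y = U *v x" by (auto simp: matrix_vector_mul_assoc[symmetric])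
      then have "y = (\<Sum>j\<in>UNIV. x $ j *\<^sub>R column j U)"
        by (simp add: matrix_mult_sum scalar_mult_eq_scaleR)
      moreover have "x $ j *\<^sub>R column j U \<in> span ((\<lambda>j. column j U) ` I)" for j
      proof (cases "j \<in> I")
        case False
        then have "column j U = 0"
          using assms column_restrict_cols[of j I U] by (simp add: stiefel_def)
        then show ?thesis by (simp add: span_zero)
      qed (auto intro: span_scale span_base)
      ultimately show "y \<in> span ((\<lambda>j. column j U) ` I)" by (simp add: span_sum)
    qed
  qed
  then show "orthonormal_basis I (\<lambda>j. column j U) (range ((*v) (U ** transpose U)))"
    using assms by (simp add: orthonormal_basis_def stiefel_iff)
qed

lemma orthonormal_basis_card:
  fixes b :: "'m::finite \<Rightarrow> real^'n"
  assumes "orthonormal_basis I b V"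
  shows "card I = dim V"
proof -
  have o: "b j \<bullet> b k = (if j = k then 1 else 0)" if "j \<in> I" "k \<in> I" for j k
    using assms that by (auto simp: orthonormal_basis_def)
  have inj: "inj_on b I" using o by (intro inj_onI) (metis zero_neq_one)
  have "pairwise orthogonal (b ` I)" by (auto simp: pairwise_def orthogonal_def o)
  moreover have "0 \<notin> b ` I" using o by (metis imageE inner_zero_left zero_neq_one)
  ultimately have "independent (b ` I)" by (rule pairwise_orthogonal_independent)
  then have "card (b ` I) = dim (span (b ` I))" by (simp add: dim_eq_card_independent)
  moreover have "span (b ` I) = V" using assms by (simp add: orthonormal_basis_def)
  ultimately show ?thesis using card_image[OF inj] by metis
qed

lemma stiefel_frame_exists:
  fixes R :: "real^'n^'n" and I :: "'m::finite set"
  assumes R: "transpose R = R" "R ** R = R" and "rank R = card I"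
  shows "\<exists>Y :: real^'m^'n. Y \<in> stiefel I \<and> Y ** transpose Y = R"
proof -
  have "subspace (range ((*v) R))" by (rule subspace_range_matrix)
  then obtain B where B: "pairwise orthogonal B" "\<And>x. x \<in> B \<Longrightarrow> norm x = 1" "independent B"
    "card B = dim (range ((*v) R))" "span B = range ((*v) R)"
    using orthonormal_basis_subspace by metis
  have "finite B" using B(3) by (rule finiteI_independent)
  moreover have "card I = card B" using assms(3) B(4) by (simp add: rank_dim_range)
  ultimately obtain g where g: "bij_betw g I B" using finite_same_card_bij[of I B] by auto
  define Q :: "real^'m^'n" where "Q = (\<chi> k j. g j $ k)"
  have Q: "column j Q = g j" for j by (simp add: Q_def column_def vec_eq_iff)
  have basis: "orthonormal_basis I (\<lambda>j. column j Q) (range ((*v) R))"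
    unfolding orthonormal_basis_def
  proof (intro conjI ballI)
    fix j k assume jk: "j \<in> I" "k \<in> I"
    then have "g j \<in> B" "g k \<in> B" "g j = g k \<longleftrightarrow> j = k"
      using g by (auto simp: bij_betw_def inj_on_def)
    then show "column j Q \<bullet> column k Q = (if j = k then 1 else 0)"
      using B(1,2) by (auto simp: Q pairwise_def orthogonal_def dot_square_norm)
  next
    show "span ((\<lambda>j. column j Q) ` I) = range ((*v) R)"
      using g B(5) by (simp add: Q bij_betw_def)
  qed
  define Y where "Y = restrict_cols I Q"
  have Y: "Y \<in> stiefel I" unfolding Y_def using basis by (rule orthonormal_basis_stiefel)
  have "range ((*v) (Y ** transpose Y)) = span ((\<lambda>j. column j Y) ` I)"
    using stiefel_projector(3)[OF Y] by (simp add: orthonormal_basis_def)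
  also have "(\<lambda>j. column j Y) ` I = (\<lambda>j. column j Q) ` I"
    by (intro image_cong) (auto simp: Y_def column_restrict_cols)
  also have "span \<dots> = range ((*v) R)" using basis by (simp add: orthonormal_basis_def)
  finally have "Y ** transpose Y = R"
    by (rule orthogonal_projector_unique[OF stiefel_projector(1,2)[OF Y] R])
  with Y show ?thesis by blast
qed

text \<open>The range of M is the image of the coordinate space of I, of dimension at most
  \<open>card I\<close>; a nonzero kernel vector z in it allows restriction to the complement of
  z.\<close>

lemma rank_less_if_kernel:
  fixes M :: "real^'m^'m" and I :: "'m set"
  assumes M: "M ** id_on I = M" and z: "id_on I *v z = z" "z \<noteq> 0" "M *v z = 0"
  shows "rank M < card I"
proof -
  define V where "V = range ((*v) (id_on I :: real^'m^'m))"
  define W where "W = V \<inter> {y. orthogonal z y}"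
  have V: "subspace V" unfolding V_def by (rule subspace_range_matrix)
  have W: "subspace W"
    unfolding W_def using V by (intro subspace_inter subspace_orthogonal_to_vector)
  have "z \<in> V" unfolding V_def using z(1) by (metis rangeI)
  moreover have "z \<notin> W" using z(2) by (simp add: W_def orthogonal_def)
  ultimately have "W \<subset> V" by (auto simp: W_def)
  then have "dim W < dim V" using V W by (metis dim_psubset span_eq_iff)
  moreover have "dim V \<le> card I"
  proof -
    have "V \<subseteq> span ((\<lambda>j. axis j 1) ` I)"
    proof
      fix y assume "y \<in> V"
      then obtain x where x: "y = id_on I *v x" by (auto simp: V_def)
      have "y $ k = (if k \<in> I then x $ k else 0)" for k
      proof -
        have "y $ k = (\<Sum>j\<in>UNIV. id_on I $ k $ j * x $ j)"
          by (simp add: x matrix_vector_mult_def)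
        also have "\<dots> = (\<Sum>j\<in>UNIV. if j = k then (if k \<in> I then x $ j else 0) else 0)"
          by (rule sum.cong) (auto simp: id_on_component)
        finally show ?thesis by simp
      qed
      then have "y = (\<Sum>j\<in>I. x $ j *\<^sub>R axis j 1)"
        by (simp add: vec_eq_iff axis_def if_distrib cong: if_cong)
      also have "\<dots> \<in> span ((\<lambda>j. axis j 1) ` I)" by (intro span_sum span_scale span_base) auto
      finally show "y \<in> span ((\<lambda>j. axis j 1) ` I)" .
    qed
    then have "dim V \<le> card ((\<lambda>j. axis j (1::real)) ` I :: (real^'m) set)" by (intro dim_le_card) auto
    also have "\<dots> \<le> card I" by (rule card_image_le) simp
    finally show ?thesis .
  qed
  moreover have "rank M \<le> dim W"
  proof -
    have "range ((*v) M) \<subseteq> (*v) M ` W"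
    proof
      fix y assume "y \<in> range ((*v) M)"
      then obtain x where x: "y = M *v x" by blast
      define w where "w = id_on I *v x"
      define u where "u = w - ((z \<bullet> w) / (z \<bullet> z)) *\<^sub>R z"
      have "w \<in> V" by (simp add: V_def w_def)
      then have "u \<in> W" using V \<open>z \<in> V\<close> z(2)
        by (auto simp: u_def W_def orthogonal_def inner_diff_right intro!: subspace_diff subspace_scale)
      moreover have "M *v u = y"
        by (simp add: u_def matrix_vector_simps z(3)) (simp add: w_def x matrix_vector_mul_assoc M)
      ultimately show "y \<in> (*v) M ` W" by blast
    qed
    then have "dim (range ((*v) M)) \<le> dim ((*v) M ` W)" by (rule dim_subset)
    also have "\<dots> \<le> dim W" by (rule dim_image_le[OF matrix_vector_mul_linear])
    finally show ?thesis by (simp add: rank_dim_range)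
  qed
  ultimately show ?thesis by simp
qed

text \<open>From E v = v one gets P R P v = 0 and R P R v = 0, hence R P v = 0 and P R v = 0. A
  nonzero P v or R v would lie in one range orthogonally to the other and make the product of the
  two frames lose rank. So both vanish, and v = E v = 0.\<close>

lemma no_right_angle_if_not_cut:
  fixes P R :: "real^'n^'n" and U :: "real^'n^'n"
  assumes U: "U \<in> stiefel I" "U ** transpose U = P"
    and R: "transpose R = R" "R ** R = R" "rank R = card I"
    and cut: "R \<notin> cut_locus I P" and v: "proj_gap P R *v v = v"
  shows "v = 0"
proof (rule ccontr)
  assume "v \<noteq> 0"
  obtain Y :: "real^'n^'n" where Y: "Y \<in> stiefel I" "Y ** transpose Y = R"
    using stiefel_frame_exists[OF R] by blast
  have P: "transpose P = P" "P ** P = P" using stiefel_projector[OF U(1)] U(2) by auto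
  note id = stiefel_mult(1,2)
  have id_t: "id_on I ** transpose Z = transpose Z" if "Z \<in> stiefel I" for Z :: "real^'n^'n"
  proof -
    show ?thesis using id(2)[OF that] by (metis matrix_transpose_mul transpose_id_on)
  qed
  have rank: "\<not> rank (transpose U ** Y) < card I" using cut U Y by (auto simp: cut_locus_def)
  have no_kernel: False if A: "A \<in> stiefel I" and B: "B \<in> stiefel I"
    and w: "B ** transpose B *v w = w" "A ** transpose A *v w = 0" "w \<noteq> 0"
    and rk: "\<not> rank (transpose A ** B) < card I" for A B :: "real^'n^'n" and w
  proof -
    let ?z = "transpose B *v w"
    have Bz: "B *v ?z = w" using w(1) by (simp add: matrix_vector_mul_assoc)
    have "transpose A *v w = transpose A *v (A ** transpose A *v w)"
      by (simp add: matrix_vector_mul_assoc matrix_mul_assoc id[OF A] id_t[OF A])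
    then have "transpose A *v w = 0" using w(2) by simp
    then have "(transpose A ** B) *v ?z = 0" by (simp add: matrix_vector_mul_assoc[symmetric] Bz)
    moreover have "?z \<noteq> 0" using Bz w(3) by auto
    moreover have "id_on I *v ?z = ?z" by (simp add: matrix_vector_mul_assoc id_t[OF B])
    moreover have "transpose A ** B ** id_on I = transpose A ** B"
      by (simp add: matrix_mul_assoc[symmetric] id[OF B])
    ultimately show False using rank_less_if_kernel rk by blast
  qed
  have gap_P: "P ** proj_gap P R = P - P ** R ** P" and gap_R: "R ** proj_gap P R = R - R ** P ** R"
    by (simp_all add: proj_gap_def matrix_distribs matrix_mul_assoc P R)
  have PRP: "R *v (P *v v) = 0"
  proof -
    have "P *v v = (P ** proj_gap P R) *v v" by (simp add: matrix_vector_mul_assoc[symmetric] v)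
    then have "P *v (R *v (P *v v)) = 0" by (simp add: gap_P matrix_vector_simps)
    then have "(R *v (P *v v)) \<bullet> (R *v (P *v v)) = 0"
      by (metis P(1) R(1,2) inner_matrix_vector_left inner_zero_right matrix_vector_mul_assoc)
    then show ?thesis by simp
  qed
  have RPR: "P *v (R *v v) = 0"
  proof -
    have "R *v v = (R ** proj_gap P R) *v v" by (simp add: matrix_vector_mul_assoc[symmetric] v)
    then have "R *v (P *v (R *v v)) = 0" by (simp add: gap_R matrix_vector_simps)
    then have "(P *v (R *v v)) \<bullet> (P *v (R *v v)) = 0"
      by (metis P(1,2) R(1) inner_matrix_vector_left inner_zero_right matrix_vector_mul_assoc)
    then show ?thesis by simp
  qed
  have "P *v v = 0"
  proof (rule ccontr)
    assume nz: "P *v v \<noteq> 0"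
    \<comment> \<open>For P v the frames exchange roles; transposition preserves the rank.\<close>
    have "rank (transpose Y ** U) = rank (transpose U ** Y)"
      by (metis matrix_transpose_mul rank_transpose transpose_transpose)
    then show False
      using no_kernel[OF Y(1) U(1), of "P *v v"] nz PRP rank by (simp add: U(2) Y(2) matrix_vector_mul_assoc P)
  qed
  moreover have "R *v v = 0"
  proof (rule ccontr)
    assume nz: "R *v v \<noteq> 0"
    show False
      using no_kernel[OF U(1) Y(1), of "R *v v"] nz RPR rank by (simp add: U(2) Y(2) matrix_vector_mul_assoc R)
  qed
  ultimately have "proj_gap P R *v v = 0"
    by (simp add: proj_gap_def matrix_vector_mul_assoc[symmetric] matrix_vector_simps)
  then show False using v \<open>v \<noteq> 0\<close> by simp
qed

section \<open>Disjoint blocks, the determinant criterion and the assembly of the theorem\<close>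

lemma block_disjoint:
  assumes "i \<noteq> j"
  shows "block q i \<inter> (block q j :: 'n::{finite,linorder} set) = {}"
proof -
  have "block q a \<inter> (block q b :: 'n set) = {}" if "a < b" for a b
  proof -
    have "sum q {1..a} \<le> sum q {1..<b}" using that by (intro sum_mono2) auto
    then show ?thesis by (auto simp: block_def)
  qed
  then show ?thesis using assms by (metis Int_commute linorder_neqE_nat)
qed

lemma id_on_disjoint: "I \<inter> K = {} \<Longrightarrow> id_on I ** id_on K = 0"
  by (auto simp: vec_eq_iff matrix_matrix_mult_def id_on_component intro!: sum.neutral)

lemma continuous_on_det:
  fixes f :: "real \<Rightarrow> real^'n^'n"
  assumes "continuous_on J f"
  shows "continuous_on J (\<lambda>x. det (f x))"
  unfolding det_def
  by (intro continuous_intros bounded_linear.continuous_on[OF bounded_linear_vec_nth] assms)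

text \<open>This turns the absence of right angles into the nonvanishing of a continuous function,
  an open condition.\<close>

lemma det_one_minus_nonzero_iff:
  fixes E :: "real^'n^'n"
  shows "det (mat 1 - E) \<noteq> 0 \<longleftrightarrow> (\<forall>v. E *v v = v \<longrightarrow> v = 0)"
proof -
  have "det (mat 1 - E) \<noteq> 0 \<longleftrightarrow> (\<exists>B. B ** (mat 1 - E) = mat 1)"
    by (simp add: invertible_det_nz[symmetric] invertible_left_inverse)
  moreover have "(mat 1 - E) *v v = 0 \<longleftrightarrow> E *v v = v" for v
    by (auto simp: matrix_vector_simps)
  ultimately show ?thesis by (simp add: matrix_left_invertible_ker)
qed

theorem mainTheorem8:
  fixes S :: "real \<Rightarrow> real^('n::{finite,linorder})^('n::{finite,linorder})"
    and J :: "real set" and x0 :: real and r :: nat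
    and Q0 :: "real^('n::{finite,linorder})^('n::{finite,linorder})"
  assumes "open J" and "is_interval J" and "x0 \<in> J"
    and "real_analytic_curve_on S J"
    and "\<And>x. x \<in> J \<Longrightarrow> transpose (S x) = S x"
    and "\<And>x. x \<in> J \<Longrightarrow> card (eigenvalues (S x)) = r"
    and "eigenvector_matrix (S x0) Q0"
  shows "(\<forall>x\<in>J. \<forall>i\<in>{1..r}. flag_type (S x) i = flag_type (S x0) i) \<and>
    smooth_curve_on (holonomy_lift S x0 Q0) (holonomy_domain S J x0) \<and>
    (\<forall>x\<in>holonomy_domain S J x0. eigenvector_matrix (S x) (holonomy_lift S x0 Q0 x)) \<and>
    (\<forall>x\<in>holonomy_domain S J x0. \<forall>i\<in>{1..r}.
       let I = block (flag_type (S x0)) i in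
       is_arg_min (geodesic_dist (stiefel I) (restrict_cols I Q0))
         (\<lambda>W. W \<in> stiefel I \<and> W ** transpose W = eigproj (S x) i)
         (restrict_cols I (holonomy_lift S x0 Q0 x)))"
proof -
  interpret isospectral_type_curve S J r
    using assms analytic_Ck_on by unfold_locales auto
  define q where "q = flag_type (S x0)"
  define I :: "nat \<Rightarrow> 'n set" where "I = block q"
  define U where "U i = restrict_cols (I i) Q0" for i
  define H where "H i x = holonomy (I i) (pr i x0) (pr i x) (U i)" for i x
  have flag: "flag_type (S x) i = q i" if "x \<in> J" "i \<in> {1..r}" for x i
    unfolding q_def using assms(2,3) that by (intro flag_type_constant) (auto simp: is_interval_connected)
  note props = symmetric_matrix.eigproj_props[OF S_matrix]
  have basis0: "orthonormal_basis (I i) (\<lambda>j. column j Q0) (eigenspace (S x0) (ev i x0))" if "i \<in> {1..r}" for i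
    using assms(3,7) that S_card by (simp add: eigenvector_matrix_def I_def q_def)
  have U: "U i \<in> stiefel (I i)" "U i ** transpose (U i) = pr i x0" "card (I i) = q i" if i: "i \<in> {1..r}" for i
  proof -
    show st: "U i \<in> stiefel (I i)" unfolding U_def using basis0[OF i] by (rule orthonormal_basis_stiefel)
    have "range ((*v) (U i ** transpose (U i))) = span ((\<lambda>j. column j (U i)) ` I i)"
      using stiefel_projector(3)[OF st] by (simp add: orthonormal_basis_def)
    also have "(\<lambda>j. column j (U i)) ` I i = (\<lambda>j. column j Q0) ` I i"
      by (intro image_cong) (auto simp: U_def column_restrict_cols)
    also have "span \<dots> = range ((*v) (pr i x0))"
      using basis0[OF i] props(3)[OF assms(3)] by (simp add: orthonormal_basis_def)
    finally show "U i ** transpose (U i) = pr i x0"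
      by (rule orthogonal_projector_unique[OF stiefel_projector(1,2)[OF st] props(1,2)[OF assms(3)]])
    show "card (I i) = q i"
      using orthonormal_basis_card[OF basis0[OF i]] props(3)[OF assms(3), of i]
      by (simp add: q_def flag_type_def rank_dim_range)
  qed
  \<comment> \<open>The open set J' of nonvanishing determinants contains the domain of the lift;
    all differentiation takes place on J'.\<close>
  define \<delta> where "\<delta> i x = det (mat 1 - proj_gap (pr i x0) (pr i x))" for i x
  define J' where "J' = {x\<in>J. \<forall>i\<in>{1..r}. \<delta> i x \<noteq> 0}"
  have pr_Ck: "Ck_on k (pr i) J" if "i \<in> {1..r}" for i k using ev_pr_Ck that by blast
  have "open J'"
  proof -
    have "open {x\<in>J. \<delta> i x \<noteq> 0}" if "i \<in> {1..r}" for i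
    proof -
      have "continuous_on J (\<lambda>x. \<delta> i x)"
        unfolding \<delta>_def proj_gap_def using pr_Ck[OF that, of 0]
        by (intro continuous_on_det continuous_intros matrix_mult.continuous_on) auto
      then have "open (J \<inter> (\<lambda>x. \<delta> i x) -` (- {0}))"
        using assms(1) by (rule continuous_open_preimage) auto
      moreover have "J \<inter> (\<lambda>x. \<delta> i x) -` (- {0}) =
          {x\<in>J. \<delta> i x \<noteq> 0}" by auto
      ultimately show ?thesis by simp
    qed
    then have "open (J \<inter> (\<Inter>i\<in>{1..r}. {x\<in>J. \<delta> i x \<noteq> 0}))"
      using assms(1) by (intro open_Int open_INT) auto
    moreover have "J' = J \<inter> (\<Inter>i\<in>{1..r}. {x\<in>J. \<delta> i x \<noteq> 0})"
      by (auto simp: J'_def)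
    ultimately show ?thesis by simp
  qed
  have domain: "holonomy_domain S J x0 \<subseteq> J'"
  proof
    fix x assume "x \<in> holonomy_domain S J x0"
    then have x: "x \<in> J" and cut: "\<And>i. i \<in> {1..r} \<Longrightarrow> pr i x \<notin> cut_locus (I i) (pr i x0)"
      unfolding holonomy_domain_def I_def q_def using connected_component_subset S_card[OF assms(3)] by fastforce+
    have "v = 0" if i: "i \<in> {1..r}" and v: "proj_gap (pr i x0) (pr i x) *v v = v" for i v
      by (rule no_right_angle_if_not_cut[OF U(1,2)[OF i] props(1,2)[OF x] _ cut[OF i] v])
        (use flag[OF x i] U(3)[OF i] in \<open>simp add: flag_type_def\<close>)
    then show "x \<in> J'" using x by (simp add: J'_def \<delta>_def det_one_minus_nonzero_iff)
  qed
  have pair: "projector_pair (pr i x0) (pr i x)" if "x \<in> J'" "i \<in> {1..r}" for i x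
  proof -
    have "x \<in> J" and nz: "\<delta> i x \<noteq> 0" using that by (auto simp: J'_def)
    then show ?thesis using props(1,2)[OF assms(3)] props(1,2)[OF \<open>x \<in> J\<close>] nz[unfolded \<delta>_def det_one_minus_nonzero_iff]
      by unfold_locales auto
  qed
  have H: "H i x \<in> stiefel (I i)" "H i x ** transpose (H i x) = pr i x"
    if "x \<in> J'" "i \<in> {1..r}" for i x
    using projector_pair.holonomy_stiefel(1,2)[OF pair[OF that] U(1,2)[OF that(2)]] by (simp_all add: H_def)
  have Hid: "H i x ** id_on (I i) = H i x" if "x \<in> J'" "i \<in> {1..r}" for i x
    using H(1)[OF that] by (simp add: stiefel_def restrict_cols_eq)
  have lift: "holonomy_lift S x0 Q0 x = (\<Sum>i\<in>{1..r}. H i x)" if "x \<in> J'" for x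
    unfolding holonomy_lift_def S_card[OF assms(3)] Let_def
    by (intro sum.cong refl) (use Hid[OF that] in \<open>simp add: H_def U_def I_def q_def restrict_cols_eq\<close>)
  have disj: "id_on (I i) ** id_on (I k) = 0" if "i \<noteq> k" for i k
    using block_disjoint[OF that] unfolding I_def by (rule id_on_disjoint)
  have restrict: "restrict_cols (I k) (holonomy_lift S x0 Q0 x) = H k x" if x: "x \<in> J'" and k: "k \<in> {1..r}" for x k
  proof -
    have "restrict_cols (I k) (holonomy_lift S x0 Q0 x) = (\<Sum>i\<in>{1..r}. H i x ** id_on (I k))"
      by (simp add: lift[OF x] restrict_cols_eq matrix_mult.sum_left)
    also have "\<dots> = (\<Sum>i\<in>{1..r}. if i = k then H k x else 0)"
    proof (rule sum.cong[OF refl])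
      fix i assume i: "i \<in> {1..r}"
      have "H i x ** id_on (I k) = H i x ** (id_on (I i) ** id_on (I k))"
        by (simp add: matrix_mul_assoc Hid[OF x i])
      then show "H i x ** id_on (I k) = (if i = k then H k x else 0)"
        using disj[of i k] Hid[OF x k] by auto
    qed
    finally show ?thesis using k by simp
  qed
  have "smooth_curve_on (holonomy_lift S x0 Q0) (holonomy_domain S J x0)"
  proof (rule smooth_curve_on_if_Ck_on[OF \<open>open J'\<close> domain])
    fix k
    have "Ck_on k (H i) J'" if i: "i \<in> {1..r}" for i
    proof -
      have "projector_curve (pr i x0) (pr i) J'"
        using \<open>open J'\<close> pair[OF _ i] Ck_on_subset[OF pr_Ck[OF i], of J']
        by (intro projector_curve.intro) (auto simp: J'_def)
      then show ?thesis unfolding H_def using U(1,2)[OF i] by (rule projector_curve.holonomy_Ck)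
    qed
    then have "Ck_on k (\<lambda>x. \<Sum>i\<in>{1..r}. H i x) J'" by (intro Ck_on_sum) auto
    then show "Ck_on k (holonomy_lift S x0 Q0) J'"
      by (rule Ck_on_cong[OF \<open>open J'\<close>, rotated]) (simp add: lift)
  qed
  moreover have "eigenvector_matrix (S x) (holonomy_lift S x0 Q0 x)" if "x \<in> holonomy_domain S J x0" for x
  proof -
    have x': "x \<in> J'" using that domain by blast
    then have x: "x \<in> J" by (simp add: J'_def)
    let ?Q = "holonomy_lift S x0 Q0 x"
    have cross: "H i x ** transpose (H k x) = 0" if "i \<in> {1..r}" "k \<in> {1..r}" "i \<noteq> k" for i k
    proof -
      have t: "id_on (I k) ** transpose (H k x) = transpose (H k x)"
        using Hid[OF x' that(2)] by (metis matrix_transpose_mul transpose_id_on)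
      have "H i x ** transpose (H k x) = (H i x ** id_on (I i)) ** (id_on (I k) ** transpose (H k x))"
        unfolding t Hid[OF x' that(1)] ..
      also have "\<dots> = H i x ** (id_on (I i) ** id_on (I k)) ** transpose (H k x)"
        by (simp add: matrix_mul_assoc)
      finally show ?thesis by (simp add: disj[OF that(3)])
    qed
    \<comment> \<open>Blocks on disjoint columns have vanishing mixed products, so only the
      projectors remain, and they sum to the identity.\<close>
    have "?Q ** transpose ?Q = (\<Sum>i\<in>{1..r}. \<Sum>k\<in>{1..r}. H i x ** transpose (H k x))"
      unfolding lift[OF x'] linear_sum[OF linear_transpose] matrix_mult.sum_left matrix_mult.sum_right
      by (rule sum.swap)
    also have "\<dots> = (\<Sum>i\<in>{1..r}. pr i x)"
    proof (rule sum.cong[OF refl])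
      fix i assume i: "i \<in> {1..r}"
      have "(\<Sum>k\<in>{1..r}. H i x ** transpose (H k x)) = (\<Sum>k\<in>{1..r}. if k = i then pr i x else 0)"
        using i cross[OF i] H(2)[OF x' i] by (intro sum.cong) auto
      then show "(\<Sum>k\<in>{1..r}. H i x ** transpose (H k x)) = pr i x" using i by simp
    qed
    also have "\<dots> = mat 1" using symmetric_matrix.sum_eigproj[OF S_matrix[OF x]] S_card[OF x] by simp
    finally have "orthogonal_matrix ?Q" by (simp add: orthogonal_matrix matrix_left_right_inverse)
    moreover have "orthonormal_basis (block (flag_type (S x)) i) (\<lambda>j. column j ?Q) (eigenspace (S x) (ev i x))"
      if i: "i \<in> {1..r}" for i
    proof -
      \<comment> \<open>The types are known to agree on indices 1 to r only; the sums defining the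
        block involve no others.\<close>
      have "block (flag_type (S x)) i = I i"
      proof -
        have "sum (flag_type (S x)) {1..<i} = sum q {1..<i}" "sum (flag_type (S x)) {1..i} = sum q {1..i}"
          using flag[OF x] i by (auto intro!: sum.cong)
        then show ?thesis by (simp add: I_def block_def)
      qed
      moreover have "orthonormal_basis (I i) (\<lambda>j. column j (H i x)) (eigenspace (S x) (ev i x))"
        using stiefel_projector(3)[OF H(1)[OF x' i]] by (simp add: H(2)[OF x' i] props(3)[OF x])
      moreover have "column j (H i x) = column j ?Q" if "j \<in> I i" for j
        using restrict[OF x' i] column_restrict_cols[of j "I i" ?Q] that by simp
      ultimately show ?thesis by (simp add: orthonormal_basis_def cong: image_cong)
    qed
    ultimately show ?thesis by (simp add: eigenvector_matrix_def S_card[OF x])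
  qed
  moreover have "is_arg_min (geodesic_dist (stiefel (I i)) (U i))
      (\<lambda>W. W \<in> stiefel (I i) \<and> W ** transpose W = pr i x)
      (restrict_cols (I i) (holonomy_lift S x0 Q0 x))"
    if "x \<in> holonomy_domain S J x0" "i \<in> {1..r}" for x i
  proof -
    have x': "x \<in> J'" using that domain by blast
    show ?thesis
      unfolding restrict[OF x' that(2)] H_def
      by (rule projector_pair.holonomy_is_arg_min[OF pair[OF x' that(2)] U(1,2)[OF that(2)]])
  qed
  ultimately show ?thesis
    using flag by (auto simp: Let_def U_def I_def q_def)
qed

end
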